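(* Let $X$ be an irreducible curve of $\mathbb{P}_2$ of degree $d$. For every sequence of integers $(n_i)_{0\le i\le d-1}$ satisfying $n_i\ge i$ for $0\le i\le d-1$ and $n_i\le n_{i+1}\le n_i+1$ for $0\le i\le d-2$, there exists a group of points $Y$ on $X$ whose relative characteristic sequence (relative to $X$) is $(n_i)$.
   Context: $k$ is an algebraically closed field of characteristic $0$, $A_2=k[X_0,X_1,X_2]$. A projective subscheme $X\subset\mathbb{P}_2$ is given by its saturated homogeneous ideal $I_X$, and $A_X=A_2/I_X$. "Irreducible" means that $I_X$ is prime. A group of points on $X$ is a closed subscheme $Y\subset X$ of pure dimension $0$ (not necessarily reduced); the empty group of points is allowed (with $I_Y=A_2$). Relative characteristic sequence: let $Y_0,Y_1$ be linear forms with no common zero on $X$, $R_1=k[Y_0,Y_1]$. The kernel $I_{Y/X}=I_Y/I_X$ of $A_X\to A_Y$ is a graded free $R_1$-module of rank $d$, $I_{Y/X}\simeq\bigoplus_{i=0}^{d-1}R_1[-n_i]$ with $n_0\le\dots\le n_{d-1}$, where $R_1[a](l)=R_1(a+l)$; $(n_i)$ is the relative characteristic sequence of $Y$ in $X$ (it does not depend on the choice of $Y_0,Y_1$). *)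

theory Defs
  imports
    "HOL-Library.Poly_Mapping"
    "HOL-Library.Numeral_Type"
    "HOL-Library.FuncSet"
    "HOL-Computational_Algebra.Polynomial"
    "HOL-Algebra.QuotRing"
    "HOL-Algebra.Algebraic_Closure_Type"
begin

section \<open>The polynomial ring in three variables\<close>

text \<open>
  Monomials are exponent vectors \<open>3 \<Rightarrow>\<^sub>0 nat\<close> indexed by the three-element type \<open>3\<close>; the
  multiplication of \<^typ>\<open>(3 \<Rightarrow>\<^sub>0 nat) \<Rightarrow>\<^sub>0 'k::comm_ring_1\<close> provided by the library is the
  convolution product, i.e. the product of polynomials.
\<close>

type_synonym 'k poly3 = "(3 \<Rightarrow>\<^sub>0 nat) \<Rightarrow>\<^sub>0 'k"

abbreviation A2 :: "'k::field poly3 ring" where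
  "A2 \<equiv> ring_of_type_algebra"

definition var :: "3 \<Rightarrow> 'k::field poly3" where
  "var i = Poly_Mapping.single (Poly_Mapping.single i 1) 1"

definition scale :: "'k::field \<Rightarrow> 'k poly3 \<Rightarrow> 'k poly3" where
  "scale c f = Poly_Mapping.single 0 c * f"

lemma vector_space_scale: "vector_space (scale :: 'k::field \<Rightarrow> _)"
  by unfold_locales
    (simp_all add: scale_def distrib_left distrib_right single_add mult_single flip: mult.assoc single_one)

definition mon_deg :: "(3 \<Rightarrow>\<^sub>0 nat) \<Rightarrow> nat" where
  "mon_deg m = (\<Sum>i\<in>UNIV. Poly_Mapping.lookup m i)"

text \<open>Degrees are integers, so that the component of negative degree is \<open>{0}\<close>.\<close>

definition forms :: "int \<Rightarrow> 'k::field poly3 set" where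
  "forms l = {f. \<forall>m\<in>Poly_Mapping.keys f. int (mon_deg m) = l}"

definition hom_component :: "nat \<Rightarrow> 'k::field poly3 \<Rightarrow> 'k poly3" where
  "hom_component l f =
    (\<Sum>m | m \<in> Poly_Mapping.keys f \<and> mon_deg m = l. Poly_Mapping.single m (Poly_Mapping.lookup f m))"

definition homogeneous_ideal :: "'k::field poly3 set \<Rightarrow> bool" where
  "homogeneous_ideal I \<longleftrightarrow> ideal I A2 \<and> (\<forall>f\<in>I. \<forall>l. hom_component l f \<in> I)"

definition saturated :: "'k::field poly3 set \<Rightarrow> bool" where
  "saturated I \<longleftrightarrow> (\<forall>f. (\<forall>i. \<exists>N. var i ^ N * f \<in> I) \<longrightarrow> f \<in> I)"


section \<open>Closed subschemes of the projective plane\<close>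

text \<open>A closed subscheme is represented by its saturated homogeneous ideal.\<close>

definition closed_subscheme :: "'k::field poly3 set \<Rightarrow> bool" where
  "closed_subscheme I \<longleftrightarrow> homogeneous_ideal I \<and> saturated I"

text \<open>
  The points of \<open>Proj (A2/I)\<close>, as homogeneous primes of \<open>A2\<close> that contain \<open>I\<close> but not the
  irrelevant ideal. The closure of a point \<open>P\<close> is \<open>proj_points P\<close>.
\<close>

definition proj_points :: "'k::field poly3 set \<Rightarrow> 'k poly3 set set" where
  "proj_points I = {P. primeideal P A2 \<and> homogeneous_ideal P \<and> I \<subseteq> P \<and> (\<exists>i. var i \<notin> P)}"

text \<open>Krull dimension: the supremum of the lengths of the strict chains of points is \<open>n\<close>.\<close>

definition has_dim :: "'k::field poly3 set set \<Rightarrow> nat \<Rightarrow> bool" where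
  "has_dim S n \<longleftrightarrow>
    (\<exists>C. subset.chain S C \<and> finite C \<and> card C = Suc n) \<and>
    (\<forall>C. subset.chain S C \<and> finite C \<longrightarrow> card C \<le> Suc n)"

text \<open>Every irreducible component has dimension \<open>n\<close>; this holds for the empty subscheme.\<close>

definition pure_dim :: "'k::field poly3 set \<Rightarrow> nat \<Rightarrow> bool" where
  "pure_dim I n \<longleftrightarrow>
    (\<forall>P\<in>proj_points I. (\<forall>Q\<in>proj_points I. Q \<subseteq> P \<longrightarrow> Q = P) \<longrightarrow> has_dim (proj_points P) n)"

text \<open>The dimension of the component of degree \<open>l\<close> of \<open>A2/I\<close>.\<close>

definition hilbert_fun :: "'k::field poly3 set \<Rightarrow> nat \<Rightarrow> nat" where
  "hilbert_fun I l =
    vector_space.dim scale (forms (int l) :: 'k poly3 set) - vector_space.dim scale (forms (int l) \<inter> I)"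

text \<open>\<open>d\<close> is \<open>r!\<close> times the leading coefficient of the Hilbert polynomial, whose degree is \<open>r\<close>.\<close>

definition has_degree :: "'k::field poly3 set \<Rightarrow> nat \<Rightarrow> nat \<Rightarrow> bool" where
  "has_degree I r d \<longleftrightarrow>
    (\<exists>p :: rat Polynomial.poly. Polynomial.degree p = r \<and>
       fact r * Polynomial.lead_coeff p = of_nat d \<and>
       (\<forall>\<^sub>F l in sequentially. of_nat (hilbert_fun I l) = Polynomial.poly p (of_nat l)))"

definition curve_of_degree :: "'k::field poly3 set \<Rightarrow> nat \<Rightarrow> bool" where
  "curve_of_degree I d \<longleftrightarrow> closed_subscheme I \<and> pure_dim I 1 \<and> has_degree I 1 d"

definition group_of_points_on :: "'k::field poly3 set \<Rightarrow> 'k poly3 set \<Rightarrow> bool" where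
  "group_of_points_on IY IX \<longleftrightarrow> closed_subscheme IY \<and> IX \<subseteq> IY \<and> pure_dim IY 0"


section \<open>The relative characteristic sequence\<close>

definition no_common_zero ::
  "'k::field poly3 set \<Rightarrow> 'k poly3 \<Rightarrow> 'k poly3 \<Rightarrow> bool" where
  "no_common_zero IX Y0 Y1 \<longleftrightarrow> \<not> (\<exists>P\<in>proj_points IX. Y0 \<in> P \<and> Y1 \<in> P)"

text \<open>The subalgebra generated by two elements.\<close>

definition R1 :: "'k::field poly3 \<Rightarrow> 'k poly3 \<Rightarrow> 'k poly3 set" where
  "R1 Y0 Y1 = module.span scale {Y0 ^ a * Y1 ^ b | a b. True}"

text \<open>
  The graded module \<open>\<Oplus>\<^bsub>i<d\<^esub> R1[-n i]\<close>: the underlying set, and its component of degree \<open>l\<close>, in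
  accordance with \<open>R1[a](l) = R1(a + l)\<close>.
\<close>

definition free_module :: "'k::field poly3 \<Rightarrow> 'k poly3 \<Rightarrow> nat \<Rightarrow> (nat \<Rightarrow> 'k poly3) set" where
  "free_module Y0 Y1 d = (\<Pi>\<^sub>E i\<in>{..<d}. R1 Y0 Y1)"

definition free_module_part ::
  "'k::field poly3 \<Rightarrow> 'k poly3 \<Rightarrow> nat \<Rightarrow> (nat \<Rightarrow> int) \<Rightarrow> int \<Rightarrow> (nat \<Rightarrow> 'k poly3) set" where
  "free_module_part Y0 Y1 d n l = (\<Pi>\<^sub>E i\<in>{..<d}. R1 Y0 Y1 \<inter> forms (l - n i))"

text \<open>The image of \<open>S\<close> in \<open>A2/IX\<close>; in particular \<open>residues IX IY\<close> is \<open>IY/IX\<close>.\<close>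

definition residues :: "'k::field poly3 set \<Rightarrow> 'k poly3 set \<Rightarrow> 'k poly3 set set" where
  "residues IX S = (\<lambda>f. IX +>\<^bsub>A2\<^esub> f) ` S"

text \<open>\<open>\<phi>\<close> is an isomorphism of graded \<open>R1\<close>-modules from \<open>\<Oplus>\<^bsub>i<d\<^esub> R1[-n i]\<close> onto \<open>IY/IX\<close>.\<close>

definition graded_iso ::
  "'k::field poly3 set \<Rightarrow> 'k poly3 set \<Rightarrow> 'k poly3 \<Rightarrow> 'k poly3 \<Rightarrow> nat \<Rightarrow> (nat \<Rightarrow> int) \<Rightarrow>
    ((nat \<Rightarrow> 'k poly3) \<Rightarrow> 'k poly3 set) \<Rightarrow> bool" where
  "graded_iso IX IY Y0 Y1 d n \<phi> \<longleftrightarrow>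
    bij_betw \<phi> (free_module Y0 Y1 d) (residues IX IY) \<and>
    (\<forall>s\<in>free_module Y0 Y1 d. \<forall>t\<in>free_module Y0 Y1 d.
       \<phi> (\<lambda>i\<in>{..<d}. s i + t i) = \<phi> s \<oplus>\<^bsub>A2 Quot IX\<^esub> \<phi> t) \<and>
    (\<forall>r\<in>R1 Y0 Y1. \<forall>s\<in>free_module Y0 Y1 d.
       \<phi> (\<lambda>i\<in>{..<d}. r * s i) = (IX +>\<^bsub>A2\<^esub> r) \<otimes>\<^bsub>A2 Quot IX\<^esub> \<phi> s) \<and>
    (\<forall>l. \<phi> ` free_module_part Y0 Y1 d n l = residues IX (IY \<inter> forms l))"

text \<open>
  The sequence does not depend on the choice of \<open>Y0, Y1\<close>: all admissible choices are required
  to yield \<open>n\<close>, and there has to be at least one.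
\<close>

definition admissible :: "'k::field poly3 set \<Rightarrow> 'k poly3 \<Rightarrow> 'k poly3 \<Rightarrow> bool" where
  "admissible IX Y0 Y1 \<longleftrightarrow> Y0 \<in> forms 1 \<and> Y1 \<in> forms 1 \<and> no_common_zero IX Y0 Y1"

definition relative_characteristic_sequence ::
  "'k::field poly3 set \<Rightarrow> 'k poly3 set \<Rightarrow> nat \<Rightarrow> (nat \<Rightarrow> int) \<Rightarrow> bool" where
  "relative_characteristic_sequence IX IY d n \<longleftrightarrow>
    mono_on {..<d} n \<and>
    (\<exists>Y0 Y1. admissible IX Y0 Y1) \<and>
    (\<forall>Y0 Y1. admissible IX Y0 Y1 \<longrightarrow> (\<exists>\<phi>. graded_iso IX IY Y0 Y1 d n \<phi>))"

end

theory Submission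
  imports Defs
begin

text \<open>
  The ideal of \<open>X\<close> is generated by a form \<open>F\<close> of degree \<open>d\<close>. Project from a point \<open>w\<close> outside \<open>X\<close>:
  infinitely many lines through \<open>w\<close> meet \<open>X\<close> in \<open>d\<close> distinct points, because \<open>F\<close> is irreducible and
  the characteristic is zero. Put \<open>\<mu> i = n i - i\<close>, choose such lines with index \<open>j\<close>, and on each of
  them an enumeration of the points of \<open>X\<close> with index \<open>i < d\<close>. Then \<open>Y\<close> consists of the points
  \<open>(j, i)\<close> with \<open>j < \<mu> i\<close>.

  Start from the basis \<open>1, Z, \<dots>, Z^(d-1)\<close> of \<open>A_X\<close>, of degrees \<open>0, \<dots>, d - 1\<close>, and impose vanishing at
  the points one by one, in lexicographic order. If a graded basis of the current module is given
  and \<open>m\<close> is the least degree of a form in the current ideal that does not vanish at the new point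
  \<open>q\<close>, then some basis element of degree \<open>m\<close> does not vanish at \<open>q\<close>. Multiplying it by the linear
  form of \<open>R1\<close> that vanishes at \<open>q\<close>, and subtracting multiples of it from the other elements, gives a
  graded basis of the new module: one degree \<open>m\<close> has become \<open>m + 1\<close>. Since \<open>m\<close> only depends on the
  points, the result is the same for all admissible pairs of linear forms.

  For the point \<open>(j, i)\<close> one has \<open>m = i + j\<close>. A product of \<open>j\<close> lines through \<open>w\<close> and \<open>i\<close> further lines
  shows \<open>m \<le> i + j\<close>. Conversely, as \<open>\<mu>\<close> decreases in steps of at most one, a form of degree
  less than \<open>i + j\<close> that vanishes at the preceding points vanishes on the whole first line after a
  multiple of \<open>F\<close> has been subtracted; hence that line can be split off, which lowers both \<open>j\<close> and the
  degree by one.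
\<close>

section \<open>Polynomials in three variables\<close>

text \<open>All computation takes place in the chart Y0 = 1, where forms of degree l become exactly
  the polynomials in k[y][z] of total degree at most l. The lines through w are y = const, and F has
  the constant leading coefficient F(w) in z; so one can divide by F without denominators, and
  restriction to such a line never lowers its degree.

  That one form generates I_X needs an argument of its own: F is a nonzero form of least degree, w
  is put off its zeros, and the affine ideal is shown to be principal by pseudo-division and Gauss's
  lemma, one factor y - a at a time. The Hilbert function supplies the rest: its growth by d per
  degree rules out I_X = 0 and linear forms in I_X that vanish at w, and it forces deg F = d.

  The hypothesis on n says that \<mu> drops by 0 or 1 in each step. This staircase leaves at least
  min(d, i + j - j0) chosen points on every line j0 < j, just the number of zeros that forces a form
  of degree less than i + j - j0 to become a multiple of F on that line.\<close>

lemma scale_one [simp]: "scale 1 f = f"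
  by (simp add: scale_def single_one)

lemma scale_zero [simp]: "scale 0 f = 0" "scale c 0 = 0"
  by (simp_all add: scale_def)

lemma scale_add: "scale c (f + g) = scale c f + scale c g"
  by (simp add: scale_def distrib_left)

lemma scale_add_left: "scale (a + b) f = scale a f + scale b f"
  by (simp add: scale_def distrib_right single_add)

lemma scale_scale: "scale a (scale b f) = scale (a * b) f"
  by (simp add: scale_def mult_single flip: mult.assoc)

lemma scale_mult_left: "scale c f * g = scale c (f * g)"
  by (simp add: scale_def mult.assoc)

lemma scale_mult_right: "f * scale c g = scale c (f * g)"
  by (simp add: scale_def mult.left_commute)

lemma poly3_eq_sum: "(f :: 'k::field poly3) = (\<Sum>m\<in>Poly_Mapping.keys f. Poly_Mapping.single m (Poly_Mapping.lookup f m))"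
  by (rule poly_mapping_eqI)
     (auto simp: lookup_sum lookup_single when_def in_keys_iff sum.delta)

lemma poly3_induct [case_names single add]:
  fixes f :: "'k::field poly3"
  assumes "\<And>m c. P (Poly_Mapping.single m c)" "\<And>f g. P f \<Longrightarrow> P g \<Longrightarrow> P (f + g)"
  shows "P f"
proof -
  have z: "P 0" using assms(1)[of 0 0] by simp
  have "P (\<Sum>m\<in>M. Poly_Mapping.single m (Poly_Mapping.lookup f m))" if "finite M" for M
    using that by induction (auto simp: z assms)
  then show ?thesis using poly3_eq_sum[of f] by (metis finite_keys)
qed

lemma UNIV_3: "(UNIV :: 3 set) = {0, 1, 2}"
proof -
  have "card {0, 1, 2 :: 3} = 3" by (simp add: card_insert_if)
  then have "card {0, 1, 2 :: 3} = CARD(3)" by simp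
  then show ?thesis by (metis card_subset_eq finite subset_UNIV)
qed

lemma sum_3: "(\<Sum>i\<in>UNIV. f (i :: 3)) = f 0 + f 1 + f 2"
  unfolding UNIV_3 by (simp add: add.assoc)

lemma forall_3: "(\<forall>i :: 3. P i) \<longleftrightarrow> P 0 \<and> P 1 \<and> P 2"
proof -
  have "(\<forall>i :: 3. P i) \<longleftrightarrow> (\<forall>i \<in> UNIV. P i)" by simp
  then show ?thesis unfolding UNIV_3 by simp
qed

lemma mon_deg_add: "mon_deg (m + m') = mon_deg m + mon_deg m'"
  by (simp add: mon_deg_def lookup_add sum.distrib)

lemma mon_deg_0 [simp]: "mon_deg 0 = 0"
  by (simp add: mon_deg_def)

lemma mon_deg_single [simp]: "mon_deg (Poly_Mapping.single i a) = a"
  by (simp add: mon_deg_def lookup_single when_def sum.delta)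

lemma forms_0 [simp]: "0 \<in> forms l"
  by (simp add: forms_def)

lemma forms_add: "f \<in> forms l \<Longrightarrow> g \<in> forms l \<Longrightarrow> f + g \<in> forms l"
  using keys_add[of f g] by (auto simp: forms_def)

lemma forms_single: "Poly_Mapping.single m c \<in> forms (int (mon_deg m))"
  by (auto simp: forms_def)

lemma forms_mult: "f \<in> forms a \<Longrightarrow> g \<in> forms b \<Longrightarrow> f * g \<in> forms (a + b)"
  using keys_mult[of f g] by (fastforce simp: forms_def mon_deg_add)

lemma forms_scale: "f \<in> forms a \<Longrightarrow> scale c f \<in> forms a"
  using forms_mult[of "Poly_Mapping.single 0 c" 0 f a] forms_single[of 0 c]
  by (simp add: scale_def)

lemma forms_uminus: "f \<in> forms l \<Longrightarrow> - f \<in> forms l"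
  by (simp add: forms_def)

lemma forms_diff: "f \<in> forms l \<Longrightarrow> g \<in> forms l \<Longrightarrow> f - g \<in> forms l"
  using forms_add[of f l "- g"] forms_uminus[of g l] by simp

lemma forms_sum: "(\<And>i. i \<in> S \<Longrightarrow> f i \<in> forms l) \<Longrightarrow> sum f S \<in> forms l"
  by (induction S rule: infinite_finite_induct) (auto intro: forms_add)

lemma forms_1: "1 \<in> forms 0"
  using forms_single[of 0 1] by (simp add: single_one)

lemma forms_power: "f \<in> forms 1 \<Longrightarrow> f ^ a \<in> forms (int a)"
  by (induction a) (auto simp: forms_1 dest: forms_mult[of f 1])

lemma forms_var: "var i \<in> forms 1"
  using forms_single[of "Poly_Mapping.single i 1" 1] by (simp add: var_def)

lemma forms_neg: "l < 0 \<Longrightarrow> f \<in> forms l \<Longrightarrow> f = 0"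
  by (rule poly_mapping_eqI) (force simp: forms_def in_keys_iff)

lemma lookup_hom_component: "Poly_Mapping.lookup (hom_component l f) m = (if mon_deg m = l then Poly_Mapping.lookup f m else 0)"
  by (auto simp: hom_component_def lookup_sum lookup_single when_def in_keys_iff sum.delta)

lemma hom_component_forms: "hom_component l f \<in> forms (int l)"
  by (auto simp: forms_def in_keys_iff lookup_hom_component split: if_splits)

lemma hom_component_add: "hom_component l (f + g) = hom_component l f + hom_component l g"
  by (rule poly_mapping_eqI) (simp add: lookup_hom_component lookup_add)

lemma hom_component_0 [simp]: "hom_component l 0 = 0"
  by (rule poly_mapping_eqI) (simp add: lookup_hom_component)

lemma hom_component_sum: "hom_component l (sum f S) = (\<Sum>i\<in>S. hom_component l (f i))"
  by (induction S rule: infinite_finite_induct) (auto simp: hom_component_add)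

lemma hom_component_of_form: "f \<in> forms a \<Longrightarrow> hom_component l f = (if a = int l then f else 0)"
  by (rule poly_mapping_eqI) (auto simp: lookup_hom_component forms_def in_keys_iff)

lemma sum_hom_component:
  assumes "\<And>m. m \<in> Poly_Mapping.keys f \<Longrightarrow> mon_deg m \<le> N"
  shows "f = (\<Sum>l\<le>N. hom_component l f)"
  by (rule poly_mapping_eqI)
     (use assms in \<open>fastforce simp: lookup_sum lookup_hom_component in_keys_iff sum.delta\<close>)

lemma ex_sum_hom_component: "\<exists>N. \<forall>M\<ge>N. f = (\<Sum>l\<le>M. hom_component l f)"
proof -
  have "finite (mon_deg ` Poly_Mapping.keys f)" by simp
  then obtain N where "\<forall>x \<in> mon_deg ` Poly_Mapping.keys f. x \<le> N"
    by (meson finite_nat_set_iff_bounded_le)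
  then show ?thesis
    by (metis imageI order_trans sum_hom_component)
qed

lemma hom_component_eqI:
  assumes "\<And>l. hom_component l f = hom_component l g"
  shows "f = g"
  by (rule poly_mapping_eqI) (metis assms lookup_hom_component)

lemma hom_component_mult_form:
  assumes "e \<in> forms (int n)"
  shows "hom_component l (r * e) = (if n \<le> l then hom_component (l - n) r * e else 0)"
proof -
  obtain N where N: "r = (\<Sum>k\<le>N. hom_component k r)" and "l \<le> N"
    using ex_sum_hom_component[of r] by (metis le_cases)
  have "r * e = (\<Sum>k\<le>N. hom_component k r * e)"
    unfolding sum_distrib_right[symmetric] using N by (rule arg_cong)
  then have "hom_component l (r * e) = (\<Sum>k\<le>N. hom_component l (hom_component k r * e))"
    by (simp add: hom_component_sum)
  also have "\<dots> = (\<Sum>k\<le>N. if int k + int n = int l then hom_component k r * e else 0)"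
    using hom_component_of_form[OF forms_mult[OF hom_component_forms assms]] by simp
  also have "\<dots> = (\<Sum>k\<le>N. if n \<le> l \<and> k = l - n then hom_component k r * e else 0)"
    by (intro sum.cong) auto
  also have "\<dots> = (if n \<le> l then hom_component (l - n) r * e else 0)"
    using \<open>l \<le> N\<close> by (auto simp: sum.delta)
  finally show ?thesis .
qed

lemma single_eq_var_times:
  assumes "mon_deg m = Suc l"
  shows "\<exists>i m'. mon_deg m' = l \<and> Poly_Mapping.single m c = var i * Poly_Mapping.single m' c"
proof -
  obtain i where i: "Poly_Mapping.lookup m i \<noteq> 0"
    using assms unfolding mon_deg_def by (metis sum.neutral nat.distinct(1))
  define m' where "m' = m - Poly_Mapping.single i 1"
  have m: "m = Poly_Mapping.single i 1 + m'"
    using i by (intro poly_mapping_eqI) (auto simp: m'_def lookup_add lookup_minus lookup_single when_def)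
  then show ?thesis
    using assms by (intro exI[of _ i] exI[of _ m']) (auto simp: var_def mult_single mon_deg_add)
qed

text \<open>A form is a sum of monomials, and a monomial of positive degree is a variable times one
  of the next lower degree. \<open>P\<close> carries the degree because the step \<open>var\<close>
  changes it.\<close>

lemma forms_induct [consumes 1, case_names const var add]:
  fixes f :: "'k::field poly3"
  assumes "f \<in> forms (int l)"
    and const: "\<And>c. P 0 (Poly_Mapping.single 0 c)"
    and var: "\<And>l i g. g \<in> forms (int l) \<Longrightarrow> P l g \<Longrightarrow> P (Suc l) (var i * g)"
    and add: "\<And>l f g. f \<in> forms (int l) \<Longrightarrow> g \<in> forms (int l) \<Longrightarrow> P l f \<Longrightarrow> P l g \<Longrightarrow> P l (f + g)"
  shows "P l f"
proof -
  have s: "P l (Poly_Mapping.single m c)" if "mon_deg m = l" for m c l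
    using that
  proof (induction l arbitrary: m)
    case 0
    then have "m = 0"
      unfolding mon_deg_def by (intro poly_mapping_eqI) auto
    then show ?case using const by simp
  next
    case (Suc l)
    then obtain i m' where "mon_deg m' = l" "Poly_Mapping.single m c = var i * Poly_Mapping.single m' c"
      using single_eq_var_times by blast
    then show ?case using Suc.IH var forms_single by metis
  qed
  have z: "P l 0"
  proof (induction l)
    case 0 show ?case using const[of 0] by simp
  next
    case (Suc l) show ?case using var[OF forms_0 Suc, of 0] by simp
  qed
  have "P l (\<Sum>m\<in>M. Poly_Mapping.single m (Poly_Mapping.lookup f m)) \<and> (\<Sum>m\<in>M. Poly_Mapping.single m (Poly_Mapping.lookup f m)) \<in> forms (int l)"
    if "finite M" "M \<subseteq> Poly_Mapping.keys f" for M
    using that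
  proof (induction M)
    case empty then show ?case using z by simp
  next
    case (insert m M)
    have "mon_deg m = l" using insert.prems assms(1) by (auto simp: forms_def)
    then show ?case
      using insert add[OF forms_single] s forms_add[OF forms_single] by fastforce
  qed
  then show ?thesis using poly3_eq_sum[of f] by (metis finite_keys subset_refl)
qed

subsection \<open>Substitution homomorphisms\<close>

text \<open>\<open>c\<close> embeds the coefficients into the target ring. The targets used are k
  (evaluation), k[t] (restriction to a parametrised line) and k[y][z] (dehomogenisation).\<close>

definition psubst :: "('k::field \<Rightarrow> 'b::comm_ring_1) \<Rightarrow> (3 \<Rightarrow> 'b) \<Rightarrow> 'k poly3 \<Rightarrow> 'b" where
  "psubst c x f = (\<Sum>m\<in>Poly_Mapping.keys f. c (Poly_Mapping.lookup f m) * (\<Prod>i\<in>UNIV. x i ^ Poly_Mapping.lookup m i))"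

locale coeff_hom =
  fixes c :: "'k::field \<Rightarrow> 'b::comm_ring_1"
  assumes hom_0: "c 0 = 0" and hom_1: "c 1 = 1"
    and hom_add: "c (a + b) = c a + c b" and hom_mult: "c (a * b) = c a * c b"
begin

lemma psubst_superset:
  assumes "finite K" "Poly_Mapping.keys f \<subseteq> K"
  shows "psubst c x f = (\<Sum>m\<in>K. c (Poly_Mapping.lookup f m) * (\<Prod>i\<in>UNIV. x i ^ Poly_Mapping.lookup m i))"
  unfolding psubst_def using assms by (intro sum.mono_neutral_left) (auto simp: in_keys_iff hom_0)

lemma psubst_0: "psubst c x 0 = 0"
  by (simp add: psubst_def)

lemma psubst_add: "psubst c x (f + g) = psubst c x f + psubst c x g"
proof -
  let ?K = "Poly_Mapping.keys f \<union> Poly_Mapping.keys g"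
  have "Poly_Mapping.keys (f + g) \<subseteq> ?K" by (rule keys_add)
  then show ?thesis
    by (simp add: psubst_superset[of ?K] lookup_add hom_add distrib_right sum.distrib)
qed

lemma psubst_single: "psubst c x (Poly_Mapping.single m a) = c a * (\<Prod>i\<in>UNIV. x i ^ Poly_Mapping.lookup m i)"
  by (simp add: psubst_def hom_0)

lemma psubst_mult: "psubst c x (f * g) = psubst c x f * psubst c x g"
proof (induction f rule: poly3_induct)
  case (single m a)
  show ?case
  proof (induction g rule: poly3_induct)
    case (single m' b)
    show ?case
      by (simp add: mult_single psubst_single hom_mult lookup_add power_add prod.distrib mult_ac)
  qed (simp add: distrib_left psubst_add)
qed (simp add: distrib_right psubst_add)

lemma psubst_1: "psubst c x 1 = 1"
  using psubst_single[of x 0 1] by (simp add: single_one hom_1)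

lemma psubst_power: "psubst c x (f ^ n) = psubst c x f ^ n"
  by (induction n) (simp_all add: psubst_mult psubst_1)

lemma psubst_uminus: "psubst c x (- f) = - psubst c x f"
  using psubst_add[of x f "- f"] by (simp add: eq_neg_iff_add_eq_0 add.commute psubst_0)

lemma psubst_diff: "psubst c x (f - g) = psubst c x f - psubst c x g"
  using psubst_add[of x f "- g"] by (simp add: psubst_uminus)

lemma psubst_sum: "psubst c x (sum f S) = (\<Sum>i\<in>S. psubst c x (f i))"
  by (induction S rule: infinite_finite_induct) (auto simp: psubst_add psubst_0)

lemma psubst_const: "psubst c x (Poly_Mapping.single 0 a) = c a"
  by (simp add: psubst_single)

lemma psubst_scale: "psubst c x (scale a f) = c a * psubst c x f"
  by (simp add: scale_def psubst_mult psubst_const)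

lemma psubst_var: "psubst c x (var i) = x i"
  by (simp add: var_def psubst_single hom_1 lookup_single when_def if_distrib if_distribR prod.delta cong: if_cong)

end

definition ev :: "(3 \<Rightarrow> 'k::field) \<Rightarrow> 'k poly3 \<Rightarrow> 'k" where
  "ev = psubst (\<lambda>a. a)"

text \<open>The restriction of a polynomial to the line of scalar multiples of \<open>q\<close>.\<close>

definition cone :: "(3 \<Rightarrow> 'k::field) \<Rightarrow> 'k poly3 \<Rightarrow> 'k poly" where
  "cone q = psubst (\<lambda>a. [:a:]) (\<lambda>i. [:0, q i:])"

interpretation hom_id: coeff_hom "\<lambda>a. a :: 'k::field"
  by unfold_locales auto

interpretation hom_C: coeff_hom "\<lambda>a. [:a :: 'k::field:]"
  by unfold_locales (auto simp flip: one_pCons)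

interpretation hom_CC: coeff_hom "\<lambda>a. [:[:a :: 'k::field:]:]"
  by unfold_locales (auto simp flip: one_pCons)

lemma ev_simps:
  "ev q (f + g) = ev q f + ev q g" "ev q (f - g) = ev q f - ev q g"
  "ev q (f * g) = ev q f * ev q g" "ev q (f ^ m) = ev q f ^ m"
  "ev q (- f) = - ev q f" "ev q 0 = 0" "ev q 1 = 1"
  "ev q (sum F S) = (\<Sum>i\<in>S. ev q (F i))"
  "ev q (Poly_Mapping.single 0 a) = a" "ev q (scale a f) = a * ev q f"
  "ev q (var i) = q i"
  unfolding ev_def
  by (rule hom_id.psubst_add hom_id.psubst_diff hom_id.psubst_mult hom_id.psubst_power hom_id.psubst_uminus
        hom_id.psubst_0 hom_id.psubst_1 hom_id.psubst_sum hom_id.psubst_const hom_id.psubst_scale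
        hom_id.psubst_var)+

lemma cone_simps:
  "cone q (f + g) = cone q f + cone q g" "cone q (f - g) = cone q f - cone q g"
  "cone q (f * g) = cone q f * cone q g" "cone q (f ^ m) = cone q f ^ m"
  "cone q (- f) = - cone q f" "cone q 0 = 0" "cone q 1 = 1"
  "cone q (sum F S) = (\<Sum>i\<in>S. cone q (F i))"
  "cone q (Poly_Mapping.single 0 a) = [:a:]" "cone q (scale a f) = [:a:] * cone q f"
  "cone q (var i) = [:0, q i:]"
  unfolding cone_def
  by (rule hom_C.psubst_add hom_C.psubst_diff hom_C.psubst_mult hom_C.psubst_power hom_C.psubst_uminus
        hom_C.psubst_0 hom_C.psubst_1 hom_C.psubst_sum hom_C.psubst_const hom_C.psubst_scale
        hom_C.psubst_var)+

text \<open>Homogeneity: h(t q) = t^l h(q).\<close>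

lemma cone_form: "h \<in> forms (int l) \<Longrightarrow> cone q h = monom (ev q h) l"
proof (induction rule: forms_induct)
  case (const c)
  show ?case by (simp add: cone_simps ev_simps monom_0)
next
  case (var l i g)
  then show ?case by (simp add: cone_simps ev_simps monom_Suc smult_monom)
next
  case (add l f g)
  then show ?case by (simp add: cone_simps ev_simps add_monom)
qed

lemma coeff_cone: "coeff (cone q h) l = ev q (hom_component l h)"
proof -
  obtain N where N: "h = (\<Sum>k\<le>N. hom_component k h)" and "l \<le> N"
    using ex_sum_hom_component[of h] by (meson nle_le)
  have "cone q h = cone q (\<Sum>k\<le>N. hom_component k h)"
    using N by (rule arg_cong)
  also have "\<dots> = (\<Sum>k\<le>N. monom (ev q (hom_component k h)) k)"
    by (simp add: cone_simps cone_form[OF hom_component_forms])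
  finally have "cone q h = (\<Sum>k\<le>N. monom (ev q (hom_component k h)) k)" .
  then show ?thesis using \<open>l \<le> N\<close> by (simp add: coeff_sum sum.delta)
qed

section \<open>Ideals and points\<close>

lemma A2_simps [simp]:
  "carrier A2 = UNIV" "x \<otimes>\<^bsub>A2\<^esub> y = x * y" "x \<oplus>\<^bsub>A2\<^esub> y = x + y" "\<zero>\<^bsub>A2\<^esub> = 0" "\<one>\<^bsub>A2\<^esub> = 1"
  by (simp_all add: ring_of_type_algebra_def)

lemma ring_A2: "ring (A2 :: 'k::field poly3 ring)" and cring_A2: "cring (A2 :: 'k::field poly3 ring)"
  by (rule ring_from_type_algebra cring_from_type_algebra)+

lemma a_inv_A2: "\<ominus>\<^bsub>A2\<^esub> x = - (x :: 'k::field poly3)"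
proof -
  interpret ring "A2 :: 'k poly3 ring" by (rule ring_A2)
  show ?thesis by (rule minus_equality) simp_all
qed

lemma ideal_A2_iff:
  "ideal I (A2 :: 'k::field poly3 ring) \<longleftrightarrow> 0 \<in> I \<and> (\<forall>x\<in>I. \<forall>y\<in>I. x + y \<in> I) \<and> (\<forall>a. \<forall>x\<in>I. a * x \<in> I)"
proof
  assume "ideal I (A2 :: 'k poly3 ring)"
  then interpret ideal I "A2 :: 'k poly3 ring" .
  show "0 \<in> I \<and> (\<forall>x\<in>I. \<forall>y\<in>I. x + y \<in> I) \<and> (\<forall>a. \<forall>x\<in>I. a * x \<in> I)"
    using additive_subgroup.zero_closed[OF additive_subgroup_axioms]
      additive_subgroup.a_closed[OF additive_subgroup_axioms] I_l_closed by simp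
next
  assume *: "0 \<in> I \<and> (\<forall>x\<in>I. \<forall>y\<in>I. x + y \<in> I) \<and> (\<forall>a. \<forall>x\<in>I. a * x \<in> I)"
  have neg: "- x \<in> I" if "x \<in> I" for x
    using * that by (metis mult_minus1)
  show "ideal I (A2 :: 'k poly3 ring)"
  proof (rule idealI[OF ring_A2])
    show "subgroup I (add_monoid (A2 :: 'k poly3 ring))"
    proof
      fix x assume "x \<in> I"
      then show "inv\<^bsub>add_monoid A2\<^esub> x \<in> I"
        using neg a_inv_A2[of x] by (simp add: a_inv_def)
    qed (use * in simp_all)
    next
    fix a x assume "a \<in> I"
    then show "x \<otimes>\<^bsub>A2\<^esub> a \<in> I" "a \<otimes>\<^bsub>A2\<^esub> x \<in> I"
      using * by (simp_all add: mult.commute[of a])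
  qed
qed

lemma primeideal_A2_iff:
  "primeideal I (A2 :: 'k::field poly3 ring) \<longleftrightarrow>
     ideal I A2 \<and> 1 \<notin> I \<and> (\<forall>a b. a * b \<in> I \<longrightarrow> a \<in> I \<or> b \<in> I)"
proof
  assume "primeideal I (A2 :: 'k poly3 ring)"
  then interpret primeideal I "A2 :: 'k poly3 ring" .
  have "1 \<notin> I" using one_imp_carrier I_notcarr by auto
  then show "ideal I A2 \<and> 1 \<notin> I \<and> (\<forall>a b. a * b \<in> I \<longrightarrow> a \<in> I \<or> b \<in> I)"
    using I_prime ideal_axioms by simp
next
  assume *: "ideal I A2 \<and> 1 \<notin> I \<and> (\<forall>a b. a * b \<in> I \<longrightarrow> a \<in> I \<or> b \<in> I)"
  then have "ideal I (A2 :: 'k poly3 ring)" by simp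
  moreover have "I \<noteq> UNIV" using * by auto
  ultimately show "primeideal I (A2 :: 'k poly3 ring)"
    using * by (intro primeidealI cring_A2) auto
qed

lemma coset_A2: "I +>\<^bsub>A2\<^esub> f = {i + f | i. i \<in> I}"
  by (auto simp: a_r_coset_def r_coset_def)

locale poly3_ideal =
  fixes I :: "'k::field poly3 set"
  assumes ideal: "ideal I A2"
begin

lemma zero_in: "0 \<in> I" and add_in: "x \<in> I \<Longrightarrow> y \<in> I \<Longrightarrow> x + y \<in> I" and mult_in: "x \<in> I \<Longrightarrow> a * x \<in> I"
  using ideal unfolding ideal_A2_iff by auto

lemma mult_in': "x \<in> I \<Longrightarrow> x * a \<in> I"
  using mult_in[of x a] by (simp add: mult.commute)

lemma uminus_in: "x \<in> I \<Longrightarrow> - x \<in> I"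
  using mult_in[of x "-1"] by simp

lemma diff_in: "x \<in> I \<Longrightarrow> y \<in> I \<Longrightarrow> x - y \<in> I"
  using add_in[of x "- y"] uminus_in[of y] by simp

lemma sum_in: "(\<And>i. i \<in> S \<Longrightarrow> f i \<in> I) \<Longrightarrow> sum f S \<in> I"
  by (induction S rule: infinite_finite_induct) (auto intro: add_in zero_in)

lemma scale_in: "x \<in> I \<Longrightarrow> scale c x \<in> I"
  by (simp add: scale_def mult_in)

lemma coset_eq: "I +>\<^bsub>A2\<^esub> f = I +>\<^bsub>A2\<^esub> g \<longleftrightarrow> f - g \<in> I"
proof
  assume "I +>\<^bsub>A2\<^esub> f = I +>\<^bsub>A2\<^esub> g"
  moreover have "0 + f \<in> I +>\<^bsub>A2\<^esub> f"
    using zero_in by (auto simp: coset_A2 )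
  ultimately obtain i where "i \<in> I" "f = i + g"
    by (auto simp: coset_A2)
  then show "f - g \<in> I" by simp
next
  assume *: "f - g \<in> I"
  have "x + f \<in> I +>\<^bsub>A2\<^esub> g" if "x \<in> I" for x
    using add_in[OF that *] by (force simp: coset_A2)
  moreover have "x + g \<in> I +>\<^bsub>A2\<^esub> f" if "x \<in> I" for x
    using diff_in[OF that *] by (force simp: coset_A2)
  ultimately show "I +>\<^bsub>A2\<^esub> f = I +>\<^bsub>A2\<^esub> g"
    by (auto simp: coset_A2)
qed

lemma quot_add: "(I +>\<^bsub>A2\<^esub> f) \<oplus>\<^bsub>A2 Quot I\<^esub> (I +>\<^bsub>A2\<^esub> g) = I +>\<^bsub>A2\<^esub> (f + g)"
proof -
  interpret ideal I "A2 :: 'k poly3 ring" by (rule ideal)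
  show ?thesis by (simp add: FactRing_def a_rcos_sum)
qed

lemma quot_mult: "(I +>\<^bsub>A2\<^esub> f) \<otimes>\<^bsub>A2 Quot I\<^esub> (I +>\<^bsub>A2\<^esub> g) = I +>\<^bsub>A2\<^esub> (f * g)"
proof -
  interpret ideal I "A2 :: 'k poly3 ring" by (rule ideal)
  show ?thesis by (simp add: FactRing_def rcoset_mult_add)
qed

end

text \<open>\<open>cone\<close> instead of \<open>ev\<close>: vanishing along the whole line through
  the origin and q makes this a homogeneous ideal. For empty S it is the whole ring, the ideal of
  the empty group of points.\<close>

definition points_ideal :: "(3 \<Rightarrow> 'k::field) set \<Rightarrow> 'k poly3 set" where
  "points_ideal S = {h. \<forall>q\<in>S. cone q h = 0}"

lemma ideal_points_ideal: "ideal (points_ideal S) A2"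
  unfolding ideal_A2_iff points_ideal_def by (auto simp: cone_simps)

lemma hom_component_points_ideal: "h \<in> points_ideal S \<Longrightarrow> hom_component l h \<in> points_ideal S"
  unfolding points_ideal_def by (auto simp: cone_form[OF hom_component_forms] simp flip: coeff_cone)

lemma homogeneous_points_ideal: "homogeneous_ideal (points_ideal S)"
  by (simp add: homogeneous_ideal_def ideal_points_ideal hom_component_points_ideal)

lemma form_in_points_ideal_iff: "h \<in> forms (int l) \<Longrightarrow> h \<in> points_ideal S \<longleftrightarrow> (\<forall>q\<in>S. ev q h = 0)"
  by (simp add: points_ideal_def cone_form)

lemma prime_point_ideal: "primeideal (points_ideal {q}) A2"
  unfolding primeideal_A2_iff by (simp add: ideal_points_ideal) (simp add: points_ideal_def cone_simps)

lemma var_notin_point_ideal: "q i \<noteq> 0 \<Longrightarrow> var i \<notin> points_ideal {q}"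
  by (simp add: points_ideal_def cone_simps)

text \<open>For q nonzero, \<open>cone q\<close> sends some variable to a nonzero multiple of t,
  which can be cancelled in k[t].\<close>

lemma saturated_points_ideal:
  assumes "\<And>q. q \<in> S \<Longrightarrow> q \<noteq> (\<lambda>i. 0)"
  shows "saturated (points_ideal S)"
  unfolding saturated_def
proof (intro allI impI)
  fix f assume *: "\<forall>i. \<exists>N. var i ^ N * f \<in> points_ideal S"
  have "cone q f = 0" if q: "q \<in> S" for q
  proof -
    obtain i where i: "q i \<noteq> 0" using assms[OF q] by auto
    obtain N where "cone q (var i ^ N * f) = 0"
      using * q unfolding points_ideal_def by blast
    then show ?thesis using i by (simp add: cone_simps)
  qed
  then show "f \<in> points_ideal S" by (simp add: points_ideal_def)
qed

lemma point_ideal_in_proj_points: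
  assumes "IX \<subseteq> points_ideal {q}" "q \<noteq> (\<lambda>i. 0)"
  shows "points_ideal {q} \<in> proj_points IX"
  using assms var_notin_point_ideal[of q] prime_point_ideal[of q] homogeneous_points_ideal[of "{q}"]
  unfolding proj_points_def by (auto simp: fun_eq_iff)

text \<open>For q nonzero, the ring modulo \<open>points_ideal {q}\<close> is k[t], whose only
  homogeneous primes are 0 and (t). The latter pulls back to the irrelevant ideal, which contains
  \<open>var j\<close>.\<close>

lemma homogeneous_prime_above_point:
  assumes "primeideal P A2" "homogeneous_ideal P" "points_ideal {q} \<subseteq> P" "var j \<notin> P"
  shows "P = points_ideal {q}" "q \<noteq> (\<lambda>i. 0)"
proof -
  interpret poly3_ideal P using assms(2) by (intro poly3_ideal.intro) (simp add: homogeneous_ideal_def)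
  have prime: "a * b \<in> P \<Longrightarrow> a \<in> P \<or> b \<in> P" and one: "1 \<notin> P" for a b
    using assms(1) by (auto simp: primeideal_A2_iff)
  have power: "a ^ n \<in> P \<Longrightarrow> a \<in> P" for a n
    using one by (induction n) (auto dest: prime)
  show q: "q \<noteq> (\<lambda>i. 0)"
    using assms(3,4) by (auto simp: points_ideal_def subset_iff cone_simps)
  then obtain i where i: "q i \<noteq> 0" by auto
  \<comment> \<open>A linear form with value 1 at q, so that \<open>cone q\<close> maps it to
    t.\<close>
  define L where "L = scale (1 / q i) (var i)"
  have L: "cone q L = monom 1 1" using i by (simp add: L_def cone_simps monom_Suc monom_0)
  have Lpow: "cone q (scale c (L ^ n)) = monom c n" for c n
    by (simp add: cone_simps L monom_power smult_monom)
  show "P = points_ideal {q}"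
  proof (rule ccontr)
    assume "P \<noteq> points_ideal {q}"
    then obtain h where h: "h \<in> P" "cone q h \<noteq> 0" using assms(3) by (auto simp: points_ideal_def)
    then obtain l where l: "coeff (cone q h) l \<noteq> 0" by (auto simp: poly_eq_iff)
    define c where "c = ev q (hom_component l h)"
    have c: "c \<noteq> 0" using l by (simp add: c_def coeff_cone)
    have "hom_component l h - scale c (L ^ l) \<in> points_ideal {q}"
      by (simp add: points_ideal_def hom_C.psubst_diff cone_simps(2) cone_form[OF hom_component_forms] Lpow c_def)
    moreover have "hom_component l h \<in> P"
      using h(1) assms(2) by (simp add: homogeneous_ideal_def)
    ultimately have "hom_component l h - (hom_component l h - scale c (L ^ l)) \<in> P"
      using assms(3) diff_in by blast
    then have "scale (1 / c) (scale c (L ^ l)) \<in> P" by (simp add: scale_in)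
    then have "L ^ l \<in> P" using c by (simp add: scale_scale)
    then have "L \<in> P" by (rule power)
    moreover have "var j - scale (q j) L \<in> P"
      using assms(3) by (auto simp: points_ideal_def cone_simps L monom_Suc monom_0)
    ultimately have "(var j - scale (q j) L) + scale (q j) L \<in> P"
      using add_in scale_in by blast
    then show False using assms(4) by simp
  qed
qed

text \<open>Otherwise choose for each q an \<open>h q\<close> that vanishes at q and lies outside P;
  the product vanishes on S, so it lies in P, against primality.\<close>

lemma prime_above_points:
  assumes "finite S" "primeideal P A2" "points_ideal S \<subseteq> P"
  shows "\<exists>q\<in>S. points_ideal {q} \<subseteq> P"
proof (rule ccontr)
  have prime: "a * b \<in> P \<Longrightarrow> a \<in> P \<or> b \<in> P" and one: "1 \<notin> P" for a b
    using assms(2) by (auto simp: primeideal_A2_iff)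
  assume "\<not> ?thesis"
  then obtain h where h: "\<And>q. q \<in> S \<Longrightarrow> cone q (h q) = 0 \<and> h q \<notin> P"
    by (simp add: points_ideal_def subset_iff) metis
  have "(\<Prod>q\<in>T. h q) \<notin> P \<and> (\<forall>q\<in>T. cone q (\<Prod>q\<in>T. h q) = 0)" if "T \<subseteq> S" "finite T" for T
    using that(2,1)
  proof (induction T rule: finite_induct)
    case empty then show ?case using one by simp
  next
    case (insert q T) then show ?case using h[of q] prime by (auto simp: cone_simps)
  qed
  from this[of S] show False using assms(1,3) by (auto simp: points_ideal_def)
qed

text \<open>Every point of the scheme is some \<open>points_ideal {q}\<close> with q in S, and its
  closure contains no further point, so each component has dimension 0.\<close>

lemma group_of_points_points_ideal:
  assumes "finite S" "\<And>q. q \<in> S \<Longrightarrow> q \<noteq> (\<lambda>i. 0)" "IX \<subseteq> points_ideal S"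
  shows "group_of_points_on (points_ideal S) IX"
proof -
  have pts: "\<exists>q\<in>S. P = points_ideal {q}" if "P \<in> proj_points (points_ideal S)" for P
    using prime_above_points[OF assms(1), of P] homogeneous_prime_above_point[of P] that
    unfolding proj_points_def by blast
  have single: "proj_points (points_ideal {q}) = {points_ideal {q}}" if "q \<in> S" for q
    using homogeneous_prime_above_point[of _ q] point_ideal_in_proj_points[of "points_ideal {q}" q] assms(2)[OF that]
    unfolding proj_points_def by blast
  have dim: "has_dim {P} 0" for P :: "'a poly3 set"
    unfolding has_dim_def
  proof (intro conjI allI impI)
    show "\<exists>C. subset.chain {P} C \<and> finite C \<and> card C = Suc 0"
      by (intro exI[of _ "{P}"]) (auto simp: subset_chain_def)
    fix C assume "subset.chain {P} C \<and> finite C"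
    then have "C \<subseteq> {P}" by (auto simp: subset_chain_def)
    then show "card C \<le> Suc 0" using card_mono[of "{P}" C] by simp
  qed
  have "pure_dim (points_ideal S) 0"
    unfolding pure_dim_def using pts single dim by metis
  then show ?thesis
    using assms homogeneous_points_ideal saturated_points_ideal[of S]
    by (simp add: group_of_points_on_def closed_subscheme_def)
qed

section \<open>Linear coordinates\<close>

interpretation poly3: vector_space "scale :: 'k::field \<Rightarrow> 'k poly3 \<Rightarrow> 'k poly3"
  by (rule vector_space_scale)

lemma mult_in_span:
  assumes "f \<in> poly3.span S" "\<And>s. s \<in> S \<Longrightarrow> y * s \<in> poly3.span T"
  shows "y * f \<in> poly3.span T"
  using assms(1)
proof (induction rule: poly3.span_induct_alt)
  case base then show ?case by (simp add: poly3.span_zero)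
next
  case (step c x y')
  then show ?case
    by (simp add: distrib_left scale_mult_right assms(2) poly3.span_add poly3.span_scale)
qed

lemma forms_0_const:
  assumes "f \<in> forms 0"
  shows "f = Poly_Mapping.single 0 (Poly_Mapping.lookup f 0)"
proof (rule poly_mapping_eqI)
  fix m
  have "m = 0" if "Poly_Mapping.lookup f m \<noteq> 0"
  proof -
    have "mon_deg m = 0" using assms that by (auto simp: forms_def in_keys_iff)
    then show "m = 0" unfolding mon_deg_def by (intro poly_mapping_eqI) auto
  qed
  then show "Poly_Mapping.lookup f m = Poly_Mapping.lookup (Poly_Mapping.single 0 (Poly_Mapping.lookup f 0)) m"
    by (auto simp: lookup_single when_def)
qed

lemma forms_1_expand:
  assumes "f \<in> forms 1"
  shows "\<exists>a. f = (\<Sum>i\<in>UNIV. scale (a i) (var i))"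
proof -
  \<comment> \<open>The induction rule runs through all degrees, so the claim is guarded by
    \<open>l = 1\<close>.\<close>
  have "l = 1 \<longrightarrow> (\<exists>a. f = (\<Sum>i\<in>UNIV. scale (a i) (var i)))" if "f \<in> forms (int l)" for l
    using that
  proof (induction rule: forms_induct)
    case (const c) then show ?case by simp
  next
    case (var l i g)
    show ?case
    proof
      assume "Suc l = 1"
      then have "g \<in> forms 0" using var by simp
      then obtain c where g: "g = Poly_Mapping.single 0 c" using forms_0_const by blast
      have "var i * g = scale c (var i)" by (simp add: scale_def g mult.commute)
      also have "\<dots> = (\<Sum>j\<in>UNIV. scale (if j = i then c else 0) (var j))"
        by (simp add: if_distrib[of "\<lambda>c. scale c _"] sum.delta cong: if_cong)
      finally show "\<exists>a. var i * g = (\<Sum>i\<in>UNIV. scale (a i) (var i))"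
        by (rule exI[of _ "\<lambda>j. if j = i then c else 0"])
    qed
  next
    case (add l f g)
    show ?case
    proof
      assume "l = 1"
      then obtain a b where "f = (\<Sum>i\<in>UNIV. scale (a i) (var i))" "g = (\<Sum>i\<in>UNIV. scale (b i) (var i))"
        using add by blast
      then have "f + g = (\<Sum>i\<in>UNIV. scale (a i + b i) (var i))"
        by (simp add: scale_add_left sum.distrib)
      then show "\<exists>a. f + g = (\<Sum>i\<in>UNIV. scale (a i) (var i))"
        by (rule exI[of _ "\<lambda>i. a i + b i"])
    qed
  qed
  from this[of 1] show ?thesis using assms by simp
qed

text \<open>\<open>dehom u v w h\<close> is \<open>h (u + y v + z w)\<close> in \<open>k[y][z]\<close>, with \<open>z\<close> the outer variable.\<close>

definition dehom :: "(3 \<Rightarrow> 'k::field) \<Rightarrow> (3 \<Rightarrow> 'k) \<Rightarrow> (3 \<Rightarrow> 'k) \<Rightarrow> 'k poly3 \<Rightarrow> 'k poly poly" where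
  "dehom u v w = psubst (\<lambda>a. [:[:a:]:]) (\<lambda>i. [:[:u i, v i:], [:w i:]:])"

lemma dehom_simps:
  "dehom u v w (f + g) = dehom u v w f + dehom u v w g" "dehom u v w (f - g) = dehom u v w f - dehom u v w g"
  "dehom u v w (f * g) = dehom u v w f * dehom u v w g" "dehom u v w (f ^ m) = dehom u v w f ^ m"
  "dehom u v w (- f) = - dehom u v w f" "dehom u v w 0 = 0" "dehom u v w 1 = 1"
  "dehom u v w (sum F S) = (\<Sum>i\<in>S. dehom u v w (F i))"
  "dehom u v w (Poly_Mapping.single 0 a) = [:[:a:]:]" "dehom u v w (scale a f) = [:[:a:]:] * dehom u v w f"
  "dehom u v w (var i) = [:[:u i, v i:], [:w i:]:]"
  unfolding dehom_def
  by (rule hom_CC.psubst_add hom_CC.psubst_diff hom_CC.psubst_mult hom_CC.psubst_power hom_CC.psubst_uminus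
        hom_CC.psubst_0 hom_CC.psubst_1 hom_CC.psubst_sum hom_CC.psubst_const hom_CC.psubst_scale
        hom_CC.psubst_var)+

lemma poly_dehom: "poly (poly (dehom u v w h) [:b:]) a = ev (\<lambda>i. u i + a * v i + b * w i) h"
proof (induction h rule: poly3_induct)
  case (single m c)
  show ?case
    by (simp add: dehom_def ev_def hom_CC.psubst_single hom_id.psubst_single poly_prod algebra_simps)
next
  case (add f g) then show ?case by (simp add: dehom_simps ev_simps)
qed

lemma dehom_linear:
  assumes "f \<in> forms 1"
  shows "dehom u v w f = [:[:ev u f, ev v f:], [:ev w f:]:]"
proof -
  obtain a where "f = (\<Sum>i\<in>UNIV. scale (a i) (var i))" using forms_1_expand[OF assms] by blast
  then show ?thesis
    by (simp add: sum_3 dehom_simps ev_simps)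
qed

text \<open>Total degree in y and z below s. With the strict bound, s = 0 stands for the zero
  polynomial, and removing a linear factor needs no truncated subtraction.\<close>

definition tdeg_less :: "nat \<Rightarrow> 'k::field poly poly \<Rightarrow> bool" where
  "tdeg_less s g \<longleftrightarrow> (\<forall>b c. s \<le> b + c \<longrightarrow> coeff (coeff g c) b = 0)"

text \<open>\<open>u\<close>, \<open>v\<close>, \<open>w\<close> is the basis of k^3 dual to the
  coordinates. So w is the common zero of \<open>Y0\<close> and \<open>Y1\<close>, the centre of the
  projection, and \<open>dehom u v w\<close> puts Y0 = 1, Y1 = y, Z = z.\<close>

locale coords =
  fixes Y0 Y1 Z :: "'k::field poly3" and u v w :: "3 \<Rightarrow> 'k"
  assumes lin [intro]: "Y0 \<in> forms 1" "Y1 \<in> forms 1" "Z \<in> forms 1"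
    and var_eq: "var i = scale (u i) Y0 + scale (v i) Y1 + scale (w i) Z"
    and dual: "ev u Y0 = 1" "ev u Y1 = 0" "ev u Z = 0"
      "ev v Y0 = 0" "ev v Y1 = 1" "ev v Z = 0" "ev w Y0 = 0" "ev w Y1 = 0" "ev w Z = 1"
begin

lemma coords_induct [consumes 1, case_names const Y0 Y1 Z add scale]:
  fixes f :: "'k poly3"
  assumes "f \<in> forms (int l)"
    and const: "\<And>c. P 0 (Poly_Mapping.single 0 c)"
    and Y0: "\<And>l g. g \<in> forms (int l) \<Longrightarrow> P l g \<Longrightarrow> P (Suc l) (Y0 * g)"
    and Y1: "\<And>l g. g \<in> forms (int l) \<Longrightarrow> P l g \<Longrightarrow> P (Suc l) (Y1 * g)"
    and Z: "\<And>l g. g \<in> forms (int l) \<Longrightarrow> P l g \<Longrightarrow> P (Suc l) (Z * g)"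
    and add: "\<And>l f g. f \<in> forms (int l) \<Longrightarrow> g \<in> forms (int l) \<Longrightarrow> P l f \<Longrightarrow> P l g \<Longrightarrow> P l (f + g)"
    and scale: "\<And>l g c. g \<in> forms (int l) \<Longrightarrow> P l g \<Longrightarrow> P l (scale c g)"
  shows "P l f"
  using assms(1)
proof (induction rule: forms_induct)
  case (const c) then show ?case by (rule assms(2))
next
  case (var l i g)
  have "var i * g = scale (u i) (Y0 * g) + scale (v i) (Y1 * g) + scale (w i) (Z * g)"
    by (simp add: var_eq distrib_right scale_mult_left)
  moreover have "Y0 * g \<in> forms (int (Suc l))" "Y1 * g \<in> forms (int (Suc l))" "Z * g \<in> forms (int (Suc l))"
    using lin var forms_mult[of _ 1 g "int l"] by auto
  ultimately show ?case
    using var by (auto intro!: add scale Y0 Y1 Z forms_add forms_scale)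
next
  case (add l f g) then show ?case by (rule assms(6))
qed

abbreviation "\<delta> \<equiv> dehom u v w"

lemma dehom_coords: "\<delta> Y0 = 1" "\<delta> Y1 = [:[:0, 1:]:]" "\<delta> Z = [:0, 1:]"
  by (simp_all add: dehom_linear lin dual one_pCons)

lemma dehom_tdeg_less: "h \<in> forms (int l) \<Longrightarrow> tdeg_less (Suc l) (\<delta> h)"
proof (induction rule: coords_induct)
  case (const c) then show ?case by (auto simp: tdeg_less_def dehom_simps coeff_pCons split: nat.split)
qed (auto simp: tdeg_less_def dehom_simps dehom_coords coeff_pCons split: nat.split)

text \<open>Only Z^l contributes, and Y0 and Y1 vanish at w. Thus F(w) nonzero makes
  \<open>\<delta> F\<close> monic in z up to a constant.\<close>

lemma coeff_dehom_top: "h \<in> forms (int l) \<Longrightarrow> coeff (\<delta> h) l = [:ev w h:]"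
proof (induction rule: coords_induct)
  case (Y0 l g)
  then show ?case using dehom_tdeg_less[OF Y0(1)]
    by (auto simp: tdeg_less_def dehom_simps dehom_coords ev_simps dual intro!: poly_eqI)
next
  case (Y1 l g)
  then have "coeff (\<delta> g) (Suc l) = 0" using dehom_tdeg_less[OF Y1(1)]
    by (auto simp: tdeg_less_def intro!: poly_eqI)
  then show ?case by (simp add: dehom_simps dehom_coords ev_simps dual)
qed (auto simp: dehom_simps dehom_coords ev_simps dual)

definition basis :: "nat \<Rightarrow> nat \<times> nat \<Rightarrow> 'k poly3" where
  "basis l = (\<lambda>(b, c). Y0 ^ (l - b - c) * Y1 ^ b * Z ^ c)"

definition index :: "nat \<Rightarrow> (nat \<times> nat) set" where
  "index l = {(b, c). b + c \<le> l}"

lemma finite_index [simp]: "finite (index l)"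
  by (rule finite_subset[of _ "{..l} \<times> {..l}"]) (auto simp: index_def)

lemma basis_in_forms: "x \<in> index l \<Longrightarrow> basis l x \<in> forms (int l)"
proof (cases x)
  case (Pair b c)
  assume "x \<in> index l"
  then have "int (l - b - c) + int b + int c = int l" by (auto simp: index_def Pair)
  then show ?thesis
    using forms_mult[OF forms_mult[OF forms_power[OF lin(1), of "l - b - c"] forms_power[OF lin(2), of b]] forms_power[OF lin(3), of c]]
    by (simp add: basis_def Pair)
qed

lemma forms_in_span_basis: "f \<in> forms (int l) \<Longrightarrow> f \<in> poly3.span (basis l ` index l)"
proof (induction rule: coords_induct)
  case (const c)
  have "Poly_Mapping.single 0 c = scale c (basis 0 (0, 0))" by (simp add: scale_def basis_def)
  then show ?case by (metis (mono_tags, lifting) poly3.span_scale poly3.span_base imageI index_def le_refl add_0 mem_Collect_eq case_prodI)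
next
  case (Y0 l g)
  have "Y0 * basis l x \<in> basis (Suc l) ` index (Suc l)" if "x \<in> index l" for x
    using that by (intro image_eqI[of _ _ x]) (auto simp: index_def basis_def Suc_diff_le diff_diff_add mult_ac)
  then show ?case by (intro mult_in_span[OF Y0(2)]) (auto intro: poly3.span_base)
next
  case (Y1 l g)
  have "Y1 * basis l x \<in> basis (Suc l) ` index (Suc l)" if "x \<in> index l" for x
    using that by (intro image_eqI[of _ _ "(Suc (fst x), snd x)"]) (auto simp: index_def basis_def mult_ac)
  then show ?case by (intro mult_in_span[OF Y1(2)]) (auto intro: poly3.span_base)
next
  case (Z l g)
  have "Z * basis l x \<in> basis (Suc l) ` index (Suc l)" if "x \<in> index l" for x
    using that by (intro image_eqI[of _ _ "(fst x, Suc (snd x))"]) (auto simp: index_def basis_def mult_ac)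
  then show ?case by (intro mult_in_span[OF Z(2)]) (auto intro: poly3.span_base)
qed (auto intro: poly3.span_add poly3.span_scale)

lemma dehom_basis: "\<delta> (basis l (b, c)) = monom (monom 1 b) c"
proof -
  have "[:[:0, 1:]:] ^ b = [:monom (1 :: 'k) b:]"
    by (induction b) (simp_all add: monom_0 monom_Suc one_pCons)
  moreover have "[:0, 1 :: 'k poly:] ^ c = monom 1 c"
    by (induction c) (simp_all add: monom_0 monom_Suc flip: one_pCons)
  ultimately show ?thesis
    by (simp add: basis_def dehom_simps dehom_coords smult_monom)
qed

text \<open>Basis monomials dehomogenise to distinct monomials y^b z^c. This yields linear
  independence and the injectivity of \<open>\<delta>\<close> on forms of a given degree.\<close>

lemma coeff_dehom_basis_sum:
  assumes "(b, c) \<in> index l"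
  shows "coeff (coeff (\<delta> (\<Sum>x\<in>index l. scale (C x) (basis l x))) c) b = C (b, c)"
proof -
  have "coeff (coeff (\<delta> (\<Sum>x\<in>index l. scale (C x) (basis l x))) c) b =
      (\<Sum>x\<in>index l. C x * coeff (coeff (\<delta> (basis l x)) c) b)"
    by (simp add: dehom_simps coeff_sum)
  also have "\<dots> = (\<Sum>x\<in>index l. if x = (b, c) then C (b, c) else 0)"
    by (intro sum.cong) (auto simp: dehom_basis split: if_splits)
  finally show ?thesis using assms by (simp add: sum.delta)
qed

lemma basis_inj: "inj_on (basis l) (index l)"
proof (rule inj_onI)
  fix x y assume "basis l x = basis l y"
  then have "\<delta> (basis l x) = \<delta> (basis l y)" by simp
  then show "x = y"
    by (cases x; cases y) (simp add: dehom_basis monom_eq_iff')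
qed

lemma forms_eq_basis_sum:
  assumes "f \<in> forms (int l)"
  shows "\<exists>C. f = (\<Sum>x\<in>index l. scale (C x) (basis l x))"
proof -
  have "f \<in> range (\<lambda>C. \<Sum>y\<in>basis l ` index l. scale (C y) y)"
    using forms_in_span_basis[OF assms] by (simp add: poly3.span_finite)
  then obtain C where "f = (\<Sum>y\<in>basis l ` index l. scale (C y) y)" by blast
  then have "f = (\<Sum>x\<in>index l. scale (C (basis l x)) (basis l x))"
    by (simp add: sum.reindex basis_inj)
  then show ?thesis by (rule exI[of _ "\<lambda>x. C (basis l x)"])
qed

lemma dehom_inj:
  assumes "f \<in> forms (int l)" "\<delta> f = 0"
  shows "f = 0"
proof -
  obtain C where f: "f = (\<Sum>x\<in>index l. scale (C x) (basis l x))"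
    using forms_eq_basis_sum[OF assms(1)] by blast
  have "C x = 0" if "x \<in> index l" for x
    using coeff_dehom_basis_sum[of "fst x" "snd x" l C] that assms(2) f by simp
  then show ?thesis using f by simp
qed

lemma dehom_surj:
  assumes "tdeg_less (Suc l) g"
  shows "\<exists>f\<in>forms (int l). \<delta> f = g"
proof
  \<comment> \<open>The homogenisation of g to degree l.\<close>
  let ?f = "\<Sum>x\<in>index l. scale (coeff (coeff g (snd x)) (fst x)) (basis l x)"
  show f: "?f \<in> forms (int l)"
    by (intro forms_sum forms_scale basis_in_forms)
  show "\<delta> ?f = g"
  proof (rule poly_eqI, rule poly_eqI)
    fix c b
    show "coeff (coeff (\<delta> ?f) c) b = coeff (coeff g c) b"
    proof (cases "(b, c) \<in> index l")
      case True
      then show ?thesis by (subst coeff_dehom_basis_sum) auto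
    next
      case False
      then show ?thesis
        using assms dehom_tdeg_less[OF f] by (simp add: tdeg_less_def index_def)
    qed
  qed
qed

lemma dim_forms: "poly3.dim (forms (int l) :: 'k poly3 set) = card (index l)"
proof -
  have sub: "poly3.span (basis l ` index l) = (forms (int l) :: 'k poly3 set)"
  proof
    show "poly3.span (basis l ` index l) \<subseteq> (forms (int l) :: 'k poly3 set)"
      by (rule poly3.span_minimal)
         (auto simp: basis_in_forms poly3.subspace_def forms_add forms_scale)
  qed (use forms_in_span_basis in auto)
  have "poly3.independent (basis l ` index l)"
  proof (rule poly3.independent_if_scalars_zero)
    fix C x assume *: "(\<Sum>x\<in>basis l ` index l. scale (C x) x) = 0" "x \<in> basis l ` index l"
    then obtain b c where x: "x = basis l (b, c)" "(b, c) \<in> index l" by auto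
    have "(\<Sum>x\<in>index l. scale (C (basis l x)) (basis l x)) = 0"
      using * by (simp add: sum.reindex basis_inj)
    then show "C x = 0"
      using coeff_dehom_basis_sum[OF x(2), of "\<lambda>x. C (basis l x)"] x by (simp add: dehom_simps)
  qed simp
  then have "poly3.dim (poly3.span (basis l ` index l)) = card (basis l ` index l)"
    by (rule poly3.dim_span_eq_card_independent)
  then show ?thesis by (simp add: sub card_image basis_inj)
qed

end

section \<open>Graded bases\<close>

lemma ev_eq_cone: "ev q h = poly (cone q h) 1"
proof (induction h rule: poly3_induct)
  case (single m c)
  show ?case by (simp add: ev_def cone_def hom_id.psubst_single hom_C.psubst_single poly_prod)
next
  case (add f g) then show ?case by (simp add: cone_simps ev_simps)
qed

lemma ev_point_ideal: "h \<in> points_ideal S \<Longrightarrow> q \<in> S \<Longrightarrow> ev q h = 0"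
  by (simp add: ev_eq_cone points_ideal_def)

locale two_forms =
  fixes Y0 Y1 :: "'k::field poly3"
  assumes Y0_form: "Y0 \<in> forms 1" and Y1_form: "Y1 \<in> forms 1"
begin

abbreviation "R \<equiv> R1 Y0 Y1"

lemma R_add: "r \<in> R \<Longrightarrow> s \<in> R \<Longrightarrow> r + s \<in> R"
  unfolding R1_def by (rule poly3.span_add)

lemma R_diff: "r \<in> R \<Longrightarrow> s \<in> R \<Longrightarrow> r - s \<in> R"
  unfolding R1_def by (rule poly3.span_diff)

lemma R_scale: "r \<in> R \<Longrightarrow> scale c r \<in> R"
  unfolding R1_def by (rule poly3.span_scale)

lemma R_0: "0 \<in> R"
  unfolding R1_def by (rule poly3.span_zero)

lemma R_sum: "(\<And>i. i \<in> S \<Longrightarrow> f i \<in> R) \<Longrightarrow> sum f S \<in> R"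
  unfolding R1_def by (rule poly3.span_sum)

lemma R_monom: "Y0 ^ a * Y1 ^ b \<in> R"
  unfolding R1_def by (rule poly3.span_base) blast

lemma R_Y0: "Y0 \<in> R" and R_Y1: "Y1 \<in> R" and R_1: "1 \<in> R"
  using R_monom[of 1 0] R_monom[of 0 1] R_monom[of 0 0] by simp_all

lemma R_const: "Poly_Mapping.single 0 c \<in> R"
  using R_scale[OF R_1, of c] by (simp add: scale_def)

lemma R_mult:
  assumes "r \<in> R" "s \<in> R"
  shows "r * s \<in> R"
proof -
  have *: "(Y0 ^ a * Y1 ^ b) * s \<in> R" for a b
    using assms(2) unfolding R1_def
  proof (rule mult_in_span)
    fix x assume "x \<in> {Y0 ^ a * Y1 ^ b |a b. True}"
    then obtain a' b' where "x = Y0 ^ a' * Y1 ^ b'" by blast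
    then have "Y0 ^ a * Y1 ^ b * x = Y0 ^ (a + a') * Y1 ^ (b + b')"
      by (simp add: power_add mult_ac)
    then show "Y0 ^ a * Y1 ^ b * x \<in> poly3.span {Y0 ^ a * Y1 ^ b |a b. True}"
      using R_monom unfolding R1_def by simp
  qed
  have "s * r \<in> R"
    using * unfolding R1_def
    by (intro mult_in_span[OF assms(1)[unfolded R1_def]]) (auto simp: mult.commute[of s])
  then show ?thesis by (simp add: mult.commute)
qed

lemma R_power: "r \<in> R \<Longrightarrow> r ^ n \<in> R"
  by (induction n) (auto intro: R_1 R_mult)

lemma monom_form: "Y0 ^ a * Y1 ^ b \<in> forms (int (a + b))"
  using forms_mult[OF forms_power[OF Y0_form, of a] forms_power[OF Y1_form, of b]] by simp

lemma hom_component_in_span: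
  assumes "r \<in> R"
  shows "hom_component m r \<in> poly3.span {Y0 ^ a * Y1 ^ b | a b. a + b = m}"
  using assms unfolding R1_def
proof (induction rule: poly3.span_induct_alt)
  case base then show ?case by (simp add: poly3.span_zero)
next
  case (step c x y)
  then obtain a b where x: "x = Y0 ^ a * Y1 ^ b" by blast
  have "x \<in> {Y0 ^ a * Y1 ^ b | a b. a + b = m}" if "a + b = m" using that x by blast
  note s = poly3.span_scale[OF poly3.span_base[OF this]]
  have "scale c x \<in> forms (int (a + b))" unfolding x by (intro forms_scale monom_form)
  then have "hom_component m (scale c x) = (if a + b = m then scale c x else 0)"
    using hom_component_of_form by fastforce
  then have "hom_component m (scale c x) \<in> poly3.span {Y0 ^ a * Y1 ^ b | a b. a + b = m}"
    using s by (simp add: poly3.span_zero)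
  then show ?case using step by (simp add: hom_component_add poly3.span_add)
qed

lemma hom_component_R: "r \<in> R \<Longrightarrow> hom_component m r \<in> R"
  using hom_component_in_span[of r m] poly3.span_mono[of "{Y0 ^ a * Y1 ^ b | a b. a + b = m}" "{Y0 ^ a * Y1 ^ b | a b. True}"]
  unfolding R1_def by blast

definition Rf :: "int \<Rightarrow> 'k poly3 set" where
  "Rf l = R \<inter> forms l"

lemma Rf_0: "0 \<in> Rf l"
  by (simp add: Rf_def R_0)

lemma Rf_add: "r \<in> Rf l \<Longrightarrow> s \<in> Rf l \<Longrightarrow> r + s \<in> Rf l"
  by (simp add: Rf_def R_add forms_add)

lemma Rf_diff: "r \<in> Rf l \<Longrightarrow> s \<in> Rf l \<Longrightarrow> r - s \<in> Rf l"
  by (simp add: Rf_def R_diff forms_diff)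

lemma Rf_sum: "(\<And>i. i \<in> S \<Longrightarrow> f i \<in> Rf l) \<Longrightarrow> sum f S \<in> Rf l"
  by (simp add: Rf_def R_sum forms_sum)

lemma Rf_scale: "r \<in> Rf l \<Longrightarrow> scale c r \<in> Rf l"
  by (simp add: Rf_def R_scale forms_scale)

lemma Rf_mult: "r \<in> Rf l \<Longrightarrow> s \<in> Rf m \<Longrightarrow> r * s \<in> Rf (l + m)"
  by (simp add: Rf_def R_mult forms_mult)

lemma Rf_Y0: "Y0 \<in> Rf 1" and Rf_Y1: "Y1 \<in> Rf 1"
  by (simp_all add: Rf_def R_Y0 R_Y1 Y0_form Y1_form)

lemma Rf_power: "r \<in> Rf 1 \<Longrightarrow> r ^ a \<in> Rf (int a)"
  by (simp add: Rf_def R_power forms_power)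

lemma Rf_neg: "l < 0 \<Longrightarrow> r \<in> Rf l \<Longrightarrow> r = 0"
  using forms_neg by (auto simp: Rf_def)

lemma Rf_hom_component: "r \<in> R \<Longrightarrow> hom_component m r \<in> Rf (int m)"
  by (simp add: Rf_def hom_component_R hom_component_forms)

lemma Rf_in_span: "r \<in> Rf (int m) \<Longrightarrow> r \<in> poly3.span {Y0 ^ a * Y1 ^ b | a b. a + b = m}"
  using hom_component_in_span[of r m] hom_component_of_form[of r "int m" m] by (simp add: Rf_def)

text \<open>For independent \<open>Y0\<close>, \<open>Y1\<close> this is the equation of the line
  joining q to their common zero; it degenerates to 0 when both vanish at q.\<close>

definition line :: "(3 \<Rightarrow> 'k) \<Rightarrow> 'k poly3" where
  "line q = scale (ev q Y1) Y0 - scale (ev q Y0) Y1"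

lemma line_Rf: "line q \<in> Rf 1"
  by (simp add: line_def Rf_diff Rf_scale Rf_Y0 Rf_Y1)

lemma ev_line: "ev p (line q) = ev q Y1 * ev p Y0 - ev q Y0 * ev p Y1"
  by (simp add: line_def ev_simps)

text \<open>R modulo \<open>line q\<close> is generated by L, so a form of degree m in R is its
  value at q times L^m up to a multiple of \<open>line q\<close>. In particular, a form of R that
  vanishes at q is divisible by \<open>line q\<close>.\<close>

lemma ex_unit_form:
  assumes "ev q Y0 \<noteq> 0 \<or> ev q Y1 \<noteq> 0"
  shows "\<exists>L. L \<in> Rf 1 \<and> ev q L = 1 \<and>
    (\<forall>m. \<forall>r\<in>Rf (int m). \<exists>s\<in>Rf (int m - 1). r = scale (ev q r) (L ^ m) + line q * s)"
proof -
  \<comment> \<open>L is whichever of \<open>Y0\<close>, \<open>Y1\<close> is nonzero at q,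
    normalised to value 1 there.\<close>
  define x where "x = (if ev q Y0 \<noteq> 0 then 1 / ev q Y0 else 0)"
  define y where "y = (if ev q Y0 \<noteq> 0 then 0 else 1 / ev q Y1)"
  define L where "L = scale x Y0 + scale y Y1"
  have L: "L \<in> Rf 1" by (simp add: L_def Rf_add Rf_scale Rf_Y0 Rf_Y1)
  have L1: "ev q L = 1" using assms by (auto simp: L_def ev_simps x_def y_def)
  then have xy: "x * ev q Y0 + y * ev q Y1 = 1" by (simp add: L_def ev_simps)
  let ?P = "\<lambda>m r. \<exists>s\<in>Rf (int m - 1). r = scale (ev q r) (L ^ m) + line q * s"
  have "scale (ev q Y0) L + scale y (line q) = scale (x * ev q Y0 + y * ev q Y1) Y0"
    by (simp add: L_def line_def scale_add scale_add_left poly3.scale_right_diff_distrib mult.commute)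
  then have Y0: "Y0 = scale (ev q Y0) L + scale y (line q)"
    by (simp add: xy)
  have "scale (ev q Y1) L + scale (- x) (line q) = scale (x * ev q Y0 + y * ev q Y1) Y1"
    by (simp add: L_def line_def scale_add scale_add_left poly3.scale_right_diff_distrib mult.commute)
  then have Y1: "Y1 = scale (ev q Y1) L + scale (- x) (line q)"
    by (simp add: xy)
  have step: "?P (Suc m) (Y * r)"
    if r: "?P m r" "r \<in> Rf (int m)" and Y: "Y = scale (ev q Y) L + scale c (line q)" for m r Y c
  proof -
    obtain s where s: "s \<in> Rf (int m - 1)" "r = scale (ev q r) (L ^ m) + line q * s"
      using r by blast
    have "Y * r = (scale (ev q Y) L + scale c (line q)) * r" using Y by simp
    also have "\<dots> = scale (ev q Y) (L * r) + line q * scale c r"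
      by (simp add: distrib_right scale_mult_left scale_mult_right)
    also have "L * r = L * (scale (ev q r) (L ^ m) + line q * s)" using s(2) by simp
    also have "\<dots> = scale (ev q r) (L ^ Suc m) + line q * (L * s)"
      by (simp add: distrib_left scale_mult_right mult_ac)
    finally have "Y * r = scale (ev q (Y * r)) (L ^ Suc m) + line q * (scale (ev q Y) (L * s) + scale c r)"
      unfolding ev_simps by (simp add: scale_add scale_scale distrib_left scale_mult_right add.assoc)
    moreover have "scale (ev q Y) (L * s) + scale c r \<in> Rf (int (Suc m) - 1)"
      using Rf_mult[OF L s(1)] r(2) by (simp add: Rf_add Rf_scale)
    ultimately show ?thesis by blast
  qed
  have monom: "?P (a + b) (Y0 ^ a * Y1 ^ b)" for a b
  proof (induction a)
    case 0
    show ?case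
    proof (induction b)
      case 0 show ?case using Rf_0 by (intro bexI[of _ 0]) (simp_all add: ev_simps)
    next
      case (Suc b)
      then show ?case using step[OF _ _ Y1, of b "Y1 ^ b"] Rf_power[OF Rf_Y1, of b] by simp
    qed
  next
    case (Suc a)
    have "Y0 ^ a * Y1 ^ b \<in> Rf (int (a + b))" by (simp add: Rf_def R_monom monom_form[simplified])
    then show ?case using step[OF _ _ Y0, of "a + b" "Y0 ^ a * Y1 ^ b"] Suc by (simp add: mult.assoc)
  qed
  have "?P m r" if "r \<in> Rf (int m)" for m r
    using Rf_in_span[OF that]
  proof (induction rule: poly3.span_induct_alt)
    case base show ?case using Rf_0 by (intro bexI[of _ 0]) (simp_all add: ev_simps)
  next
    case (step c x y)
    obtain s where s: "s \<in> Rf (int m - 1)" "x = scale (ev q x) (L ^ m) + line q * s"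
      using monom step(1) by blast
    obtain t where t: "t \<in> Rf (int m - 1)" "y = scale (ev q y) (L ^ m) + line q * t"
      using step by blast
    have "scale c x + y = scale c (scale (ev q x) (L ^ m) + line q * s) + (scale (ev q y) (L ^ m) + line q * t)"
      using s(2) t(2) by simp
    also have "\<dots> = scale (ev q (scale c x + y)) (L ^ m) + line q * (scale c s + t)"
      by (simp add: ev_simps scale_add scale_add_left scale_scale distrib_left scale_mult_right)
    finally show ?case using Rf_add[OF Rf_scale[OF s(1), of c] t(1)] by blast
  qed
  then show ?thesis using L L1 by blast
qed

text \<open>The \<open>e i\<close> represent a basis of the \<open>R\<close>-module \<open>I/IX\<close>, with \<open>e i\<close> of degree \<open>n i\<close>.\<close>

definition graded_basis :: "'k poly3 set \<Rightarrow> 'k poly3 set \<Rightarrow> nat \<Rightarrow> (nat \<Rightarrow> nat) \<Rightarrow> (nat \<Rightarrow> 'k poly3) \<Rightarrow> bool" where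
  "graded_basis IX I d n e \<longleftrightarrow>
    (\<forall>i<d. e i \<in> I \<inter> forms (int (n i))) \<and>
    (\<forall>l. \<forall>h\<in>I \<inter> forms l. \<exists>r. (\<forall>i<d. r i \<in> Rf (l - int (n i))) \<and> h - (\<Sum>i<d. r i * e i) \<in> IX) \<and>
    (\<forall>l r. (\<forall>i<d. r i \<in> Rf (l - int (n i))) \<and> (\<Sum>i<d. r i * e i) \<in> IX \<longrightarrow> (\<forall>i<d. r i = 0))"

lemma graded_basis_unique:
  assumes "graded_basis IX I d n e" "\<forall>i<d. r i \<in> Rf (l - int (n i))" "(\<Sum>i<d. r i * e i) \<in> IX"
  shows "\<forall>i<d. r i = 0"
  using assms unfolding graded_basis_def by blast

text \<open>Needed to exchange two basis elements of equal degree, so that the pivot gets the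
  prescribed index.\<close>

lemma graded_basis_permute:
  assumes "graded_basis IX I d n e" "bij_betw p {..<d} {..<d}"
  shows "graded_basis IX I d (n \<circ> p) (e \<circ> p)"
proof -
  define p' where "p' = inv_into {..<d} p"
  have p: "p i < d" if "i < d" for i using assms(2) that by (auto simp: bij_betw_def)
  have p': "p' i < d" "p (p' i) = i" if "i < d" for i
    using assms(2) that bij_betw_inv_into[OF assms(2)] unfolding p'_def
    by (auto simp: bij_betw_def f_inv_into_f)
  have p'p: "p' (p i) = i" if "i < d" for i
    using assms(2) that unfolding p'_def by (simp add: bij_betw_def)
  have sum: "(\<Sum>i<d. f (p i)) = (\<Sum>i<d. f i)" for f :: "nat \<Rightarrow> 'k poly3"
    by (rule sum.reindex_bij_betw[OF assms(2)])
  show ?thesis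
    unfolding graded_basis_def
  proof (intro conjI allI ballI impI)
    fix i assume "i < d"
    then show "(e \<circ> p) i \<in> I \<inter> forms (int ((n \<circ> p) i))"
      using assms(1) p by (simp add: graded_basis_def)
  next
    fix l h assume "h \<in> I \<inter> forms l"
    then obtain r where r: "\<forall>i<d. r i \<in> Rf (l - int (n i))" "h - (\<Sum>i<d. r i * e i) \<in> IX"
      using assms(1) unfolding graded_basis_def by blast
    then show "\<exists>r. (\<forall>i<d. r i \<in> Rf (l - int ((n \<circ> p) i))) \<and> h - (\<Sum>i<d. r i * (e \<circ> p) i) \<in> IX"
      using p sum[of "\<lambda>i. r i * e i"] by (intro exI[of _ "r \<circ> p"]) simp
  next
    fix l r i
    assume *: "(\<forall>i<d. r i \<in> Rf (l - int ((n \<circ> p) i))) \<and> (\<Sum>i<d. r i * (e \<circ> p) i) \<in> IX" and i: "i < d"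
    have "(\<Sum>i<d. r (p' i) * e i) = (\<Sum>i<d. r i * (e \<circ> p) i)"
      using sum[of "\<lambda>i. r (p' i) * e i"] p'p by simp
    then have 1: "(\<Sum>i<d. r (p' i) * e i) \<in> IX"
      using * by (elim conjE) (erule ssubst)
    have 2: "\<forall>i<d. r (p' i) \<in> Rf (l - int (n i))"
      using * p' by fastforce
    have "\<forall>i<d. r (p' i) = 0"
      by (rule graded_basis_unique[OF assms(1) 2 1])
    then have "r (p' (p i)) = 0" using p[OF i] by blast
    then show "r i = 0" using p'p[OF i] by simp
  qed
qed

end

context two_forms
begin

lemma graded_basisI:
  assumes "\<And>i. i < d \<Longrightarrow> e i \<in> I" "\<And>i. i < d \<Longrightarrow> e i \<in> forms (int (n i))"
    "\<And>l h. h \<in> I \<Longrightarrow> h \<in> forms l \<Longrightarrow> \<exists>r. (\<forall>i<d. r i \<in> Rf (l - int (n i))) \<and> h - (\<Sum>i<d. r i * e i) \<in> IX"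
    "\<And>l r i. \<forall>i<d. r i \<in> Rf (l - int (n i)) \<Longrightarrow> (\<Sum>i<d. r i * e i) \<in> IX \<Longrightarrow> i < d \<Longrightarrow> r i = 0"
  shows "graded_basis IX I d n e"
  unfolding graded_basis_def using assms by blast

lemma graded_basis_form:
  assumes "graded_basis IX I d n e" "i < d"
  shows "e i \<in> I" "e i \<in> forms (int (n i))"
  using assms unfolding graded_basis_def by blast+

lemma graded_basis_span:
  assumes "graded_basis IX I d n e" "h \<in> I" "h \<in> forms l"
  shows "\<exists>r. (\<forall>i<d. r i \<in> Rf (l - int (n i))) \<and> h - (\<Sum>i<d. r i * e i) \<in> IX"
  using assms unfolding graded_basis_def by blast

lemma graded_basis_combination_form:
  assumes "graded_basis IX I d n e" "\<forall>i<d. r i \<in> Rf (l - int (n i))"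
  shows "(\<Sum>i<d. r i * e i) \<in> forms l"
proof (rule forms_sum)
  fix i assume "i \<in> {..<d}"
  then have "r i \<in> forms (l - int (n i))" "e i \<in> forms (int (n i))"
    using assms(2) graded_basis_form[OF assms(1)] by (auto simp: Rf_def)
  then show "r i * e i \<in> forms l" using forms_mult by fastforce
qed

text \<open>The corrected e_j vanish at q. Hence an element of I vanishes at q exactly if its
  coefficient at e_i does, that is, if this coefficient is divisible by \<open>line q\<close>.
  Minimality of \<open>n i\<close> ensures that the corrections never need a negative
  degree.\<close>

lemma graded_basis_add_point_pivot:
  assumes gb: "graded_basis IX I d n e" and I: "ideal I A2" and IX: "ideal IX A2" "IX \<subseteq> points_ideal {q}"
    and line: "line q \<noteq> 0"
    and i: "i < d" "ev q (e i) \<noteq> 0"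
    and van: "\<And>t h. t < n i \<Longrightarrow> h \<in> I \<Longrightarrow> h \<in> forms (int t) \<Longrightarrow> ev q h = 0"
  shows "\<exists>e'. graded_basis IX (I \<inter> points_ideal {q}) d (n(i := Suc (n i))) e'"
proof -
  interpret I: poly3_ideal I by (rule poly3_ideal.intro[OF I])
  interpret IX: poly3_ideal IX by (rule poly3_ideal.intro[OF IX(1)])
  have q: "ev q Y0 \<noteq> 0 \<or> ev q Y1 \<noteq> 0"
    using line by (auto simp: line_def)
  obtain L where L: "L \<in> Rf 1" "ev q L = 1"
    and Ldiv: "\<And>m r. r \<in> Rf (int m) \<Longrightarrow> \<exists>s\<in>Rf (int m - 1). r = scale (ev q r) (L ^ m) + line q * s"
    using ex_unit_form[OF q] by blast
  define c where "c j = ev q (e j) / ev q (e i)" for j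
  \<comment> \<open>For n j < n i the truncated exponent does no harm: e_j then vanishes at q by
    \<open>van\<close>, so \<open>c j = 0\<close>.\<close>
  define g where "g j = scale (c j) (L ^ (n j - n i))" for j
  define e' where "e' j = (if j = i then line q * e i else e j - g j * e i)" for j
  define J where "J = {..<d} - {i}"
  have split: "(\<Sum>j<d. f j) = f i + (\<Sum>j\<in>J. f j)" for f :: "nat \<Rightarrow> 'k poly3"
    unfolding J_def using i(1) by (intro sum.remove) auto
  have split': "(\<Sum>j<d. f j) = f i + (\<Sum>j\<in>J. f j)" for f :: "nat \<Rightarrow> 'k"
    unfolding J_def using i(1) by (intro sum.remove) auto
  have J: "j < d" "j \<noteq> i" if "j \<in> J" for j using that by (auto simp: J_def)
  have c0: "c j = 0" if "j < d" "n j < n i" for j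
    using van[OF that(2)] graded_basis_form[OF gb that(1)] by (simp add: c_def)
  have g: "g j \<in> Rf (int (n j) - int (n i))" if "j < d" for j
  proof (cases "n j < n i")
    case True then show ?thesis using c0[OF that] by (simp add: g_def Rf_0)
  next
    case False
    then show ?thesis using Rf_scale[OF Rf_power[OF L(1)], of "c j" "n j - n i"] by (simp add: g_def)
  qed
  have evg: "ev q (g j) = c j" for j by (simp add: g_def ev_simps L)
  have sum_e': "(\<Sum>j<d. r j * e' j) = (line q * r i - (\<Sum>j\<in>J. r j * g j)) * e i + (\<Sum>j\<in>J. r j * e j)" for r
  proof -
    have "(\<Sum>j<d. r j * e' j) = r i * (line q * e i) + (\<Sum>j\<in>J. r j * (e j - g j * e i))"
      unfolding split by (simp add: e'_def J)
    also have "\<dots> = (line q * r i) * e i + ((\<Sum>j\<in>J. r j * e j) - (\<Sum>j\<in>J. r j * g j) * e i)"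
      by (simp add: right_diff_distrib sum_subtractf sum_distrib_left sum_distrib_right mult_ac)
    finally show ?thesis by (simp add: algebra_simps)
  qed
  have rg: "(\<Sum>j\<in>J. r j * g j) \<in> Rf (l - int (n i))" if "\<forall>j\<in>J. r j \<in> Rf (l - int (n j))" for r l
  proof (rule Rf_sum)
    fix j assume j: "j \<in> J"
    then show "r j * g j \<in> Rf (l - int (n i))"
      using Rf_mult[of "r j" "l - int (n j)" "g j" "int (n j) - int (n i)"] that g[OF J(1)[OF j]] by simp
  qed
  have form: "e' j \<in> forms (int ((n(i := Suc (n i))) j))" if "j < d" for j
  proof (cases "j = i")
    case True
    then show ?thesis
      using forms_mult[of "line q" 1 "e i" "int (n i)"] line_Rf graded_basis_form[OF gb i(1)]
      by (simp add: e'_def Rf_def)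
  next
    case False
    have "g j * e i \<in> forms (int (n j))"
      using forms_mult[of "g j" "int (n j) - int (n i)" "e i" "int (n i)"] g[OF that] graded_basis_form[OF gb i(1)]
      by (simp add: Rf_def)
    then show ?thesis using False graded_basis_form[OF gb that] by (simp add: e'_def forms_diff)
  qed
  have "graded_basis IX (I \<inter> points_ideal {q}) d (n(i := Suc (n i))) e'"
  proof (rule graded_basisI)
    fix j assume j: "j < d"
    show "e' j \<in> forms (int ((n(i := Suc (n i))) j))" using form[OF j] .
    have "ev q (e' j) = 0"
      using i(2) by (simp add: e'_def ev_simps ev_line evg) (simp add: c_def)
    then have "e' j \<in> points_ideal {q}" using form_in_points_ideal_iff[OF form[OF j]] by simp
    moreover have "e' j \<in> I"
      using graded_basis_form[OF gb] i j by (auto simp: e'_def intro!: I.mult_in I.diff_in)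
    ultimately show "e' j \<in> I \<inter> points_ideal {q}" by blast
  next
    fix l h assume h: "h \<in> I \<inter> points_ideal {q}" "h \<in> forms l"
    obtain r where r: "\<forall>j<d. r j \<in> Rf (l - int (n j))" "h - (\<Sum>j<d. r j * e j) \<in> IX"
      using graded_basis_span[OF gb _ h(2)] h(1) by blast
    \<comment> \<open>The coefficient of e_i after each other e_j has been replaced by its corrected
      version plus g_j e_i.\<close>
    define s where "s = r i + (\<Sum>j\<in>J. r j * g j)"
    have s: "s \<in> Rf (l - int (n i))"
      unfolding s_def using r(1) i(1) J by (intro Rf_add rg) auto
    have "ev q h = 0" "ev q (h - (\<Sum>j<d. r j * e j)) = 0"
      using ev_point_ideal[of _ "{q}" q] h(1) r(2) IX(2) by blast+
    then have "(\<Sum>j<d. ev q (r j) * ev q (e j)) = 0" by (simp add: ev_simps)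
    moreover have "(\<Sum>j<d. ev q (r j) * ev q (e j)) = ev q s * ev q (e i)"
      unfolding split' using i(2) by (simp add: s_def ev_simps evg distrib_right sum_distrib_right c_def)
    ultimately have evs: "ev q s = 0" using i(2) by simp
    have "\<exists>t\<in>Rf (l - int (n i) - 1). s = line q * t"
    proof (cases "l < int (n i)")
      case True
      then show ?thesis using Rf_neg[OF _ s] Rf_0 by auto
    next
      case False
      then show ?thesis using Ldiv[of s "nat (l - int (n i))"] s evs by simp
    qed
    then obtain t where t: "t \<in> Rf (l - int (n i) - 1)" "s = line q * t" by blast
    define r' where "r' = r(i := t)"
    have "(\<Sum>j\<in>J. r' j * g j) = (\<Sum>j\<in>J. r j * g j)" "(\<Sum>j\<in>J. r' j * e j) = (\<Sum>j\<in>J. r j * e j)"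
      using J by (auto simp: r'_def intro!: sum.cong)
    then have "(\<Sum>j<d. r' j * e' j) = (s - (\<Sum>j\<in>J. r j * g j)) * e i + (\<Sum>j\<in>J. r j * e j)"
      unfolding sum_e' t(2) by (simp add: r'_def)
    also have "\<dots> = (\<Sum>j<d. r j * e j)" unfolding split s_def by simp
    finally have "h - (\<Sum>j<d. r' j * e' j) \<in> IX" using r(2) by simp
    moreover have "\<forall>j<d. r' j \<in> Rf (l - int ((n(i := Suc (n i))) j))"
      using r(1) t(1) by (simp add: r'_def algebra_simps)
    ultimately show "\<exists>r. (\<forall>j<d. r j \<in> Rf (l - int ((n(i := Suc (n i))) j))) \<and> h - (\<Sum>j<d. r j * e' j) \<in> IX"
      by blast
  next
    fix l r j assume r: "\<forall>j<d. r j \<in> Rf (l - int ((n(i := Suc (n i))) j))" "(\<Sum>j<d. r j * e' j) \<in> IX"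
      and j: "j < d"
    \<comment> \<open>A relation among the new elements becomes one among the old; its coefficient
      at e_i then yields \<open>line q * r i = 0\<close>, and \<open>line q\<close> cancels.\<close>
    define r' where "r' = r(i := line q * r i - (\<Sum>j\<in>J. r j * g j))"
    have rJ: "r j \<in> Rf (l - int (n j))" if "j \<in> J" for j using r(1) J[OF that] by force
    have ri: "r i \<in> Rf (l - int (n i) - 1)" using r(1) i(1) by (force simp: algebra_simps)
    have "(\<Sum>j\<in>J. r' j * e j) = (\<Sum>j\<in>J. r j * e j)"
      using J by (auto simp: r'_def intro!: sum.cong)
    then have "(\<Sum>j<d. r' j * e j) = (\<Sum>j<d. r j * e' j)"
      unfolding sum_e' split by (simp add: r'_def)
    then have "(\<Sum>j<d. r' j * e j) \<in> IX" using r(2) by simp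
    moreover have "\<forall>j<d. r' j \<in> Rf (l - int (n j))"
    proof (intro allI impI)
      fix j assume j: "j < d"
      show "r' j \<in> Rf (l - int (n j))"
      proof (cases "j = i")
        case True
        then show ?thesis
          using Rf_mult[OF line_Rf ri, of q] rg[of r l] rJ by (simp add: r'_def Rf_diff)
      next
        case False
        then show ?thesis using rJ[of j] j by (simp add: r'_def J_def)
      qed
    qed
    ultimately have r'0: "\<forall>j<d. r' j = 0" using graded_basis_unique[OF gb] by blast
    then have rJ0: "r j = 0" if "j \<in> J" for j using J[OF that] by (auto simp: r'_def split: if_splits)
    have "line q * r i = 0" using r'0 i(1) rJ0 by (auto simp: r'_def)
    with line have "r i = 0" by simp
    then show "r j = 0" using rJ0 j by (cases "j = i") (auto simp: J_def)
  qed
  then show ?thesis by blast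
qed

text \<open>Some term r_j e_j in the expansion of f is nonzero at q. Then n j \<le> n i because r_j
  is not 0, and n j \<ge> n i by \<open>van\<close>; so e_j is a pivot of the right degree, and a
  swap moves it to index i.\<close>

lemma graded_basis_add_point:
  assumes gb: "graded_basis IX I d n e" and I: "ideal I A2" and IX: "ideal IX A2" "IX \<subseteq> points_ideal {q}"
    and line: "line q \<noteq> 0" and i: "i < d"
    and nonvan: "f \<in> I" "f \<in> forms (int (n i))" "ev q f \<noteq> 0"
    and van: "\<And>t h. t < n i \<Longrightarrow> h \<in> I \<Longrightarrow> h \<in> forms (int t) \<Longrightarrow> ev q h = 0"
  shows "\<exists>e'. graded_basis IX (I \<inter> points_ideal {q}) d (n(i := Suc (n i))) e'"
proof -
  obtain r where r: "\<forall>j<d. r j \<in> Rf (int (n i) - int (n j))" "f - (\<Sum>j<d. r j * e j) \<in> IX"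
    using graded_basis_span[OF gb nonvan(1,2)] by blast
  have "ev q (f - (\<Sum>j<d. r j * e j)) = 0"
    using ev_point_ideal[of _ "{q}" q] r(2) IX(2) by blast
  then have "(\<Sum>j<d. ev q (r j) * ev q (e j)) \<noteq> 0"
    using nonvan(3) by (simp add: ev_simps)
  then obtain j where j: "j < d" "ev q (r j) \<noteq> 0" "ev q (e j) \<noteq> 0"
    by (metis (no_types, lifting) lessThan_iff mult_eq_0_iff sum.neutral)
  have "\<not> int (n i) - int (n j) < 0"
    using Rf_neg[of "int (n i) - int (n j)" "r j"] r(1) j by (auto simp: ev_simps)
  moreover have "\<not> n j < n i" using van graded_basis_form[OF gb j(1)] j(3) by blast
  ultimately have nj: "n j = n i" by simp
  define p where "p = (\<lambda>x. if x = i then j else if x = j then i else x)"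
  have p: "bij_betw p {..<d} {..<d}"
    by (rule bij_betw_byWitness[of _ p]) (use i j(1) in \<open>auto simp: p_def\<close>)
  have "n \<circ> p = n" using nj by (auto simp: p_def)
  then have "graded_basis IX I d n (e \<circ> p)"
    using graded_basis_permute[OF gb p] by simp
  then show ?thesis
    by (rule graded_basis_add_point_pivot[OF _ I IX line i _ van]) (use j in \<open>simp_all add: p_def\<close>)
qed

lemma graded_basis_iso:
  assumes gb: "graded_basis IX I d n e" and I: "homogeneous_ideal I" and IX: "homogeneous_ideal IX" "IX \<subseteq> I"
  shows "\<exists>\<phi>. graded_iso IX I Y0 Y1 d (\<lambda>i. int (n i)) \<phi>"
proof -
  interpret I: poly3_ideal I using I by (intro poly3_ideal.intro) (simp add: homogeneous_ideal_def)
  interpret IX: poly3_ideal IX using IX by (intro poly3_ideal.intro) (simp add: homogeneous_ideal_def)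
  define \<sigma> where "\<sigma> s = (\<Sum>i<d. s i * e i)" for s :: "nat \<Rightarrow> 'k poly3"
  define \<phi> where "\<phi> s = IX +>\<^bsub>A2\<^esub> \<sigma> s" for s
  have \<sigma>_I: "\<sigma> s \<in> I" for s
    unfolding \<sigma>_def using graded_basis_form[OF gb] by (intro I.sum_in I.mult_in) auto
  have free: "s \<in> free_module Y0 Y1 d \<longleftrightarrow> (\<forall>i<d. s i \<in> R) \<and> s \<in> extensional {..<d}" for s
    by (auto simp: free_module_def PiE_iff)
  have part: "s \<in> free_module_part Y0 Y1 d (\<lambda>i. int (n i)) l \<longleftrightarrow>
      (\<forall>i<d. s i \<in> Rf (l - int (n i))) \<and> s \<in> extensional {..<d}" for s l
    by (auto simp: free_module_part_def PiE_iff Rf_def)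
  have \<sigma>_restrict: "\<sigma> (restrict s {..<d}) = \<sigma> s" for s by (simp add: \<sigma>_def)
  \<comment> \<open>\<open>graded_basis\<close> excludes homogeneous relations; an arbitrary
    relation is split into its components.\<close>
  have zero: "r i = 0" if r: "\<forall>i<d. r i \<in> R" "\<sigma> r \<in> IX" and i: "i < d" for r i
  proof (rule hom_component_eqI)
    fix k
    \<comment> \<open>In this degree the coefficient of e_i is the component of degree k of
      r_i.\<close>
    define l where "l = k + n i"
    define \<rho> where "\<rho> j = (if n j \<le> l then hom_component (l - n j) (r j) else 0)" for j
    have "hom_component l (\<sigma> r) = \<sigma> \<rho>"
      unfolding \<sigma>_def hom_component_sum \<rho>_def
      using hom_component_mult_form[OF graded_basis_form(2)[OF gb]] by (intro sum.cong) auto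
    then have "(\<Sum>i<d. \<rho> i * e i) \<in> IX"
      using IX(1) r(2) by (metis homogeneous_ideal_def \<sigma>_def)
    moreover have "\<forall>j<d. \<rho> j \<in> Rf (int l - int (n j))"
      using Rf_hom_component r(1) Rf_0 by (auto simp: \<rho>_def simp flip: of_nat_diff)
    ultimately have "\<rho> i = 0" using graded_basis_unique[OF gb] i by blast
    then show "hom_component k (r i) = hom_component k 0" by (simp add: \<rho>_def l_def)
  qed
  have inj: "inj_on \<phi> (free_module Y0 Y1 d)"
  proof (rule inj_onI)
    fix s t assume s: "s \<in> free_module Y0 Y1 d" and t: "t \<in> free_module Y0 Y1 d" and eq: "\<phi> s = \<phi> t"
    have "\<sigma> (\<lambda>i. s i - t i) = \<sigma> s - \<sigma> t"
      by (simp add: \<sigma>_def left_diff_distrib sum_subtractf)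
    also have "\<dots> \<in> IX" using eq by (simp add: \<phi>_def IX.coset_eq)
    finally have diff: "\<sigma> (\<lambda>i. s i - t i) \<in> IX" .
    have "\<forall>i<d. s i - t i \<in> R" using s t by (simp add: free R_diff)
    from zero[OF this diff] have "s i = t i" if "i < d" for i using that by simp
    then show "s = t" using s t unfolding free by (intro extensionalityI[of _ "{..<d}"]) auto
  qed
  have sub: "\<phi> s \<in> residues IX I" for s
    unfolding residues_def \<phi>_def using \<sigma>_I by blast
  have form: "\<exists>s\<in>free_module_part Y0 Y1 d (\<lambda>i. int (n i)) l. \<phi> s = IX +>\<^bsub>A2\<^esub> h"
    if h: "h \<in> I" "h \<in> forms l" for h l
  proof -
    obtain r where r: "\<forall>i<d. r i \<in> Rf (l - int (n i))" "h - \<sigma> r \<in> IX"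
      using graded_basis_span[OF gb h] unfolding \<sigma>_def by blast
    have "\<phi> (restrict r {..<d}) = IX +>\<^bsub>A2\<^esub> h"
      using IX.uminus_in[OF r(2)] by (simp add: \<phi>_def \<sigma>_restrict IX.coset_eq)
    moreover have "restrict r {..<d} \<in> free_module_part Y0 Y1 d (\<lambda>i. int (n i)) l"
      using r(1) by (simp add: part)
    ultimately show ?thesis by blast
  qed
  have surj: "residues IX I \<subseteq> \<phi> ` free_module Y0 Y1 d"
  proof
    fix x assume "x \<in> residues IX I"
    then obtain h where h: "h \<in> I" "x = IX +>\<^bsub>A2\<^esub> h" by (auto simp: residues_def)
    obtain N where N: "h = (\<Sum>l\<le>N. hom_component l h)" using ex_sum_hom_component[of h] by blast
    have "\<forall>l. \<exists>s\<in>free_module_part Y0 Y1 d (\<lambda>i. int (n i)) (int l). \<phi> s = IX +>\<^bsub>A2\<^esub> hom_component l h"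
      by (intro allI form hom_component_forms) (use I h(1) in \<open>simp add: homogeneous_ideal_def\<close>)
    then obtain s where s: "\<And>l. s l \<in> free_module_part Y0 Y1 d (\<lambda>i. int (n i)) (int l)"
        "\<And>l. \<phi> (s l) = IX +>\<^bsub>A2\<^esub> hom_component l h"
      by metis
    define t where "t = restrict (\<lambda>i. \<Sum>l\<le>N. s l i) {..<d}"
    have "\<sigma> t = (\<Sum>l\<le>N. \<sigma> (s l))"
      unfolding t_def \<sigma>_restrict unfolding \<sigma>_def sum_distrib_right by (rule sum.swap)
    moreover have "(\<Sum>l\<le>N. \<sigma> (s l)) - (\<Sum>l\<le>N. hom_component l h) \<in> IX"
      unfolding sum_subtractf[symmetric] using s(2) by (intro IX.sum_in) (simp add: \<phi>_def IX.coset_eq)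
    ultimately have "\<sigma> t - h \<in> IX" by (simp flip: N)
    then have "\<phi> t = x" by (simp add: h(2) \<phi>_def IX.coset_eq)
    moreover have "t \<in> free_module Y0 Y1 d"
      using s(1) unfolding free part by (auto simp: t_def Rf_def intro!: R_sum)
    ultimately show "x \<in> \<phi> ` free_module Y0 Y1 d" by blast
  qed
  have "graded_iso IX I Y0 Y1 d (\<lambda>i. int (n i)) \<phi>"
    unfolding graded_iso_def
  proof (intro conjI ballI allI)
    show "bij_betw \<phi> (free_module Y0 Y1 d) (residues IX I)"
      unfolding bij_betw_def using inj sub surj by blast
  next
    fix s t
    show "\<phi> (\<lambda>i\<in>{..<d}. s i + t i) = \<phi> s \<oplus>\<^bsub>A2 Quot IX\<^esub> \<phi> t"
      unfolding \<phi>_def IX.quot_add \<sigma>_restrict by (simp add: \<sigma>_def distrib_right sum.distrib)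
  next
    fix r s
    show "\<phi> (\<lambda>i\<in>{..<d}. r * s i) = (IX +>\<^bsub>A2\<^esub> r) \<otimes>\<^bsub>A2 Quot IX\<^esub> \<phi> s"
      unfolding \<phi>_def IX.quot_mult \<sigma>_restrict by (simp add: \<sigma>_def sum_distrib_left mult.assoc)
  next
    fix l
    show "\<phi> ` free_module_part Y0 Y1 d (\<lambda>i. int (n i)) l = residues IX (I \<inter> forms l)"
    proof
      show "\<phi> ` free_module_part Y0 Y1 d (\<lambda>i. int (n i)) l \<subseteq> residues IX (I \<inter> forms l)"
        using \<sigma>_I graded_basis_combination_form[OF gb]
        unfolding residues_def \<phi>_def part \<sigma>_def by (auto simp: part)
      show "residues IX (I \<inter> forms l) \<subseteq> \<phi> ` free_module_part Y0 Y1 d (\<lambda>i. int (n i)) l"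
        using form unfolding residues_def by (auto, metis image_eqI)
    qed
  qed
  then show ?thesis by blast
qed

end

sublocale coords \<subseteq> two_forms Y0 Y1
  by unfold_locales (rule lin)+

section \<open>Expansion in powers of Z and division by a form that is monic in Z\<close>

context coords
begin

lemma ev_u_line: "ev u (line q) = ev q Y1" and ev_v_line: "ev v (line q) = - ev q Y0"
  by (simp_all add: ev_line dual)

lemma line_nonzero: "line q \<noteq> 0 \<longleftrightarrow> ev q Y0 \<noteq> 0 \<or> ev q Y1 \<noteq> 0"
proof
  show "line q \<noteq> 0 \<Longrightarrow> ev q Y0 \<noteq> 0 \<or> ev q Y1 \<noteq> 0"
    by (auto simp: line_def)
  show "ev q Y0 \<noteq> 0 \<or> ev q Y1 \<noteq> 0 \<Longrightarrow> line q \<noteq> 0"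
    using ev_u_line[of q] ev_v_line[of q] by (auto simp: ev_simps)
qed

lemma Rf_1_line:
  assumes "f \<in> Rf 1"
  shows "\<exists>q. f = line q"
proof -
  have "f \<in> poly3.span {Y0 ^ a * Y1 ^ b | a b. a + b = 1}"
    using Rf_in_span[of f 1] assms by simp
  moreover have "{Y0 ^ a * Y1 ^ b | a b. a + b = 1} \<subseteq> {Y0, Y1}"
    by (auto simp: add_is_1)
  ultimately have "f \<in> poly3.span {Y0, Y1}" using poly3.span_mono by blast
  then obtain a b where "f - scale a Y0 = scale b Y1"
    unfolding poly3.span_insert[of Y0 "{Y1}"] poly3.span_singleton by blast
  then have f: "f = scale a Y0 + scale b Y1" by (simp add: diff_eq_eq add.commute)
  \<comment> \<open>The point with Y0(q) = -b and Y1(q) = a, so that \<open>line q\<close> is a Y0 +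
    b Y1.\<close>
  define q where "q i = - b * u i + a * v i" for i
  have lin_ev: "ev q h = - b * ev u h + a * ev v h" if h: "h \<in> forms 1" for h
  proof -
    obtain c where "h = (\<Sum>i\<in>UNIV. scale (c i) (var i))" using forms_1_expand[OF h] by blast
    then show ?thesis by (simp add: sum_3 ev_simps q_def algebra_simps)
  qed
  have "ev q Y0 = - b" "ev q Y1 = a" using lin_ev lin by (simp_all add: dual)
  then show ?thesis using f by (intro exI[of _ q]) (simp add: line_def scale_add_left flip: scale_scale)
qed

lemma dehom_R:
  assumes "r \<in> R"
  shows "\<exists>p. \<delta> r = [:p:]"
  using assms unfolding R1_def
proof (induction rule: poly3.span_induct_alt)
  case base then show ?case by (intro exI[of _ 0]) (simp add: dehom_simps)
next
  case (step c x y)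
  then obtain a b p where "x = Y0 ^ a * Y1 ^ b" "\<delta> y = [:p:]" by blast
  moreover have "[:[:0, 1 :: 'k:]:] ^ b = [:[:0, 1:] ^ b:]" by (induction b) (simp_all add: one_pCons)
  ultimately show ?case
    by (intro exI[of _ "smult c ([:0, 1:] ^ b) + p"]) (simp add: dehom_simps dehom_coords)
qed

text \<open>Y0 and Y1 vanish at w and Z(w) = 1, so evaluating at w isolates the constant coefficient
  of Z^l.\<close>

lemma expand_powers:
  assumes "h \<in> forms (int l)"
  shows "\<exists>r. (\<forall>i<l. r i \<in> Rf (int l - int i)) \<and> h = scale (ev w h) (Z ^ l) + (\<Sum>i<l. r i * Z ^ i)"
  using assms
proof (induction rule: coords_induct)
  case (const c)
  show ?case by (simp add: scale_def ev_simps)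
next
  case (Y0 l g)
  then obtain r where r: "\<forall>i<l. r i \<in> Rf (int l - int i)" "g = scale (ev w g) (Z ^ l) + (\<Sum>i<l. r i * Z ^ i)"
    by blast
  define r' where "r' i = (if i = l then scale (ev w g) Y0 else Y0 * r i)" for i
  have "Y0 * g = Y0 * (scale (ev w g) (Z ^ l) + (\<Sum>i<l. r i * Z ^ i))" using r(2) by simp
  also have "\<dots> = scale (ev w (Y0 * g)) (Z ^ Suc l) + (\<Sum>i<Suc l. r' i * Z ^ i)"
    by (simp add: r'_def ev_simps dual distrib_left sum_distrib_left scale_mult_left scale_mult_right mult.assoc)
  finally have "Y0 * g = \<dots>" .
  moreover have "r' i \<in> Rf (int (Suc l) - int i)" if "i < Suc l" for i
    using that Rf_scale[OF Rf_Y0] Rf_mult[OF Rf_Y0, of "r i" "int l - int i"] r(1)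
    by (auto simp: r'_def algebra_simps less_Suc_eq)
  ultimately show ?case by blast
next
  case (Y1 l g)
  then obtain r where r: "\<forall>i<l. r i \<in> Rf (int l - int i)" "g = scale (ev w g) (Z ^ l) + (\<Sum>i<l. r i * Z ^ i)"
    by blast
  define r' where "r' i = (if i = l then scale (ev w g) Y1 else Y1 * r i)" for i
  have "Y1 * g = Y1 * (scale (ev w g) (Z ^ l) + (\<Sum>i<l. r i * Z ^ i))" using r(2) by simp
  also have "\<dots> = scale (ev w (Y1 * g)) (Z ^ Suc l) + (\<Sum>i<Suc l. r' i * Z ^ i)"
    by (simp add: r'_def ev_simps dual distrib_left sum_distrib_left scale_mult_left scale_mult_right mult.assoc)
  finally have "Y1 * g = \<dots>" .
  moreover have "r' i \<in> Rf (int (Suc l) - int i)" if "i < Suc l" for i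
    using that Rf_scale[OF Rf_Y1] Rf_mult[OF Rf_Y1, of "r i" "int l - int i"] r(1)
    by (auto simp: r'_def algebra_simps less_Suc_eq)
  ultimately show ?case by blast
next
  case (Z l g)
  then obtain r where r: "\<forall>i<l. r i \<in> Rf (int l - int i)" "g = scale (ev w g) (Z ^ l) + (\<Sum>i<l. r i * Z ^ i)"
    by blast
  define r' where "r' i = (case i of 0 \<Rightarrow> 0 | Suc j \<Rightarrow> r j)" for i
  have "Z * g = Z * (scale (ev w g) (Z ^ l) + (\<Sum>i<l. r i * Z ^ i))" using r(2) by simp
  also have "\<dots> = scale (ev w (Z * g)) (Z ^ Suc l) + (\<Sum>i<Suc l. r' i * Z ^ i)"
    by (simp add: r'_def ev_simps dual distrib_left sum_distrib_left scale_mult_right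
        sum.lessThan_Suc_shift mult_ac del: sum.lessThan_Suc)
  finally have "Z * g = \<dots>" .
  moreover have "r' i \<in> Rf (int (Suc l) - int i)" if "i < Suc l" for i
    using that r(1) Rf_0 by (auto simp: r'_def split: nat.split)
  ultimately show ?case by blast
next
  case (add l f g)
  then obtain r s where r: "\<forall>i<l. r i \<in> Rf (int l - int i)" "f = scale (ev w f) (Z ^ l) + (\<Sum>i<l. r i * Z ^ i)"
    and s: "\<forall>i<l. s i \<in> Rf (int l - int i)" "g = scale (ev w g) (Z ^ l) + (\<Sum>i<l. s i * Z ^ i)"
    by blast
  have "f + g = (scale (ev w f) (Z ^ l) + (\<Sum>i<l. r i * Z ^ i)) + (scale (ev w g) (Z ^ l) + (\<Sum>i<l. s i * Z ^ i))"
    using r(2) s(2) by simp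
  also have "\<dots> = scale (ev w (f + g)) (Z ^ l) + (\<Sum>i<l. (r i + s i) * Z ^ i)"
    unfolding ev_simps by (simp add: scale_add_left distrib_right sum.distrib)
  finally show ?case using r(1) s(1) by (intro exI[of _ "\<lambda>i. r i + s i"]) (auto intro: Rf_add)
next
  case (scale l g c)
  then obtain r where r: "\<forall>i<l. r i \<in> Rf (int l - int i)" "g = scale (ev w g) (Z ^ l) + (\<Sum>i<l. r i * Z ^ i)"
    by blast
  have "scale c g = scale c (scale (ev w g) (Z ^ l) + (\<Sum>i<l. r i * Z ^ i))" using r(2) by simp
  also have "\<dots> = scale (ev w (scale c g)) (Z ^ l) + (\<Sum>i<l. scale c (r i) * Z ^ i)"
    unfolding ev_simps by (simp add: scale_add scale_scale scale_mult_left poly3.scale_sum_right)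
  finally show ?case using r(1) by (intro exI[of _ "\<lambda>i. scale c (r i)"]) (auto intro: Rf_scale)
qed

text \<open>Division by F as a polynomial in Z over R, possible because its leading coefficient F(w)
  is a nonzero constant. Any ideal containing F is allowed, since it is applied to the multiples of
  F before these are known to exhaust I_X.\<close>

lemma reduce_powers:
  assumes I: "ideal I A2" and F: "F \<in> I" "F \<in> forms (int d)" "ev w F \<noteq> 0" and d: "d > 0"
    and h: "h \<in> forms (int l)"
  shows "\<exists>r. (\<forall>i<d. r i \<in> Rf (int l - int i)) \<and> h - (\<Sum>i<d. r i * Z ^ i) \<in> I"
  using h
proof (induction rule: coords_induct)
  interpret poly3_ideal I by (rule poly3_ideal.intro[OF I])
  {
    case (const c)
    show ?case
    proof (intro exI conjI allI impI)
      fix i :: nat assume "i < d"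
      show "(if i = 0 then Poly_Mapping.single 0 c else 0) \<in> Rf (int 0 - int i)"
        using R_const forms_single[of 0 c] R_0 by (auto simp: Rf_def)
    next
      have "(\<Sum>i<d. (if i = 0 then Poly_Mapping.single 0 c else 0) * Z ^ i) =
          (\<Sum>i<d. if i = 0 then Poly_Mapping.single 0 c else 0)"
        by (intro sum.cong) auto
      then show "Poly_Mapping.single 0 c - (\<Sum>i<d. (if i = 0 then Poly_Mapping.single 0 c else 0) * Z ^ i) \<in> I"
        using d by (simp add: sum.delta zero_in)
    qed
  next
    case (Y0 l g)
    then obtain r where r: "\<forall>i<d. r i \<in> Rf (int l - int i)" "g - (\<Sum>i<d. r i * Z ^ i) \<in> I" by blast
    have "Y0 * g - (\<Sum>i<d. (Y0 * r i) * Z ^ i) = Y0 * (g - (\<Sum>i<d. r i * Z ^ i))"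
      by (simp add: right_diff_distrib sum_distrib_left mult.assoc)
    moreover have "Y0 * r i \<in> Rf (int (Suc l) - int i)" if "i < d" for i
      using Rf_mult[OF Rf_Y0, of "r i" "int l - int i"] r(1) that by (simp add: algebra_simps)
    ultimately show ?case using mult_in[OF r(2)] by (intro exI[of _ "\<lambda>i. Y0 * r i"]) simp
  next
    case (Y1 l g)
    then obtain r where r: "\<forall>i<d. r i \<in> Rf (int l - int i)" "g - (\<Sum>i<d. r i * Z ^ i) \<in> I" by blast
    have "Y1 * g - (\<Sum>i<d. (Y1 * r i) * Z ^ i) = Y1 * (g - (\<Sum>i<d. r i * Z ^ i))"
      by (simp add: right_diff_distrib sum_distrib_left mult.assoc)
    moreover have "Y1 * r i \<in> Rf (int (Suc l) - int i)" if "i < d" for i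
      using Rf_mult[OF Rf_Y1, of "r i" "int l - int i"] r(1) that by (simp add: algebra_simps)
    ultimately show ?case using mult_in[OF r(2)] by (intro exI[of _ "\<lambda>i. Y1 * r i"]) simp
  next
    case (Z l g)
    then obtain r where r: "\<forall>i<d. r i \<in> Rf (int l - int i)" "g - (\<Sum>i<d. r i * Z ^ i) \<in> I" by blast
    obtain f where f: "\<forall>i<d. f i \<in> Rf (int d - int i)" "F = scale (ev w F) (Z ^ d) + (\<Sum>i<d. f i * Z ^ i)"
      using expand_powers[OF F(2)] by blast
    define c where "c = 1 / ev w F"
    obtain d' where d': "d = Suc d'" using d by (cases d) auto
    have "scale c F = scale c (scale (ev w F) (Z ^ d) + (\<Sum>i<d. f i * Z ^ i))" using f(2) by simp
    also have "\<dots> = Z ^ d + (\<Sum>i<d. scale c (f i) * Z ^ i)"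
      using F(3) by (simp add: scale_add scale_scale c_def scale_mult_left poly3.scale_sum_right)
    finally have cF: "Z ^ d + (\<Sum>i<d. scale c (f i) * Z ^ i) \<in> I" using scale_in[OF F(1)] by metis
    \<comment> \<open>Multiplication by Z shifts the coefficients; the term
      \<open>r d' * Z ^ d\<close> that sticks out is eliminated with the normalised F.\<close>
    define r' where "r' i = (case i of 0 \<Rightarrow> 0 | Suc j \<Rightarrow> r j) - r d' * scale c (f i)" for i
    have "(\<Sum>i<d. (case i of 0 \<Rightarrow> 0 | Suc j \<Rightarrow> r j) * Z ^ i) + r d' * Z ^ d = Z * (\<Sum>i<d. r i * Z ^ i)"
    proof -
      have "(\<Sum>i<Suc d'. (case i of 0 \<Rightarrow> 0 | Suc j \<Rightarrow> r j) * Z ^ i) = (\<Sum>i<d'. r i * Z ^ Suc i)"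
        by (subst sum.lessThan_Suc_shift) simp
      then show ?thesis
        unfolding d' by (simp add: sum_distrib_left distrib_left mult_ac)
    qed
    then have shift: "(\<Sum>i<d. (case i of 0 \<Rightarrow> 0 | Suc j \<Rightarrow> r j) * Z ^ i) =
        Z * (\<Sum>i<d. r i * Z ^ i) - r d' * Z ^ d"
      by (rule eq_diff_eq[THEN iffD2])
    have "(\<Sum>i<d. r' i * Z ^ i) =
        (\<Sum>i<d. (case i of 0 \<Rightarrow> 0 | Suc j \<Rightarrow> r j) * Z ^ i) - r d' * (\<Sum>i<d. scale c (f i) * Z ^ i)"
      by (simp add: r'_def left_diff_distrib sum_subtractf sum_distrib_left mult.assoc)
    then have "Z * g - (\<Sum>i<d. r' i * Z ^ i) =
        Z * (g - (\<Sum>i<d. r i * Z ^ i)) + r d' * (Z ^ d + (\<Sum>i<d. scale c (f i) * Z ^ i))"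
      unfolding shift by (simp add: right_diff_distrib distrib_left)
    moreover have "r' i \<in> Rf (int (Suc l) - int i)" if i: "i < d" for i
    proof -
      have "r d' * scale c (f i) \<in> Rf ((int l - int d') + (int d - int i))"
        using r(1) f(1) i d' by (intro Rf_mult Rf_scale) auto
      moreover have "(int l - int d') + (int d - int i) = int (Suc l) - int i" by (simp add: d')
      moreover have "(case i of 0 \<Rightarrow> 0 | Suc j \<Rightarrow> r j) \<in> Rf (int (Suc l) - int i)"
        using r(1) i Rf_0 by (auto split: nat.split)
      ultimately show ?thesis unfolding r'_def by (metis Rf_diff)
    qed
    ultimately show ?case using add_in[OF mult_in[OF r(2)] mult_in[OF cF]] by (metis (no_types, lifting))
  next
    case (add l f g)
    then obtain r s where r: "\<forall>i<d. r i \<in> Rf (int l - int i)" "f - (\<Sum>i<d. r i * Z ^ i) \<in> I"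
      and s: "\<forall>i<d. s i \<in> Rf (int l - int i)" "g - (\<Sum>i<d. s i * Z ^ i) \<in> I" by blast
    have "f + g - (\<Sum>i<d. (r i + s i) * Z ^ i) = (f - (\<Sum>i<d. r i * Z ^ i)) + (g - (\<Sum>i<d. s i * Z ^ i))"
      by (simp add: distrib_right sum.distrib)
    then have "f + g - (\<Sum>i<d. (r i + s i) * Z ^ i) \<in> I"
      using add_in[OF r(2) s(2)] by metis
    then show ?case using r(1) s(1)
      by (intro exI[of _ "\<lambda>i. r i + s i"]) (auto intro: Rf_add)
  next
    case (scale l g c)
    then obtain r where r: "\<forall>i<d. r i \<in> Rf (int l - int i)" "g - (\<Sum>i<d. r i * Z ^ i) \<in> I" by blast
    have "scale c g - (\<Sum>i<d. scale c (r i) * Z ^ i) = scale c (g - (\<Sum>i<d. r i * Z ^ i))"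
      by (simp add: scale_mult_left poly3.scale_sum_right poly3.scale_right_diff_distrib)
    then show ?case using scale_in[OF r(2)] r(1)
      by (intro exI[of _ "\<lambda>i. scale c (r i)"]) (auto intro: Rf_scale)
  }
qed

text \<open>\<open>\<delta>\<close> maps R into k[y] and Z to z, so such a sum can be compared
  coefficientwise in k[y][z].\<close>

lemma dehom_powers:
  assumes "\<forall>i<d. r i \<in> R"
  shows "degree (\<delta> (\<Sum>i<d. r i * Z ^ i)) < d \<or> \<delta> (\<Sum>i<d. r i * Z ^ i) = 0"
    "i < d \<Longrightarrow> \<delta> (r i) = [:coeff (\<delta> (\<Sum>i<d. r i * Z ^ i)) i:]"
proof -
  have "\<forall>i. \<exists>p. i < d \<longrightarrow> \<delta> (r i) = [:p:]" using assms dehom_R by blast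
  then obtain p where p: "\<And>i. i < d \<Longrightarrow> \<delta> (r i) = [:p i:]" by metis
  have "[:0, 1 :: 'k poly:] ^ c = monom 1 c" for c
    by (induction c) (simp_all add: monom_0 monom_Suc flip: one_pCons)
  then have *: "\<delta> (\<Sum>i<d. r i * Z ^ i) = (\<Sum>i<d. monom (p i) i)"
    by (simp add: dehom_simps dehom_coords p smult_monom)
  have coeff: "coeff (\<delta> (\<Sum>i<d. r i * Z ^ i)) j = (if j < d then p j else 0)" for j
    unfolding * by (simp add: coeff_sum sum.delta)
  then show "i < d \<Longrightarrow> \<delta> (r i) = [:coeff (\<delta> (\<Sum>i<d. r i * Z ^ i)) i:]" by (simp add: p)
  show "degree (\<delta> (\<Sum>i<d. r i * Z ^ i)) < d \<or> \<delta> (\<Sum>i<d. r i * Z ^ i) = 0"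
    using coeff by (metis leading_coeff_0_iff)
qed

lemma degree_dehom:
  assumes "F \<in> forms (int d)" "ev w F \<noteq> 0"
  shows "degree (\<delta> F) = d" "lead_coeff (\<delta> F) = [:ev w F:]"
proof -
  have "coeff (\<delta> F) i = 0" if "i > d" for i
    using dehom_tdeg_less[OF assms(1)] that by (intro poly_eqI) (simp add: tdeg_less_def)
  moreover have "coeff (\<delta> F) d \<noteq> 0" using coeff_dehom_top[OF assms(1)] assms(2) by simp
  ultimately show "degree (\<delta> F) = d"
    by (meson le_degree le_antisym degree_le)
  then show "lead_coeff (\<delta> F) = [:ev w F:]" using coeff_dehom_top[OF assms(1)] by simp
qed

lemma dehom_inj_int:
  assumes "r \<in> forms l" "\<delta> r = 0"
  shows "r = 0"
  using assms dehom_inj[of r "nat l"] forms_neg[of l r] by (cases "l < 0") auto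

text \<open>Starting point of the induction: \<open>UNIV\<close> is the ideal of the empty group of
  points. Spanning is division by F; independence holds because a nonzero multiple of
  \<open>\<delta> F\<close> has degree at least d in z.\<close>

lemma graded_basis_powers:
  assumes IX: "ideal IX A2" "\<And>h. h \<in> IX \<Longrightarrow> \<exists>g. h = F * g"
    and F: "F \<in> IX" "F \<in> forms (int d)" "ev w F \<noteq> 0" and d: "d > 0"
  shows "graded_basis IX UNIV d (\<lambda>i. i) (\<lambda>i. Z ^ i)"
proof (rule graded_basisI)
  fix l and h :: "'k poly3" assume h: "h \<in> forms l"
  show "\<exists>r. (\<forall>i<d. r i \<in> Rf (l - int i)) \<and> h - (\<Sum>i<d. r i * Z ^ i) \<in> IX"
  proof (cases "l < 0")
    case True
    then have "h = 0" using h forms_neg by blast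
    then show ?thesis using IX(1) Rf_0 by (intro exI[of _ "\<lambda>_. 0"]) (simp add: ideal_A2_iff)
  next
    case False
    then show ?thesis using reduce_powers[OF IX(1) F d, of h "nat l"] h by simp
  qed
next
  fix l r i assume r: "\<forall>i<d. r i \<in> Rf (l - int i)" "(\<Sum>i<d. r i * Z ^ i) \<in> IX" and i: "i < d"
  have R: "\<forall>i<d. r i \<in> R" using r(1) by (simp add: Rf_def)
  obtain g where "(\<Sum>i<d. r i * Z ^ i) = F * g" using IX(2) r(2) by blast
  then have \<delta>: "\<delta> (\<Sum>i<d. r i * Z ^ i) = \<delta> F * \<delta> g" by (simp add: dehom_simps)
  have "\<delta> g = 0"
  proof (rule ccontr)
    assume "\<delta> g \<noteq> 0"
    moreover have "\<delta> F \<noteq> 0" using degree_dehom[OF F(2,3)] F(3) by auto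
    ultimately show False
      using dehom_powers(1)[OF R] degree_dehom(1)[OF F(2,3)] unfolding \<delta> by (auto simp: degree_mult_eq)
  qed
  then have "\<delta> (r i) = 0" using dehom_powers(2)[OF R i] \<delta> by simp
  then show "r i = 0" using r(1) i dehom_inj_int[of "r i" "l - int i"] by (simp add: Rf_def)
qed (simp_all add: forms_power lin)

end

section \<open>Prime ideals of plane curves are principal\<close>

lemma prime_elem_linear: "prime_elem [:- a, 1 :: 'k::field:]"
proof (rule prime_elemI)
  show "\<not> is_unit [:- a, 1:]" by (simp add: is_unit_iff_degree)
  fix p q :: "'k poly" assume "[:- a, 1:] dvd p * q"
  then show "[:- a, 1:] dvd p \<or> [:- a, 1:] dvd q" by (simp flip: poly_eq_0_iff_dvd)
qed simp

text \<open>Gauss's lemma: c splits into factors y - a, each of them prime in k[y][z]; as none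
  divides G, each divides Q and is cancelled.\<close>

lemma dvd_of_smult_eq_mult:
  fixes f Q G :: "'k::alg_closed_field poly poly"
  assumes "c \<noteq> 0" "smult c f = Q * G" "\<And>a. \<not> [:[:- a, 1:]:] dvd G"
  shows "G dvd f"
  using assms(1,2)
proof (induction "degree c" arbitrary: c Q)
  case 0
  then obtain c0 where c: "c = [:c0:]" "c0 \<noteq> 0" by (metis degree_eq_zeroE pCons_0_0)
  then have "[:1 / c0:] * c = 1" by (simp add: one_pCons)
  then have "f = smult ([:1 / c0:] * c) f" by simp
  also have "\<dots> = smult [:1 / c0:] (Q * G)" using 0(3) by (metis smult_smult)
  finally show ?case by (metis dvd_smult dvd_triv_right)
next
  case (Suc n)
  then have "degree c > 0" by linarith
  then obtain a where "poly c a = 0" using alg_closed_imp_poly_has_root[of c] by blast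
  then obtain c' where c': "c = [:- a, 1:] * c'" by (auto simp: poly_eq_0_iff_dvd)
  let ?p = "[:[:- a, 1:]:]"
  have prime: "prime_elem ?p" by (rule lift_prime_elem_poly[OF prime_elem_linear])
  have eq: "?p * smult c' f = Q * G"
    using Suc.prems(2) by (simp add: c' smult_smult)
  then have "?p dvd Q * G" by (metis dvd_triv_left)
  then have "?p dvd Q" using prime_elem_dvd_multD[OF prime] assms(3) by blast
  then obtain Q' where "Q = ?p * Q'" by blast
  then have "?p * smult c' f = ?p * (Q' * G)" using eq by (simp only: mult.assoc)
  then have "smult c' f = Q' * G" using prime by (metis mult_cancel_left prime_elem_def)
  moreover have "c' \<noteq> 0" using Suc.prems(1) c' by auto
  moreover have "n = degree c'"
    using Suc.hyps(2) \<open>c' \<noteq> 0\<close> by (simp add: c' degree_mult_eq del: mult_pCons_left)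
  ultimately show ?case using Suc.hyps(1) by blast
qed

context coords
begin

lemma ex_form_dehom: "\<exists>l. \<exists>h\<in>forms (int l). \<delta> h = g"
proof -
  \<comment> \<open>A crude bound for the total degree of g.\<close>
  define l where "l = degree g + (\<Sum>c\<le>degree g. degree (coeff g c))"
  have "coeff (coeff g c) b = 0" if "Suc l \<le> b + c" for b c
  proof (cases "c \<le> degree g")
    case True
    then have "degree (coeff g c) \<le> (\<Sum>c\<le>degree g. degree (coeff g c))"
      by (intro member_le_sum) auto
    then have "degree (coeff g c) < b" using that True by (simp add: l_def)
    then show ?thesis by (rule coeff_eq_0)
  next
    case False then show ?thesis by (simp add: coeff_eq_0)
  qed
  then show ?thesis using dehom_surj[of l g] by (auto simp: tdeg_less_def)
qed

lemma same_dehom: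
  assumes "f \<in> forms (int l)" "h \<in> forms (int m)" "\<delta> f = \<delta> h"
  shows "Y0 ^ m * f = Y0 ^ l * h"
proof -
  have "Y0 ^ m * f \<in> forms (int (m + l))" "Y0 ^ l * h \<in> forms (int (m + l))"
    using forms_mult[OF forms_power[OF lin(1), of m] assms(1)] forms_mult[OF forms_power[OF lin(1), of l] assms(2)]
    by (simp_all add: add.commute)
  moreover have "\<delta> (Y0 ^ m * f) = \<delta> (Y0 ^ l * h)"
    using assms(3) by (simp add: dehom_simps dehom_coords)
  ultimately have "Y0 ^ m * f - Y0 ^ l * h = 0"
    by (intro dehom_inj[of _ "m + l"] forms_diff) (simp_all add: dehom_simps)
  then show ?thesis by simp
qed

text \<open>Setting \<open>Y0 = 0\<close>; on forms the kernel is generated by \<open>Y0\<close>, which is thereby prime.\<close>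

abbreviation "\<rho> \<equiv> dehom (\<lambda>_. 0) v w"

lemma infinity_coords: "\<rho> Y0 = 0" "\<rho> Y1 = [:[:0, 1:]:]" "\<rho> Z = [:0, 1:]"
proof -
  have "ev (\<lambda>_. 0) h = 0" if h: "h \<in> forms 1" for h :: "'k poly3"
    using forms_1_expand[OF h] by (auto simp: ev_simps)
  then show "\<rho> Y0 = 0" "\<rho> Y1 = [:[:0, 1:]:]" "\<rho> Z = [:0, 1:]"
    by (simp_all add: dehom_linear lin dual one_pCons)
qed

lemma infinity_kernel:
  assumes "h \<in> forms (int l)" "\<rho> h = 0"
  shows "\<exists>g\<in>forms (int l - 1). h = Y0 * g"
proof -
  obtain C where h: "h = (\<Sum>x\<in>index l. scale (C x) (basis l x))"
    using forms_eq_basis_sum[OF assms(1)] by blast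
  \<comment> \<open>The monomials without Y0: \<open>\<rho>\<close> keeps them independent and kills
    all others.\<close>
  define B where "B = {(b, c) \<in> index l. b + c = l}"
  have B: "B \<subseteq> index l" by (auto simp: B_def)
  have split: "(\<Sum>x\<in>index l. f x) = (\<Sum>x\<in>index l - B. f x) + (\<Sum>x\<in>B. f x)" for f :: "_ \<Rightarrow> 'k poly3"
    by (rule sum.subset_diff[OF B]) simp
  have Y0pow: "l - b - c = Suc (l - b - c - 1)" if "(b, c) \<in> index l - B" for b c
    using that by (auto simp: index_def B_def)
  define g where "g = (\<Sum>(b, c)\<in>index l - B. scale (C (b, c)) (Y0 ^ (l - b - c - 1) * Y1 ^ b * Z ^ c))"
  have low: "(\<Sum>x\<in>index l - B. scale (C x) (basis l x)) = Y0 * g"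
    unfolding g_def sum_distrib_left
  proof (rule sum.cong[OF refl], clarify)
    fix b c assume "(b, c) \<in> index l" "(b, c) \<notin> B"
    then have "Y0 ^ (l - b - c) = Y0 * Y0 ^ (l - b - c - 1)" using Y0pow[of b c] by (metis Diff_iff power_Suc)
    then show "scale (C (b, c)) (basis l (b, c)) = Y0 * scale (C (b, c)) (Y0 ^ (l - b - c - 1) * Y1 ^ b * Z ^ c)"
      by (simp add: basis_def scale_mult_right mult.assoc)
  qed
  have "g \<in> forms (int l - 1)"
    unfolding g_def
  proof (rule forms_sum, clarify)
    fix b c assume *: "(b, c) \<in> index l" "(b, c) \<notin> B"
    then have "int (l - b - c - 1) + int b + int c = int l - 1" by (auto simp: index_def B_def)
    then show "scale (C (b, c)) (Y0 ^ (l - b - c - 1) * Y1 ^ b * Z ^ c) \<in> forms (int l - 1)"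
      using forms_mult[OF forms_mult[OF forms_power[OF lin(1), of "l - b - c - 1"] forms_power[OF lin(2), of b]] forms_power[OF lin(3), of c]]
      by (auto intro: forms_scale)
  qed
  moreover have "C x = 0" if "x \<in> B" for x
  proof -
    obtain b c where x: "x = (b, c)" "b + c = l" using \<open>x \<in> B\<close> by (auto simp: B_def)
    have "[:[:0, 1:]:] ^ b = [:monom (1 :: 'k) b:]" for b
      by (induction b) (simp_all add: monom_0 monom_Suc one_pCons)
    moreover have "[:0, 1 :: 'k poly:] ^ c = monom 1 c" for c
      by (induction c) (simp_all add: monom_0 monom_Suc flip: one_pCons)
    ultimately have \<rho>B: "\<rho> (basis l (b, c)) = monom (monom 1 b) c" if "(b, c) \<in> B" for b c
      using that by (auto simp: basis_def B_def dehom_simps infinity_coords smult_monom)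
    have "h = Y0 * g + (\<Sum>x\<in>B. scale (C x) (basis l x))" unfolding h split low by simp
    then have "0 = (\<Sum>x\<in>B. smult [:C x:] (\<rho> (basis l x)))"
      using assms(2) by (simp add: dehom_simps infinity_coords)
    then have "0 = coeff (coeff (\<Sum>x\<in>B. smult [:C x:] (\<rho> (basis l x))) c) b" by simp
    also have "\<dots> = (\<Sum>x\<in>B. if x = (b, c) then C (b, c) else 0)"
      unfolding coeff_sum by (intro sum.cong) (auto simp: \<rho>B split: if_splits)
    finally show "C x = 0" using that x finite_subset[OF B] by (simp add: sum.delta)
  qed
  ultimately show ?thesis unfolding h split low by (intro bexI[of _ g]) simp_all
qed

end

text \<open>\<open>no_line\<close> makes Y0 cancellable modulo I_X, so that passing to the chart Y0
  = 1 loses no information, and it keeps nonzero polynomials in y alone out of the affine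
  ideal.\<close>

locale curve_coords = coords Y0 Y1 Z u v w
  for Y0 Y1 Z :: "'k::alg_closed_field poly3" and u v w +
  fixes IX :: "'k poly3 set" and F :: "'k poly3" and e :: nat
  assumes hom: "homogeneous_ideal IX" and prime: "primeideal IX A2"
    and F: "F \<in> IX" "F \<in> forms (int e)" "ev w F \<noteq> 0"
    and no_line: "\<And>f. f \<in> Rf 1 \<Longrightarrow> f \<in> IX \<Longrightarrow> f = 0"
begin

sublocale poly3_ideal IX
  using hom by (intro poly3_ideal.intro) (simp add: homogeneous_ideal_def)

lemma prime_IX: "a * b \<in> IX \<Longrightarrow> a \<in> IX \<or> b \<in> IX" and one_notin: "1 \<notin> IX"
  using prime by (auto simp: primeideal_A2_iff)

lemma Y0_nonzero: "Y0 \<noteq> 0"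
  using dual(1) by (auto simp: ev_simps)

lemma Y0_power_mult_in: "Y0 ^ m * f \<in> IX \<Longrightarrow> f \<in> IX"
  using no_line[OF Rf_Y0] Y0_nonzero by (induction m) (auto dest: prime_IX simp: mult.assoc)

definition J :: "'k poly poly set" where
  "J = \<delta> ` IX"

text \<open>The components of a preimage are brought to a common degree by powers of Y0, which
  \<open>\<delta>\<close> sends to 1.\<close>

lemma J_form:
  assumes "g \<in> J"
  shows "\<exists>N. \<exists>h\<in>IX \<inter> forms (int N). \<delta> h = g"
proof -
  obtain h where h: "h \<in> IX" "\<delta> h = g" using assms by (auto simp: J_def)
  obtain N where N: "h = (\<Sum>l\<le>N. hom_component l h)" using ex_sum_hom_component[of h] by blast
  define h' where "h' = (\<Sum>l\<le>N. Y0 ^ (N - l) * hom_component l h)"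
  have "h' \<in> IX" unfolding h'_def
    using hom h(1) by (intro sum_in mult_in) (simp add: homogeneous_ideal_def)
  moreover have "h' \<in> forms (int N)" unfolding h'_def
  proof (rule forms_sum)
    fix l assume "l \<in> {..N}"
    then show "Y0 ^ (N - l) * hom_component l h \<in> forms (int N)"
      using forms_mult[OF forms_power[OF lin(1), of "N - l"] hom_component_forms[of l h]]
      by (simp flip: of_nat_add)
  qed
  moreover have "\<delta> h' = \<delta> (\<Sum>l\<le>N. hom_component l h)"
    unfolding h'_def by (simp add: dehom_simps dehom_coords)
  ultimately show ?thesis using h(2) N by (metis IntI)
qed

text \<open>Forms with the same image agree up to powers of Y0, and these cancel modulo the prime
  I_X.\<close>

lemma form_in_IX_iff:
  assumes "h \<in> forms (int l)"
  shows "\<delta> h \<in> J \<longleftrightarrow> h \<in> IX"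
proof
  assume "\<delta> h \<in> J"
  then obtain N h' where "h' \<in> IX" "h' \<in> forms (int N)" "\<delta> h = \<delta> h'" using J_form by fastforce
  then have "Y0 ^ N * h \<in> IX" using same_dehom[OF assms] mult_in by metis
  then show "h \<in> IX" by (rule Y0_power_mult_in)
qed (auto simp: J_def)

lemma J_diff: "f \<in> J \<Longrightarrow> g \<in> J \<Longrightarrow> f - g \<in> J"
  unfolding J_def by (auto intro: diff_in simp flip: dehom_simps)

lemma J_mult: "g \<in> J \<Longrightarrow> f * g \<in> J"
proof -
  assume "g \<in> J"
  then obtain h where "h \<in> IX" "g = \<delta> h" by (auto simp: J_def)
  moreover obtain h' where "f = \<delta> h'" using ex_form_dehom[of f] by blast
  ultimately show ?thesis unfolding J_def by (auto intro: mult_in simp flip: dehom_simps)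
qed

lemma J_prime:
  assumes "f * g \<in> J"
  shows "f \<in> J \<or> g \<in> J"
proof -
  obtain l h m h' where h: "h \<in> forms (int l)" "\<delta> h = f" "h' \<in> forms (int m)" "\<delta> h' = g"
    using ex_form_dehom[of f] ex_form_dehom[of g] by blast
  have "h * h' \<in> forms (int (l + m))" using forms_mult[OF h(1,3)] by simp
  moreover have "\<delta> (h * h') \<in> J" using assms h by (simp add: dehom_simps)
  ultimately have "h * h' \<in> IX" using form_in_IX_iff by blast
  then show ?thesis using prime_IX h by (auto simp: J_def)
qed

text \<open>Otherwise p splits into factors y - a, and since J is prime, one of them lies in J
  unless p is a unit. Then Y1 - a Y0 lies in I_X, against \<open>no_line\<close>.\<close>

lemma J_const:
  assumes "[:p:] \<in> J"
  shows "p = 0"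
proof (rule ccontr)
  assume "p \<noteq> 0"
  then show False using assms
  proof (induction "degree p" arbitrary: p)
    case 0
    then obtain c where c: "p = [:c:]" "c \<noteq> 0" by (metis degree_eq_zeroE pCons_0_0)
    have "\<delta> (Poly_Mapping.single 0 c) \<in> J" using 0 by (simp add: c dehom_simps)
    then have "Poly_Mapping.single 0 c \<in> IX"
      using form_in_IX_iff[of "Poly_Mapping.single 0 c" 0] forms_single[of 0 c] by simp
    then have "scale (1 / c) (Poly_Mapping.single 0 c) \<in> IX" by (rule scale_in)
    then show False using c(2) one_notin by (simp add: scale_def mult_single)
  next
    case (Suc n)
    then have "degree p > 0" by linarith
    then obtain a where "poly p a = 0" using alg_closed_imp_poly_has_root[of p] by blast
    then obtain q where q: "p = [:- a, 1:] * q" by (auto simp: poly_eq_0_iff_dvd)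
    have q0: "q \<noteq> 0" using Suc.prems(1) q by auto
    then have "degree q = n" using Suc.hyps(2) by (simp add: q degree_mult_eq del: mult_pCons_left)
    moreover have "[:p:] = [:[:- a, 1:]:] * [:q:]" by (simp add: q)
    ultimately have "[:[:- a, 1:]:] \<in> J"
      using Suc J_prime[of "[:[:- a, 1:]:]" "[:q:]"] q0 by metis
    moreover have *: "Y1 - scale a Y0 \<in> Rf 1" by (intro Rf_diff Rf_scale Rf_Y0 Rf_Y1)
    moreover have "\<delta> (Y1 - scale a Y0) = [:[:- a, 1:]:]"
      by (simp add: dehom_simps dehom_coords one_pCons)
    ultimately have "Y1 - scale a Y0 \<in> IX"
      using form_in_IX_iff[of "Y1 - scale a Y0" 1] by (simp add: Rf_def)
    then have "Y1 - scale a Y0 = 0" using no_line * by blast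
    moreover have "ev v (Y1 - scale a Y0) = 1" by (simp add: ev_simps dual)
    ultimately show False by (simp add: ev_simps)
  qed
qed

text \<open>G has least degree in z and, subject to that, a leading coefficient of least degree. By
  the first choice pseudo-division by G leaves no remainder; by the second no factor y - a splits
  off, so Gauss's lemma removes the multiplier c.\<close>

lemma J_generator: "\<exists>G\<in>J. G \<noteq> 0 \<and> (\<forall>g\<in>J. G dvd g)"
proof -
  have F0: "\<delta> F \<in> J" "\<delta> F \<noteq> 0" using F degree_dehom[OF F(2,3)] by (auto simp: J_def)
  define m where "m = (LEAST m. \<exists>g\<in>J. g \<noteq> 0 \<and> degree g = m)"
  have "\<exists>g\<in>J. g \<noteq> 0 \<and> degree g = m"
    unfolding m_def by (rule LeastI_ex) (use F0 in blast)
  then have ex: "\<exists>k. \<exists>g\<in>J. g \<noteq> 0 \<and> degree g = m \<and> degree (lead_coeff g) = k" by blast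
  have m_le: "m \<le> degree g" if "g \<in> J" "g \<noteq> 0" for g
    unfolding m_def by (rule Least_le) (use that in blast)
  define k where "k = (LEAST k. \<exists>g\<in>J. g \<noteq> 0 \<and> degree g = m \<and> degree (lead_coeff g) = k)"
  obtain G where G: "G \<in> J" "G \<noteq> 0" "degree G = m" "degree (lead_coeff G) = k"
    using LeastI_ex[OF ex] unfolding k_def by blast
  have k_le: "k \<le> degree (lead_coeff g)" if "g \<in> J" "g \<noteq> 0" "degree g = m" for g
    unfolding k_def by (rule Least_le) (use that in blast)
  have content: "\<not> [:[:- a, 1:]:] dvd G" for a
  proof
    assume "[:[:- a, 1:]:] dvd G"
    then obtain G' where G': "G = [:[:- a, 1:]:] * G'" by blast
    have "G' \<in> J" using J_prime[of "[:[:- a, 1:]:]" G'] G(1) J_const[of "[:- a, 1:]"] by (auto simp: G')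
    moreover have G'0: "G' \<noteq> 0" using G(2) G' by auto
    moreover have "degree G' = m" using G(3) G'0 by (simp add: G')
    ultimately have "k \<le> degree (lead_coeff G')" by (rule k_le)
    moreover have "lead_coeff G = [:- a, 1:] * lead_coeff G'" by (simp add: G')
    then have "k = 1 + degree (lead_coeff G')"
      using G(4) G'0 by (simp add: degree_mult_eq del: mult_pCons_left)
    ultimately show False by simp
  qed
  have "G dvd g" if "g \<in> J" for g
  proof -
    obtain c q where c: "c \<noteq> 0" "smult c g = G * q + pseudo_mod g G"
      using pseudo_mod(1)[OF G(2)] by blast
    have "pseudo_mod g G = [:c:] * g - q * G" using c(2) by (simp add: algebra_simps)
    then have "pseudo_mod g G \<in> J" using J_diff J_mult that G(1) by metis
    then have "pseudo_mod g G = 0" using pseudo_mod(2)[OF G(2), of g] m_le G(3) by force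
    then show ?thesis using dvd_of_smult_eq_mult[OF c(1), of g q G] c(2) content by (simp add: mult.commute)
  qed
  then show ?thesis using G by blast
qed

end

section \<open>Comparison of F with the generator of the affine ideal\<close>

context curve_coords
begin

lemma e_pos: "e > 0"
proof (rule ccontr)
  assume "\<not> e > 0"
  then have "F \<in> forms 0" using F(2) by simp
  then obtain c where c: "F = Poly_Mapping.single 0 c" using forms_0_const by blast
  then have "c \<noteq> 0" using F(3) by (auto simp: ev_simps)
  moreover have "scale (1 / c) F \<in> IX" using F(1) by (rule scale_in)
  ultimately show False using one_notin by (simp add: scale_def c mult_single)
qed

text \<open>Otherwise Y0 splits off and leaves a homogenisation of smaller degree.\<close>

lemma infinity_nonzero:
  assumes "H \<in> forms (int N)" "\<delta> H \<noteq> 0" "\<And>M H'. H' \<in> forms (int M) \<Longrightarrow> \<delta> H' = \<delta> H \<Longrightarrow> N \<le> M"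
  shows "\<rho> H \<noteq> 0"
proof
  assume "\<rho> H = 0"
  then obtain H' where H': "H' \<in> forms (int N - 1)" "H = Y0 * H'"
    using infinity_kernel[OF assms(1)] by blast
  have "\<delta> H' = \<delta> H" by (simp add: H'(2) dehom_simps dehom_coords)
  moreover have "N \<noteq> 0"
  proof
    assume "N = 0"
    then have "H' = 0" using forms_neg[of "- 1" H'] H'(1) by simp
    then show False using assms(2) H'(2) by (simp add: dehom_simps)
  qed
  ultimately show False using assms(3)[of H' "N - 1"] H'(1) by (cases N) auto
qed

text \<open>Homogenise \<open>\<delta> F = G * q\<close> factor by factor in least degrees N and M.
  The product is not divisible by Y0, so N + M \<le> e; the homogenisation of G lies in I_X, so e
  \<le> N. Hence q is constant.\<close>

lemma degree_generator:
  assumes min: "\<And>m f. f \<in> IX \<Longrightarrow> f \<in> forms (int m) \<Longrightarrow> f \<noteq> 0 \<Longrightarrow> e \<le> m"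
    and G: "G \<in> J" "G \<noteq> 0" "\<forall>g\<in>J. G dvd g"
  shows "degree G = e"
proof -
  have "\<delta> F \<in> J" using F by (auto simp: J_def)
  then obtain q where q: "\<delta> F = G * q" using G(3) by blast
  have \<delta>F: "\<delta> F \<noteq> 0" using degree_dehom[OF F(2,3)] F(3) by auto
  define N where "N = (LEAST N. \<exists>H\<in>forms (int N). \<delta> H = G)"
  obtain H where H: "H \<in> forms (int N)" "\<delta> H = G"
    using LeastI_ex[OF ex_form_dehom[of G]] unfolding N_def by blast
  have N_le: "N \<le> M" if "H' \<in> forms (int M)" "\<delta> H' = G" for M H'
    unfolding N_def by (rule Least_le) (use that in blast)
  define M where "M = (LEAST N. \<exists>H\<in>forms (int N). \<delta> H = q)"
  obtain K where K: "K \<in> forms (int M)" "\<delta> K = q"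
    using LeastI_ex[OF ex_form_dehom[of q]] unfolding M_def by blast
  have M_le: "M \<le> M'" if "H' \<in> forms (int M')" "\<delta> H' = q" for M' H'
    unfolding M_def by (rule Least_le) (use that in blast)
  have "\<rho> H \<noteq> 0" using infinity_nonzero[OF H(1)] N_le H(2) G(2) by blast
  moreover have "\<rho> K \<noteq> 0" using infinity_nonzero[OF K(1)] M_le K(2) q \<delta>F by auto
  ultimately have \<rho>HK: "\<rho> (H * K) \<noteq> 0" by (simp add: dehom_simps)
  have "H * K \<in> forms (int (N + M))" using forms_mult[OF H(1) K(1)] by simp
  moreover have "\<delta> (H * K) = \<delta> F" by (simp add: dehom_simps H K q)
  ultimately have eq: "Y0 ^ e * (H * K) = Y0 ^ (N + M) * F"
    using same_dehom F(2) by blast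
  have "N + M \<le> e"
  proof (rule ccontr)
    assume *: "\<not> N + M \<le> e"
    then have "N + M = e + Suc (N + M - e - 1)" by simp
    then have "Y0 ^ (N + M) = Y0 ^ e * (Y0 * Y0 ^ (N + M - e - 1))"
      by (metis power_add power_Suc)
    then have "Y0 ^ e * (H * K) = Y0 ^ e * (Y0 * Y0 ^ (N + M - e - 1) * F)"
      using eq by (simp only: mult.assoc)
    then have "H * K = Y0 * Y0 ^ (N + M - e - 1) * F" using Y0_nonzero by simp
    then have "\<rho> (H * K) = 0" by (simp only: dehom_simps infinity_coords mult_zero_left)
    then show False using \<rho>HK by contradiction
  qed
  moreover have "H \<in> IX" using form_in_IX_iff[OF H(1)] H(2) G(1) by simp
  moreover have "H \<noteq> 0" using H(2) G(2) by (auto simp: dehom_simps)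
  ultimately have "e \<le> N" using min[OF _ H(1)] by blast
  with \<open>N + M \<le> e\<close> have "M = 0" "N = e" by auto
  then have "K \<in> forms 0" using K(1) by simp
  then obtain c where "K = Poly_Mapping.single 0 c" using forms_0_const by blast
  then have "degree q = 0" using K(2) by (auto simp: dehom_simps)
  moreover have "degree (\<delta> F) = degree G + degree q"
    using q \<delta>F by (auto simp: degree_mult_eq)
  ultimately show ?thesis using degree_dehom[OF F(2,3)] by simp
qed

text \<open>Reduce a component of h modulo F. The remainder lies in I_X and has degree less than e
  in z, but it is a multiple of G, which has degree e; so it is 0.\<close>

lemma principal:
  assumes min: "\<And>m f. f \<in> IX \<Longrightarrow> f \<in> forms (int m) \<Longrightarrow> f \<noteq> 0 \<Longrightarrow> e \<le> m"
    and h: "h \<in> IX"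
  shows "\<exists>g. h = F * g"
proof -
  obtain G where G: "G \<in> J" "G \<noteq> 0" "\<forall>g\<in>J. G dvd g" using J_generator by blast
  have deg: "degree G = e" by (rule degree_generator[OF min G])
  define P where "P = range ((*) F)"
  have P: "ideal P A2"
    unfolding ideal_A2_iff
  proof (intro conjI ballI allI)
    show "0 \<in> P" unfolding P_def by (rule range_eqI[of _ _ 0]) simp
    fix x assume "x \<in> P"
    then obtain a where a: "x = F * a" by (auto simp: P_def)
    show "y * x \<in> P" for y
      unfolding P_def by (rule range_eqI[of _ _ "y * a"]) (simp add: a mult.left_commute)
    fix y assume "y \<in> P"
    then obtain b where b: "y = F * b" by (auto simp: P_def)
    show "x + y \<in> P"
      unfolding P_def by (rule range_eqI[of _ _ "a + b"]) (simp add: a b distrib_left)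
  qed
  have FP: "F \<in> P" unfolding P_def by (metis mult.right_neutral rangeI)
  have "hom_component l h \<in> P" for l
  proof -
    have hl: "hom_component l h \<in> IX" using hom h by (simp add: homogeneous_ideal_def)
    obtain r where r: "\<forall>i<e. r i \<in> Rf (int l - int i)" "hom_component l h - (\<Sum>i<e. r i * Z ^ i) \<in> P"
      using reduce_powers[OF P FP F(2,3) e_pos hom_component_forms] by blast
    let ?s = "\<Sum>i<e. r i * Z ^ i"
    have R: "\<forall>i<e. r i \<in> R" using r(1) by (simp add: Rf_def)
    have "P \<subseteq> IX" using mult_in' F(1) by (auto simp: P_def)
    then have "hom_component l h - (hom_component l h - ?s) \<in> IX" using diff_in hl r(2) by blast
    then have "\<delta> ?s \<in> J" by (simp add: J_def)
    then have "G dvd \<delta> ?s" using G(3) by blast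
    then have 0: "\<delta> ?s = 0" using dehom_powers(1)[OF R] deg dvd_imp_degree_le[of G "\<delta> ?s"] by linarith
    have "r i = 0" if "i < e" for i
      using dehom_inj_int[of "r i" "int l - int i"] r(1) dehom_powers(2)[OF R that] 0 that by (simp add: Rf_def)
    then show ?thesis using r(2) by simp
  qed
  moreover obtain N where "h = (\<Sum>l\<le>N. hom_component l h)" using ex_sum_hom_component[of h] by blast
  ultimately have "h \<in> P" using poly3_ideal.sum_in[OF poly3_ideal.intro[OF P]] by metis
  then show ?thesis by (auto simp: P_def)
qed

end

section \<open>Hilbert functions\<close>

lemma has_degree_one_increment:
  assumes "has_degree I 1 d"
  shows "d > 0" "\<exists>L. \<forall>l\<ge>L. hilbert_fun I (Suc l) = hilbert_fun I l + d"
proof -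
  obtain p :: "rat poly" where p: "degree p = 1" "fact 1 * lead_coeff p = of_nat d"
    and ev: "\<forall>\<^sub>F l in sequentially. of_nat (hilbert_fun I l) = poly p (of_nat l)"
    using assms unfolding has_degree_def by blast
  obtain a b where ab: "p = [:a, b:]" using p(1) by (metis degree1_coeffs One_nat_def)
  have b: "b = of_nat d" "b \<noteq> 0" using p by (auto simp: ab split: if_splits)
  then show "d > 0" by (cases d) auto
  obtain L where L: "\<And>l. l \<ge> L \<Longrightarrow> of_nat (hilbert_fun I l) = poly p (of_nat l)"
    using ev unfolding eventually_sequentially by blast
  have "hilbert_fun I (Suc l) = hilbert_fun I l + d" if "l \<ge> L" for l
  proof -
    have "(of_nat (hilbert_fun I (Suc l)) :: rat) = of_nat (hilbert_fun I l + d)"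
      using L[of l] L[of "Suc l"] that by (simp add: ab b algebra_simps)
    then show ?thesis using of_nat_eq_iff by blast
  qed
  then show "\<exists>L. \<forall>l\<ge>L. hilbert_fun I (Suc l) = hilbert_fun I l + d" by blast
qed

context coords
begin

lemma card_index_Suc: "card (index (Suc l)) = card (index l) + (l + 2)"
proof -
  have "index (Suc l) = index l \<union> (\<lambda>b. (b, Suc l - b)) ` {..Suc l}"
    by (auto simp: index_def image_iff)
  moreover have "index l \<inter> (\<lambda>b. (b, Suc l - b)) ` {..Suc l} = {}"
    by (auto simp: index_def)
  ultimately show ?thesis
    by (simp add: card_Un_disjoint card_image inj_on_def)
qed

lemma dim_mult_forms:
  assumes "F \<noteq> 0"
  shows "poly3.dim ((*) F ` forms (int l) :: 'k poly3 set) = card (index l)"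
proof (rule poly3.dim_unique)
  let ?B = "(\<lambda>x. F * basis l x) ` index l"
  have inj: "inj_on (\<lambda>x. F * basis l x) (index l)"
    using basis_inj[of l] assms by (auto simp: inj_on_def)
  show "?B \<subseteq> (*) F ` forms (int l)" using basis_in_forms by auto
  show "(*) F ` forms (int l) \<subseteq> poly3.span ?B"
  proof clarify
    fix f :: "'k poly3" assume "f \<in> forms (int l)"
    from forms_in_span_basis[OF this] show "F * f \<in> poly3.span ?B"
      by (rule mult_in_span) (auto intro: poly3.span_base)
  qed
  show "poly3.independent ?B"
  proof (rule poly3.independent_if_scalars_zero)
    fix C x assume *: "(\<Sum>x\<in>?B. scale (C x) x) = 0" "x \<in> ?B"
    then obtain b c where x: "x = F * basis l (b, c)" "(b, c) \<in> index l" by auto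
    have "F * (\<Sum>x\<in>index l. scale (C (F * basis l x)) (basis l x)) = 0"
      using *(1) by (simp add: sum.reindex[OF inj] sum_distrib_left scale_mult_right)
    then have "(\<Sum>x\<in>index l. scale (C (F * basis l x)) (basis l x)) = 0" using assms by simp
    then show "C x = 0"
      using coeff_dehom_basis_sum[OF x(2), of "\<lambda>x. C (F * basis l x)"] x by (simp add: dehom_simps)
  qed simp
  show "card ?B = card (index l)" by (rule card_image[OF inj])
qed

text \<open>Multiplication by F identifies the forms of degree l - e with the forms of degree l in
  I.\<close>

lemma hilbert_fun_principal:
  fixes F :: "'k poly3"
  assumes F: "F \<in> forms (int e)" "F \<noteq> 0" and I: "I = range ((*) F)" and l: "e \<le> l"
  shows "hilbert_fun I l = card (index l) - card (index (l - e))"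
proof -
  have "forms (int l) \<inter> I = (*) F ` forms (int (l - e))"
  proof
    show "(*) F ` forms (int (l - e)) \<subseteq> forms (int l) \<inter> I"
      using forms_mult[OF F(1), of _ "int (l - e)"] l by (auto simp: I)
    show "forms (int l) \<inter> I \<subseteq> (*) F ` forms (int (l - e))"
    proof
      fix h assume "h \<in> forms (int l) \<inter> I"
      then obtain g where h: "h \<in> forms (int l)" "h = F * g" by (auto simp: I)
      then have "h = hom_component l (g * F)"
        using hom_component_of_form[OF h(1)] by (simp add: mult.commute)
      also have "\<dots> = F * hom_component (l - e) g"
        using hom_component_mult_form[OF F(1), of l g] l
        by (simp add: mult.commute[of "hom_component (l - e) g"])
      finally show "h \<in> (*) F ` forms (int (l - e))" using hom_component_forms by blast
    qed
  qed
  then show ?thesis by (simp add: hilbert_fun_def dim_forms dim_mult_forms F)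
qed

text \<open>The Hilbert function of (F) grows by (l + 2) - (l - e + 2) = e.\<close>

lemma has_degree_principal:
  fixes F :: "'k poly3"
  assumes F: "F \<in> forms (int e)" "F \<noteq> 0" and I: "I = range ((*) F)" and deg: "has_degree I 1 d"
  shows "d = e"
proof -
  obtain L where L: "\<And>l. l \<ge> L \<Longrightarrow> hilbert_fun I (Suc l) = hilbert_fun I l + d"
    using has_degree_one_increment(2)[OF deg] by blast
  obtain l where l: "L \<le> l" "e \<le> l" using max.cobounded1 max.cobounded2 by blast
  have "l - e \<le> l" by simp
  then have "index (l - e) \<subseteq> index l" unfolding index_def by auto
  then have "card (index (l - e)) \<le> card (index l)" by (intro card_mono) auto
  moreover have "index (Suc l - e) \<subseteq> index (Suc l)" unfolding index_def by auto
  then have "card (index (Suc l - e)) \<le> card (index (Suc l))" by (intro card_mono) auto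
  moreover have "card (index (Suc l - e)) = card (index (l - e)) + (l - e + 2)"
    using card_index_Suc[of "l - e"] by (simp add: l Suc_diff_le)
  moreover have "card (index (Suc l)) = card (index l) + (l + 2)" by (rule card_index_Suc)
  ultimately show ?thesis
    using L[OF l(1)] hilbert_fun_principal[OF F I l(2)] hilbert_fun_principal[OF F I le_SucI[OF l(2)]] l
    by linarith
qed

text \<open>Without nonzero forms in I the Hilbert function would grow by l + 2 at l, which is not
  eventually constant.\<close>

lemma ex_form_of_degree_one:
  fixes I :: "'k poly3 set"
  assumes deg: "has_degree I 1 d"
  shows "\<exists>l. \<exists>f\<in>I \<inter> forms (int l). f \<noteq> 0"
proof (rule ccontr)
  assume "\<not> ?thesis"
  then have "forms (int l) \<inter> I \<subseteq> {0}" for l by blast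
  then have "poly3.dim (forms (int l) \<inter> I) = 0" for l
    using poly3.dim_le_card[of "forms (int l) \<inter> I" "{}"] by (simp add: poly3.span_empty)
  then have H: "hilbert_fun I l = card (index l)" for l by (simp add: hilbert_fun_def dim_forms)
  obtain L where "\<And>l. l \<ge> L \<Longrightarrow> hilbert_fun I (Suc l) = hilbert_fun I l + d"
    using has_degree_one_increment(2)[OF deg] by blast
  from this[of L] this[of "Suc L"] show False
    using card_index_Suc[of L] card_index_Suc[of "Suc L"] unfolding H by linarith
qed

text \<open>Modulo F and a linear form f in R, every form of degree l is a combination of L^(l-i)
  Z^i with i < e: F bounds the powers of Z, and f reduces R to powers of L. The Hilbert function
  would be bounded by e, against its growth by d > 0.\<close>

lemma no_line_in_curve:
  fixes I :: "'k poly3 set"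
  assumes I: "ideal I A2" and deg: "has_degree I 1 d"
    and F: "F \<in> I" "F \<in> forms (int e)" "ev w F \<noteq> 0" and e: "e > 0"
    and f: "f \<in> Rf 1" "f \<in> I"
  shows "f = 0"
proof (rule ccontr)
  interpret I: poly3_ideal I by (rule poly3_ideal.intro[OF I])
  assume "f \<noteq> 0"
  obtain q where q: "f = line q" using Rf_1_line[OF f(1)] by blast
  then have "ev q Y0 \<noteq> 0 \<or> ev q Y1 \<noteq> 0" using \<open>f \<noteq> 0\<close> line_nonzero by blast
  then obtain L where L: "L \<in> Rf 1" "ev q L = 1"
    and div: "\<And>m r. r \<in> Rf (int m) \<Longrightarrow> \<exists>s\<in>Rf (int m - 1). r = scale (ev q r) (L ^ m) + line q * s"
    using ex_unit_form by blast
  have bound: "hilbert_fun I l \<le> e" for l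
  proof -
    define W where "W = forms (int l) \<inter> I"
    \<comment> \<open>For i > l the exponent is truncated and the degree is wrong. This is harmless:
      the r_i in question are 0, and only the size of \<open>B\<close> counts.\<close>
    define B where "B = (\<lambda>i. L ^ (l - i) * Z ^ i) ` {..<e}"
    have "finite B" "card B \<le> e" unfolding B_def using card_image_le[of "{..<e}"] by auto
    obtain C where C: "C \<subseteq> W" "poly3.independent C" "W \<subseteq> poly3.span C" "card C = poly3.dim W"
      using poly3.basis_exists by blast
    have "C \<subseteq> poly3.span (basis l ` index l)"
      using C(1) forms_in_span_basis unfolding W_def by blast
    then have "finite C" using poly3.independent_span_bound[of "basis l ` index l" C] C(2) by simp
    have WBC: "W \<subseteq> poly3.span (B \<union> C)" using C(3) poly3.span_mono[of C "B \<union> C"] by blast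
    have "forms (int l) \<subseteq> poly3.span (B \<union> C)"
    proof
      fix h :: "'k poly3" assume h: "h \<in> forms (int l)"
      obtain r where r: "\<forall>i<e. r i \<in> Rf (int l - int i)" "h - (\<Sum>i<e. r i * Z ^ i) \<in> I"
        using reduce_powers[OF I F e h] by blast
      have "\<exists>s. r i = scale (ev q (r i)) (L ^ (l - i)) + f * s" if "i < e" for i
      proof (cases "i \<le> l")
        case True
        then have "r i \<in> Rf (int (l - i))" using r(1) that by (simp add: of_nat_diff)
        then show ?thesis using div q by blast
      next
        case False
        then have "r i = 0" using Rf_neg[of "int l - int i" "r i"] r(1) that by simp
        then show ?thesis by (intro exI[of _ 0]) (simp add: ev_simps)
      qed
      then obtain s where s: "\<And>i. i < e \<Longrightarrow> r i = scale (ev q (r i)) (L ^ (l - i)) + f * s i" by metis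
      define h' where "h' = (\<Sum>i<e. if i \<le> l then scale (ev q (r i)) (L ^ (l - i) * Z ^ i) else 0)"
      have h'B: "h' \<in> poly3.span (B \<union> C)"
        unfolding h'_def
      proof (rule poly3.span_sum)
        fix i assume "i \<in> {..<e}"
        then have "L ^ (l - i) * Z ^ i \<in> poly3.span (B \<union> C)"
          by (intro poly3.span_base) (simp add: B_def)
        then show "(if i \<le> l then scale (ev q (r i)) (L ^ (l - i) * Z ^ i) else 0) \<in> poly3.span (B \<union> C)"
          by (simp add: poly3.span_scale poly3.span_zero)
      qed
      have "h' \<in> forms (int l)" unfolding h'_def
      proof (rule forms_sum)
        fix i
        have "L ^ (l - i) * Z ^ i \<in> forms (int (l - i) + int i)"
          using L(1) lin by (intro forms_mult forms_power) (auto simp: Rf_def)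
        then show "(if i \<le> l then scale (ev q (r i)) (L ^ (l - i) * Z ^ i) else 0) \<in> forms (int l)"
          by (auto intro: forms_scale simp flip: of_nat_add)
      qed
      have "r i * Z ^ i - (if i \<le> l then scale (ev q (r i)) (L ^ (l - i) * Z ^ i) else 0) \<in> I" if i: "i < e" for i
      proof (cases "i \<le> l")
        case True
        have "r i * Z ^ i = (scale (ev q (r i)) (L ^ (l - i)) + f * s i) * Z ^ i" using s[OF i] by simp
        then have "r i * Z ^ i - scale (ev q (r i)) (L ^ (l - i) * Z ^ i) = f * s i * Z ^ i"
          by (simp add: distrib_right scale_mult_left)
        also have "\<dots> \<in> I" using f(2) by (intro I.mult_in')
        finally show ?thesis using True by simp
      next
        case False
        then have "r i = 0" using Rf_neg[of "int l - int i" "r i"] r(1) i by simp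
        then show ?thesis using False by (simp add: I.zero_in)
      qed
      then have "(\<Sum>i<e. r i * Z ^ i) - h' \<in> I"
        unfolding h'_def sum_subtractf[symmetric] by (intro I.sum_in) auto
      then have "(h - (\<Sum>i<e. r i * Z ^ i)) + ((\<Sum>i<e. r i * Z ^ i) - h') \<in> I"
        using r(2) I.add_in by blast
      then have "h - h' \<in> W" using h \<open>h' \<in> forms (int l)\<close> by (simp add: W_def forms_diff)
      then have "(h - h') + h' \<in> poly3.span (B \<union> C)" using WBC h'B poly3.span_add by blast
      then show "h \<in> poly3.span (B \<union> C)" by simp
    qed
    then have "poly3.dim (forms (int l) :: 'k poly3 set) \<le> card (B \<union> C)"
      using \<open>finite B\<close> \<open>finite C\<close> by (intro poly3.dim_le_card) auto
    also have "\<dots> \<le> e + poly3.dim W" using card_Un_le[of B C] \<open>card B \<le> e\<close> C(4) by simp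
    finally show ?thesis by (simp add: hilbert_fun_def W_def)
  qed
  obtain l where l: "\<And>m. m \<ge> l \<Longrightarrow> hilbert_fun I (Suc m) = hilbert_fun I m + d"
    using has_degree_one_increment(2)[OF deg] by blast
  have "hilbert_fun I (l + m) \<ge> m" for m
    using has_degree_one_increment(1)[OF deg] l by (induction m) (auto intro: Suc_leI)
  from this[of "Suc e"] bound[of "l + Suc e"] show False by simp
qed

end

section \<open>Generic lines\<close>

text \<open>Restriction to the line y = a through the centre w.\<close>

definition spec :: "'k::field \<Rightarrow> 'k poly poly \<Rightarrow> 'k poly" where
  "spec a g = map_poly (\<lambda>p. poly p a) g"

lemma coeff_spec: "coeff (spec a g) c = poly (coeff g c) a"
  by (simp add: spec_def coeff_map_poly)

lemma spec_add: "spec a (f + g) = spec a f + spec a g"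
  by (rule poly_eqI) (simp add: coeff_spec)

lemma spec_diff: "spec a (f - g) = spec a f - spec a g"
  by (rule poly_eqI) (simp add: coeff_spec)

lemma spec_mult: "spec a (f * g) = spec a f * spec a g"
  by (rule poly_eqI) (simp add: coeff_spec coeff_mult poly_sum)

lemma spec_const: "spec a [:p:] = [:poly p a:]"
  by (rule poly_eqI) (simp add: coeff_spec coeff_pCons split: nat.split)

lemma poly_spec: "poly (spec a g) b = poly (poly g [:b:]) a"
  by (induction g) (simp_all add: spec_def map_poly_pCons)

lemma pderiv_spec: "pderiv (spec a g) = spec a (pderiv g)"
  by (rule poly_eqI) (simp add: coeff_spec coeff_pderiv)

lemma infinite_UNIV_alg_closed: "infinite (UNIV :: 'k::alg_closed_field set)"
proof
  assume fin: "finite (UNIV :: 'k set)"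
  \<comment> \<open>Over a finite field this would have positive degree and take the value 1
    everywhere.\<close>
  define p where "p = (\<Prod>a\<in>(UNIV :: 'k set). [:- a, 1:]) + 1"
  have prod: "degree (\<Prod>a\<in>(UNIV :: 'k set). [:- a, 1:]) = card (UNIV :: 'k set)"
    by (subst degree_prod_eq_sum_degree) simp_all
  have "card (UNIV :: 'k set) > 0" using fin by (simp add: finite_UNIV_card_ge_0)
  then have "degree p > 0"
    unfolding p_def using prod degree_add_eq_left[of "1 :: 'k poly" "\<Prod>a\<in>(UNIV :: 'k set). [:- a, 1:]"] by simp
  then obtain x where x: "poly p x = 0" using alg_closed_imp_poly_has_root by blast
  have "poly (\<Prod>a\<in>(UNIV :: 'k set). [:- a, 1:]) x = 0"
    using fin by (simp add: poly_prod)
  then show False using x by (simp add: p_def)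
qed

lemma ex_nonroot:
  assumes "(p :: 'k::alg_closed_field poly) \<noteq> 0"
  shows "\<exists>a. poly p a \<noteq> 0"
  using poly_roots_finite[OF assms] infinite_UNIV_alg_closed by (metis (mono_tags, lifting) UNIV_I finite_subset mem_Collect_eq subsetI)

lemma ex_nonroot2:
  assumes "(g :: 'k::alg_closed_field poly poly) \<noteq> 0"
  shows "\<exists>a b. poly (poly g [:b:]) a \<noteq> 0"
proof -
  obtain a where a: "poly (lead_coeff g) a \<noteq> 0" using ex_nonroot[of "lead_coeff g"] assms by auto
  then have "spec a g \<noteq> 0" by (metis coeff_spec coeff_0)
  then obtain b where "poly (spec a g) b \<noteq> 0" using ex_nonroot by blast
  then show ?thesis by (auto simp: poly_spec)
qed

text \<open>Any point (1, a, b) can serve as the centre w.\<close>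

lemma coords_through:
  "coords (var 1 - scale a (var 0)) (var 2 - scale b (var 0)) (var 0)
     (\<lambda>i. if i = 1 then 1 else 0) (\<lambda>i. if i = 2 then 1 else 0)
     (\<lambda>i. if i = 0 then 1 else if i = 1 then a else (b :: 'k::field))"
proof
  fix i :: 3
  have "i = 0 \<or> i = 1 \<or> i = 2" using UNIV_3 by blast
  then show "var i = scale (if i = 1 then 1 else 0) (var 1 - scale a (var 0)) +
      scale (if i = 2 then 1 else 0) (var 2 - scale b (var 0)) +
      scale (if i = 0 then 1 else if i = 1 then a else b) (var 0)"
    by auto
qed (auto simp: ev_simps forms_diff forms_scale forms_var)

lemma coords_standard:
  "coords (var 0) (var 1) (var 2)
     (\<lambda>i. if i = 0 then 1 else 0) (\<lambda>i. if i = 1 then 1 else 0)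
     (\<lambda>i. if i = 2 then 1 else (0 :: 'k::field))"
proof
  fix i :: 3
  have "i = 0 \<or> i = 1 \<or> i = 2" using UNIV_3 by blast
  then show "var i = scale (if i = 0 then 1 else 0) (var 0) +
      scale (if i = 1 then 1 else 0) (var 1) +
      scale (if i = 2 then 1 else (0 :: 'k)) (var 2)"
    by auto
qed (auto simp: ev_simps forms_var)

lemma ex_curve_coords:
  fixes IX :: "'k::alg_closed_field poly3 set"
  assumes curve: "curve_of_degree IX d" and prime: "primeideal IX A2"
  shows "\<exists>Y0 Y1 Z u v w F. curve_coords Y0 Y1 Z u v w IX F d \<and> IX = range ((*) F)"
proof -
  have hom: "homogeneous_ideal IX" and deg: "has_degree IX 1 d" and ideal: "ideal IX A2"
    using curve by (auto simp: curve_of_degree_def closed_subscheme_def homogeneous_ideal_def)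
  interpret I: poly3_ideal IX by (rule poly3_ideal.intro[OF ideal])
  interpret S: coords "var 0" "var 1" "var 2" "\<lambda>i. if i = 0 then 1 else 0" "\<lambda>i. if i = 1 then 1 else 0"
      "\<lambda>i. if i = 2 then 1 else (0 :: 'k)"
    by (rule coords_standard)
  define e where "e = (LEAST l. \<exists>f\<in>IX \<inter> forms (int l). f \<noteq> 0)"
  obtain F where F: "F \<in> IX" "F \<in> forms (int e)" "F \<noteq> 0"
    using LeastI_ex[OF S.ex_form_of_degree_one[OF deg]] unfolding e_def by blast
  have min: "e \<le> m" if "f \<in> IX" "f \<in> forms (int m)" "f \<noteq> 0" for f m
    unfolding e_def by (rule Least_le) (use that in blast)
  have "S.\<delta> F \<noteq> 0" using S.dehom_inj[OF F(2)] F(3) by blast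
  \<comment> \<open>The centre can be chosen with first coordinate 1, since F does not vanish
    identically in that chart.\<close>
  then obtain a b where "poly (poly (S.\<delta> F) [:b:]) a \<noteq> 0" using ex_nonroot2 by blast
  then have "ev (\<lambda>i. (if i = 0 then 1 else 0) + a * (if i = 1 then 1 else 0) + b * (if i = 2 then 1 else 0)) F \<noteq> 0"
    by (simp add: poly_dehom)
  moreover have "(\<lambda>i :: 3. (if i = 0 then 1 else 0) + a * (if i = 1 then 1 else 0) + b * (if i = 2 then 1 else 0)) =
      (\<lambda>i. if i = 0 then 1 else if i = 1 then a else b)"
  proof
    fix i :: 3
    have "i = 0 \<or> i = 1 \<or> i = 2" using UNIV_3 by blast
    then show "(if i = 0 then 1 else 0) + a * (if i = 1 then 1 else 0) + b * (if i = 2 then 1 else 0) =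
      (if i = 0 then 1 else if i = 1 then a else b)" by auto
  qed
  ultimately have Fw: "ev (\<lambda>i. if i = 0 then 1 else if i = 1 then a else b) F \<noteq> 0" by simp
  interpret C: coords "var 1 - scale a (var 0)" "var 2 - scale b (var 0)" "var 0"
     "\<lambda>i. if i = 1 then 1 else 0" "\<lambda>i. if i = 2 then 1 else 0"
     "\<lambda>i. if i = 0 then 1 else if i = 1 then a else b"
    by (rule coords_through)
  have e: "e > 0"
  proof (rule ccontr)
    assume "\<not> e > 0"
    then have "F \<in> forms 0" using F(2) by simp
    then obtain c where c: "F = Poly_Mapping.single 0 c" using forms_0_const by blast
    then have "c \<noteq> 0" using F(3) by auto
    moreover have "scale (1 / c) F \<in> IX" using F(1) by (rule I.scale_in)
    ultimately have "1 \<in> IX" by (simp add: scale_def c mult_single)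
    then show False using prime by (simp add: primeideal_A2_iff)
  qed
  interpret CC: curve_coords "var 1 - scale a (var 0)" "var 2 - scale b (var 0)" "var 0"
     "\<lambda>i. if i = 1 then 1 else 0" "\<lambda>i. if i = 2 then 1 else 0"
     "\<lambda>i. if i = 0 then 1 else if i = 1 then a else b" IX F e
    by (intro curve_coords.intro C.coords_axioms curve_coords_axioms.intro hom prime F Fw
          C.no_line_in_curve[OF ideal deg F(1,2) Fw e])
  have "\<exists>g. h = F * g" if "h \<in> IX" for h
    by (rule CC.principal[OF _ that]) (rule min)
  then have IX: "IX = range ((*) F)" using I.mult_in'[OF F(1)] by blast
  have "d = e" by (rule S.has_degree_principal[OF F(2,3) IX deg])
  then show ?thesis using CC.curve_coords_axioms IX by blast
qed

section \<open>Lines that meet the curve in e distinct points\<close>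

lemma card_roots_separable:
  fixes p :: "'k::alg_closed_field poly"
  assumes "p \<noteq> 0" "\<And>z. poly p z = 0 \<Longrightarrow> poly (pderiv p) z \<noteq> 0"
  shows "card {z. poly p z = 0} = degree p"
  using assms
proof (induction "degree p" arbitrary: p)
  case 0
  then obtain c where "p = [:c:]" "c \<noteq> 0" by (metis degree_eq_zeroE pCons_0_0)
  then show ?case by simp
next
  case (Suc n)
  then have "degree p > 0" by linarith
  then obtain r where r: "poly p r = 0" using alg_closed_imp_poly_has_root by blast
  then obtain q where q: "p = [:- r, 1:] * q" by (auto simp: poly_eq_0_iff_dvd)
  have q0: "q \<noteq> 0" using Suc.prems(1) q by auto
  have deg: "degree p = Suc (degree q)" using q0 by (simp add: q degree_mult_eq del: mult_pCons_left)
  have pd: "pderiv p = q + [:- r, 1:] * pderiv q" unfolding q pderiv_mult by (simp add: pderiv_pCons)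
  have "poly q r \<noteq> 0" using Suc.prems(2)[OF r] by (simp add: pd)
  moreover have "{z. poly p z = 0} = insert r {z. poly q z = 0}" by (auto simp: q)
  moreover have "card {z. poly q z = 0} = degree q"
  proof (rule Suc.hyps(1)[OF _ q0])
    show "n = degree q" using deg Suc.hyps(2) by simp
    fix z assume "poly q z = 0"
    moreover from this have "poly p z = 0" by (simp add: q)
    then have "poly (q + [:- r, 1:] * pderiv q) z \<noteq> 0" using Suc.prems(2) pd by metis
    ultimately show "poly (pderiv q) z \<noteq> 0" by auto
  qed
  ultimately show ?case using poly_roots_finite[OF q0] by (simp add: deg)
qed

text \<open>N plays the role of the resultant. An element G of least degree in the ideal (f, g)
  satisfies c f = G q by pseudo-division. The prime f is too large in degree to divide G, so it
  divides q; cancelling f leaves c = G q', and G is constant.\<close>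

lemma elimination:
  fixes f g :: "'r::idom poly"
  assumes f: "prime_elem f" and g: "g \<noteq> 0" "degree g < degree f"
  shows "\<exists>N a b. N \<noteq> 0 \<and> [:N:] = a * f + b * g"
proof -
  define K where "K = {a * f + b * g | a b. True}"
  have Kdiff: "x * f - y * h \<in> K" if h: "h \<in> K" for x y h
  proof -
    obtain a b where "h = a * f + b * g" using h by (auto simp: K_def)
    then have "x * f - y * h = (x - y * a) * f + (- y * b) * g" by (simp add: algebra_simps)
    then show ?thesis unfolding K_def by blast
  qed
  have "0 * f + 1 * g \<in> K" unfolding K_def by blast
  then have gK: "g \<in> K" by simp
  define m where "m = (LEAST m. \<exists>h\<in>K. h \<noteq> 0 \<and> degree h = m)"
  have "\<exists>h\<in>K. h \<noteq> 0 \<and> degree h = m"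
    unfolding m_def by (rule LeastI_ex) (use gK g in blast)
  then obtain G where G: "G \<in> K" "G \<noteq> 0" "degree G = m" by blast
  have m_le: "m \<le> degree h" if "h \<in> K" "h \<noteq> 0" for h
    unfolding m_def by (rule Least_le) (use that in blast)
  obtain c q where c: "c \<noteq> 0" "smult c f = G * q + pseudo_mod f G"
    using pseudo_mod(1)[OF G(2)] by blast
  have "pseudo_mod f G = [:c:] * f - q * G" using c(2) by (simp add: algebra_simps)
  then have "pseudo_mod f G \<in> K" using Kdiff[OF G(1)] by metis
  then have "pseudo_mod f G = 0" using pseudo_mod(2)[OF G(2), of f] m_le G(3) by force
  then have cf: "[:c:] * f = G * q" using c(2) by simp
  have "\<not> f dvd G"
    using dvd_imp_degree_le[OF _ G(2)] G(3) m_le[OF gK g(1)] g(2) by fastforce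
  then have "f dvd q" using prime_elem_dvd_multD[OF f, of G q] cf by (metis dvd_triv_right)
  then obtain q' where q': "q = f * q'" by blast
  have "f \<noteq> 0" using f by auto
  then have "[:c:] = G * q'" using cf by (simp add: q' mult.left_commute mult.commute[of "[:c:]"] del: mult_pCons_left mult_pCons_right)
  moreover from this have "q' \<noteq> 0" using c(1) by auto
  ultimately have "degree G + degree q' = 0" using G(2) by (metis degree_mult_eq degree_pCons_0)
  then obtain N where "G = [:N:]" by (auto elim: degree_eq_zeroE)
  then show ?thesis using G(1,2) unfolding K_def by auto
qed

locale principal_curve = curve_coords Y0 Y1 Z u v w IX F e
  for Y0 Y1 Z :: "'k::{alg_closed_field, field_char_0} poly3" and u v w IX F e +
  assumes IX_eq: "IX = range ((*) F)"
begin

lemma J_eq: "g \<in> J \<longleftrightarrow> \<delta> F dvd g"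
proof
  assume "g \<in> J"
  then obtain h where "h \<in> IX" "g = \<delta> h" by (auto simp: J_def)
  then show "\<delta> F dvd g" using IX_eq by (auto simp: dehom_simps)
next
  assume "\<delta> F dvd g"
  then show "g \<in> J" using J_mult[of "\<delta> F"] F(1) by (auto simp: J_def mult.commute)
qed

lemma prime_elem_dehom: "prime_elem (\<delta> F)"
proof (rule prime_elemI)
  show "\<delta> F \<noteq> 0" using degree_dehom[OF F(2,3)] F(3) by auto
  show "\<not> is_unit (\<delta> F)" 
  proof
    assume "is_unit (\<delta> F)"
    then have "[:1:] \<in> J" unfolding J_eq by (simp add: one_pCons)
    then show False using J_const by fastforce
  qed
  show "\<delta> F dvd a * b \<Longrightarrow> \<delta> F dvd a \<or> \<delta> F dvd b" for a b
    using J_prime by (simp flip: J_eq)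
qed

text \<open>The leading coefficient of \<open>\<delta> F\<close> in z is the constant F(w), so it
  survives every restriction.\<close>

lemma degree_spec_F: "degree (spec a (\<delta> F)) = e"
proof (rule antisym)
  show "degree (spec a (\<delta> F)) \<le> e"
    by (rule degree_le) (simp add: coeff_spec coeff_eq_0 degree_dehom[OF F(2,3)])
  have "coeff (spec a (\<delta> F)) e = ev w F" by (simp add: coeff_spec coeff_dehom_top[OF F(2)])
  then show "e \<le> degree (spec a (\<delta> F))" using F(3) by (intro le_degree) simp
qed

text \<open>z is eliminated from \<open>\<delta> F\<close> and its z-derivative, which is nonzero in
  characteristic 0. Off the finitely many zeros of N they have no common root, so all e roots are
  simple.\<close>

lemma infinite_separable_lines: "infinite {a. card {b. poly (spec a (\<delta> F)) b = 0} = e}"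
proof -
  have d: "degree (\<delta> F) = e" by (rule degree_dehom[OF F(2,3)])
  have "pderiv (\<delta> F) \<noteq> 0" using e_pos d by (simp add: pderiv_eq_0_iff)
  moreover have "degree (pderiv (\<delta> F)) < degree (\<delta> F)" using e_pos d by (simp add: degree_pderiv)
  ultimately obtain N a b where N: "N \<noteq> 0" "[:N:] = a * \<delta> F + b * pderiv (\<delta> F)"
    using elimination[OF prime_elem_dehom] by blast
  have "card {z. poly (spec y (\<delta> F)) z = 0} = e" if y: "poly N y \<noteq> 0" for y
  proof -
    have "poly (pderiv (spec y (\<delta> F))) z \<noteq> 0" if "poly (spec y (\<delta> F)) z = 0" for z
    proof
      assume "poly (pderiv (spec y (\<delta> F))) z = 0"
      then have "poly (spec y [:N:]) z = 0" using that by (simp add: N(2) spec_add spec_mult pderiv_spec)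
      then show False using y by (simp add: spec_const)
    qed
    moreover have "spec y (\<delta> F) \<noteq> 0" using degree_spec_F[of y] e_pos by auto
    ultimately show ?thesis using card_roots_separable degree_spec_F by metis
  qed
  then have "UNIV - {y. poly N y = 0} \<subseteq> {a. card {b. poly (spec a (\<delta> F)) b = 0} = e}" by blast
  moreover have "infinite (UNIV - {y. poly N y = 0})"
    using poly_roots_finite[OF N(1)] infinite_UNIV_alg_closed by (rule Diff_infinite_finite)
  ultimately show ?thesis using finite_subset by blast
qed

lemma ex_points:
  "\<exists>a z. inj (a :: nat \<Rightarrow> 'k) \<and> (\<forall>j. inj_on (z j) {..<e} \<and> (\<forall>i<e. poly (spec (a j) (\<delta> F)) (z j i) = 0))"
proof -
  obtain a :: "nat \<Rightarrow> 'k" where a: "inj a" "range a \<subseteq> {a. card {b. poly (spec a (\<delta> F)) b = 0} = e}"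
    using infinite_countable_subset[OF infinite_separable_lines] by blast
  have "\<exists>z. bij_betw z {..<e} {b. poly (spec (a j) (\<delta> F)) b = 0}" for j
  proof -
    have "card {b. poly (spec (a j) (\<delta> F)) b = 0} = e" using a(2) by blast
    then show ?thesis using e_pos ex_bij_betw_nat_finite[of "{b. poly (spec (a j) (\<delta> F)) b = 0}"]
      by (metis card_gt_0_iff lessThan_atLeast0)
  qed
  then obtain z where z: "\<And>j. bij_betw (z j) {..<e} {b. poly (spec (a j) (\<delta> F)) b = 0}" by metis
  have "inj_on (z j) {..<e} \<and> (\<forall>i<e. poly (spec (a j) (\<delta> F)) (z j i) = 0)" for j
    using z[of j] unfolding bij_betw_def by blast
  then show ?thesis using a(1) by blast
qed

end

section \<open>Forms vanishing at the points\<close>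

text \<open>The degree bound is put on the coefficients so that m = 0 is covered.\<close>

lemma poly_eq_0_if_roots:
  fixes p :: "'k::field poly"
  assumes "inj_on z {..<m}" "\<And>i. i < m \<Longrightarrow> poly p (z i) = 0" "\<And>c. c \<ge> m \<Longrightarrow> coeff p c = 0"
  shows "p = 0"
proof (rule ccontr)
  assume p: "p \<noteq> 0"
  then have "degree p < m" using assms(3) by (metis leading_coeff_0_iff not_le)
  moreover have "z ` {..<m} \<subseteq> {x. poly p x = 0}" using assms(2) by auto
  then have "card (z ` {..<m}) \<le> card {x. poly p x = 0}"
    by (rule card_mono[OF poly_roots_finite[OF p]])
  then have "m \<le> degree p" using card_image[OF assms(1)] card_poly_roots_bound[OF p] by simp
  ultimately show False by simp
qed

text \<open>Each coefficient of g is divisible by y - a. As this is monic, the top y-coefficient of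
  the quotient reappears one degree higher in g, so the total degree drops by one.\<close>

lemma spec_eq_0_factor:
  assumes "spec a g = 0" "tdeg_less (Suc s) g"
  shows "\<exists>h. g = smult [:- a, 1:] h \<and> tdeg_less s h"
proof -
  have "[:- a, 1:] dvd coeff g c" for c
    using arg_cong[OF assms(1), of "\<lambda>p. coeff p c"] by (simp add: coeff_spec flip: poly_eq_0_iff_dvd)
  then have "[:[:- a, 1:]:] dvd g" by (simp add: const_poly_dvd_iff)
  then obtain h where "g = [:[:- a, 1:]:] * h" by blast
  then have h: "g = smult [:- a, 1:] h" by simp
  have "coeff (coeff h c) b = 0" if "s \<le> b + c" for b c
  proof (rule ccontr)
    assume *: "coeff (coeff h c) b \<noteq> 0"
    then have h0: "coeff h c \<noteq> 0" by auto
    define m where "m = degree (coeff h c)"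
    have "b \<le> m" using * by (simp add: m_def le_degree)
    then have "coeff (coeff g c) (Suc m) = 0" using assms(2) that by (simp add: tdeg_less_def)
    moreover have "coeff (coeff g c) (Suc m) = coeff (coeff h c) m"
      by (simp add: h m_def coeff_eq_0)
    ultimately show False using h0 by (simp add: m_def)
  qed
  then show ?thesis using h by (auto simp: tdeg_less_def)
qed

lemma forms_prod: "(\<And>i. f i \<in> forms 1) \<Longrightarrow> (\<Prod>i<n. f i) \<in> forms (int n)"
proof (induction n)
  case (Suc n)
  then show ?case using forms_mult[of "\<Prod>i<n. f i" "int n" "f n" 1] by (simp add: add.commute)
qed (simp add: forms_1)

lemma tdeg_less_diff: "tdeg_less s f \<Longrightarrow> tdeg_less s g \<Longrightarrow> tdeg_less s (f - g)"
  by (simp add: tdeg_less_def)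

lemma tdeg_less_mono: "tdeg_less s f \<Longrightarrow> s \<le> t \<Longrightarrow> tdeg_less t f"
  by (simp add: tdeg_less_def)

text \<open>Line j is y = a j, and z j i for i < e lists its points on X. \<open>lam\<close> is the
  hypothesis on the sequence, rewritten for \<mu> i = n i - i.\<close>

locale lines_on_curve = principal_curve Y0 Y1 Z u v w IX F e
  for Y0 Y1 Z :: "'k::{alg_closed_field, field_char_0} poly3" and u v w IX F e +
  fixes a :: "nat \<Rightarrow> 'k" and z :: "nat \<Rightarrow> nat \<Rightarrow> 'k" and \<mu> :: "nat \<Rightarrow> nat"
  assumes inj_a: "inj a" and inj_z: "inj_on (z j) {..<e}"
    and root: "i < e \<Longrightarrow> poly (spec (a j) (\<delta> F)) (z j i) = 0"
    and lam: "Suc i < e \<Longrightarrow> \<mu> (Suc i) \<le> \<mu> i \<and> \<mu> i \<le> \<mu> (Suc i) + 1"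
begin

lemma lam_antimono: "i \<le> j \<Longrightarrow> j < e \<Longrightarrow> \<mu> j \<le> \<mu> i"
proof (induction j)
  case (Suc j)
  then show ?case using lam[of j] by (cases "i = Suc j") auto
qed simp

text \<open>In other words, i + \<mu> i is weakly increasing.\<close>

lemma lam_drop: "i + t < e \<Longrightarrow> \<mu> i \<le> \<mu> (i + t) + t"
proof (induction t)
  case (Suc t)
  then show ?case using lam[of "i + t"] by simp
qed simp

text \<open>The restriction of g to the line has degree at most s and min(e, s + 1) known zeros. If
  e \<le> s + 1, these are all the zeros of F there, so F divides the restriction; otherwise they
  outnumber the degree, and it is 0. Subtracting a multiple of F leaves a multiple of the
  line.\<close>

lemma peel_line:
  assumes g: "tdeg_less (Suc s) g"
    and van: "\<And>i. i < e \<Longrightarrow> i < Suc s \<Longrightarrow> poly (spec (a j) g) (z j i) = 0"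
  shows "\<exists>C h. g = C * \<delta> F + smult [:- a j, 1:] h \<and> tdeg_less s h"
proof -
  let ?f = "spec (a j) (\<delta> F)" and ?p = "spec (a j) g"
  have high: "coeff ?p c = 0" if "c \<ge> Suc s" for c
  proof -
    have "coeff g c = 0" using g that by (intro poly_eqI) (simp add: tdeg_less_def)
    then show ?thesis by (simp add: coeff_spec)
  qed
  have deg: "degree ?f = e" by (rule degree_spec_F)
  then have f0: "?f \<noteq> 0" using e_pos by auto
  have "\<exists>c. ?p = c * ?f"
  proof (cases "e \<le> Suc s")
    case True
    have "?p mod ?f = 0"
    proof (rule poly_eq_0_if_roots[OF inj_z[of j]])
      fix i assume i: "i < e"
      have "poly (?p div ?f * ?f + ?p mod ?f) (z j i) = poly ?p (z j i)"
        by (simp only: div_mult_mod_eq)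
      then show "poly (?p mod ?f) (z j i) = 0"
        using van[OF i] root[OF i, of j] i True by (simp only: poly_add poly_mult) simp
    next
      fix c assume "e \<le> c"
      then show "coeff (?p mod ?f) c = 0"
        using degree_mod_less[OF f0, of ?p] deg by (auto intro: coeff_eq_0)
    qed
    then have "?p = ?p div ?f * ?f" by (metis add.right_neutral div_mult_mod_eq)
    then show ?thesis by blast
  next
    case False
    then have "inj_on (z j) {..<Suc s}" using inj_z[of j] by (auto intro: inj_on_subset)
    then have "?p = 0" using van high False by (intro poly_eq_0_if_roots[of "z j" "Suc s"]) auto
    then show ?thesis by (intro exI[of _ 0]) simp
  qed
  then obtain c where c: "?p = c * ?f" by blast
  \<comment> \<open>The quotient c, a polynomial in z, is lifted with coefficients constant in
    y.\<close>
  define C where "C = map_poly (\<lambda>x. [:x:]) c"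
  have C: "coeff C i = [:coeff c i:]" for i by (simp add: C_def coeff_map_poly)
  have "spec (a j) C = c" by (rule poly_eqI) (simp add: coeff_spec C)
  then have 0: "spec (a j) (g - C * \<delta> F) = 0" by (simp add: spec_diff spec_mult c)
  \<comment> \<open>The subtracted multiple must respect the degree bound: deg c + e is the degree
    of the restriction of g, hence at most s.\<close>
  have "tdeg_less (Suc s) (C * \<delta> F)"
  proof (cases "c = 0")
    case True
    then have "C = 0" by (simp add: C_def)
    then show ?thesis by (simp add: tdeg_less_def)
  next
    case False
    then have "degree ?p = degree c + e" using f0 by (simp add: c degree_mult_eq deg)
    moreover have "?p \<noteq> 0" using False f0 by (simp add: c)
    ultimately have le: "degree c + e \<le> s" using high[of "degree ?p"] by (metis leading_coeff_0_iff not_less_eq_eq)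
    have "tdeg_less (Suc (degree c)) C"
      by (auto simp: tdeg_less_def C coeff_pCons coeff_eq_0 split: nat.split)
    then obtain C' where "C' \<in> forms (int (degree c))" "\<delta> C' = C" using dehom_surj by blast
    then have "tdeg_less (Suc (degree c + e)) (C * \<delta> F)"
      using dehom_tdeg_less[of "C' * F" "degree c + e"] forms_mult[of C' "int (degree c)" F "int e"] F(2)
      by (simp add: dehom_simps)
    then show ?thesis using le by (auto intro: tdeg_less_mono)
  qed
  then have "tdeg_less (Suc s) (g - C * \<delta> F)" using g by (intro tdeg_less_diff)
  then obtain h where "g - C * \<delta> F = smult [:- a j, 1:] h" "tdeg_less s h"
    using spec_eq_0_factor[OF 0] by blast
  then show ?thesis by (metis add.commute diff_add_cancel)
qed

text \<open>Induction on j - j0: splitting off line j0 lowers the degree bound and the number of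
  remaining lines together. For j0 = j the restriction to line j has degree less than i and i zeros,
  so it is 0.\<close>

lemma vanishing_dehom:
  assumes "i < e" "j0 \<le> j" "j < \<mu> i" "tdeg_less (i + (j - j0)) g"
    "\<And>j' i'. j0 \<le> j' \<Longrightarrow> j' < j \<Longrightarrow> i' < e \<Longrightarrow> j' < \<mu> i' \<Longrightarrow> poly (spec (a j') g) (z j' i') = 0"
    "\<And>i'. i' < i \<Longrightarrow> poly (spec (a j) g) (z j i') = 0"
  shows "poly (spec (a j) g) (z j i) = 0"
  using assms(2,4-)
proof (induction "j - j0" arbitrary: j0 g)
  case 0
  then have "tdeg_less i g" by simp
  then have "coeff g c = 0" if "c \<ge> i" for c
    using that by (intro poly_eqI) (simp add: tdeg_less_def)
  then have "spec (a j) g = 0"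
    using 0 assms(1) inj_z[of j]
    by (intro poly_eq_0_if_roots[of "z j" i]) (auto simp: coeff_spec intro: inj_on_subset)
  then show ?case by simp
next
  case (Suc k)
  define s where "s = i + k"
  have j0: "j0 < j" and k: "k = j - Suc j0" using Suc.hyps(2) by auto
  have g: "tdeg_less (Suc s) g" using Suc.prems(2) unfolding Suc.hyps(2)[symmetric] by (simp add: s_def)
  have "poly (spec (a j0) g) (z j0 i') = 0" if i': "i' < e" "i' < Suc s" for i'
  proof -
    \<comment> \<open>All points needed on line j0 are selected: those up to i because \<mu> is
      decreasing, those beyond because \<mu> loses at most one per step and at most k = j - j0 - 1
      steps are taken.\<close>
    have "j0 < \<mu> i'"
    proof (cases "i' \<le> i")
      case True
      then show ?thesis using lam_antimono[OF True assms(1)] assms(3) j0 by simp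
    next
      case False
      then obtain t where t: "i' = i + t" "t \<le> k" using i'(2) by (metis add_le_cancel_left le_add_diff_inverse less_Suc_eq_le nle_le s_def)
      then show ?thesis using lam_drop[of i t] i'(1) assms(3) j0 k by simp
    qed
    then show ?thesis using Suc.prems(3)[of j0 i'] i' j0 by simp
  qed
  then obtain C h where h: "g = C * \<delta> F + smult [:- a j0, 1:] h" "tdeg_less s h"
    using peel_line[OF g] by blast
  \<comment> \<open>The multiple of F vanishes at the chosen points, so g and h differ there by the
    factor a j' - a j0, nonzero on all later lines.\<close>
  have eval: "poly (spec (a j') g) (z j' i') = (a j' - a j0) * poly (spec (a j') h) (z j' i')" if "i' < e" for j' i'
  proof -
    have "g = C * \<delta> F + [:[:- a j0, 1:]:] * h" using h(1) by simp
    then show ?thesis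
      using root[OF that, of j'] by (simp only: spec_add spec_mult spec_const poly_add poly_mult) simp
  qed
  have neq: "a j' - a j0 \<noteq> 0" if "j0 < j'" for j'
    using inj_a that by (auto dest: injD)
  have "poly (spec (a j) h) (z j i) = 0"
  proof (rule Suc.hyps(1)[OF k])
    show "Suc j0 \<le> j" using j0 by simp
    show "tdeg_less (i + (j - Suc j0)) h" using h(2) k by (simp add: s_def)
    show "poly (spec (a j') h) (z j' i') = 0" if "Suc j0 \<le> j'" "j' < j" "i' < e" "j' < \<mu> i'" for j' i'
      using Suc.prems(3)[of j' i'] eval[OF that(3), of j'] neq[of j'] that by simp
    show "poly (spec (a j) h) (z j i') = 0" if "i' < i" for i'
      using Suc.prems(4)[OF that] eval[of i' j] neq[OF j0] that assms(1) by simp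
  qed
  then show ?case using eval[OF assms(1), of j] by simp
qed

definition pt :: "nat \<Rightarrow> nat \<Rightarrow> 3 \<Rightarrow> 'k" where
  "pt j i = (\<lambda>k. u k + a j * v k + z j i * w k)"

lemma ev_pt: "ev (pt j i) h = poly (spec (a j) (\<delta> h)) (z j i)"
  by (simp add: pt_def poly_spec poly_dehom)

lemma ev_pt_coords: "ev (pt j i) Y0 = 1" "ev (pt j i) Y1 = a j" "ev (pt j i) Z = z j i"
  by (simp_all add: ev_pt poly_spec dehom_coords)

lemma pt_nonzero: "pt j i \<noteq> (\<lambda>_. 0)"
proof
  assume "pt j i = (\<lambda>_. 0)"
  then have "ev (\<lambda>_. 0) Y0 = 1" using ev_pt_coords(1)[of j i] by simp
  moreover have "ev (\<lambda>_. 0) Y0 = 0" using forms_1_expand[OF lin(1)] by (auto simp: ev_simps)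
  ultimately show False by simp
qed

lemma IX_vanishes_pt:
  assumes "i < e"
  shows "IX \<subseteq> points_ideal {pt j i}"
proof -
  have "ev (pt j i) F = 0" using root[OF assms] by (simp add: ev_pt)
  then have "cone (pt j i) F = 0" using cone_form[OF F(2)] by simp
  then show ?thesis unfolding IX_eq by (auto simp: points_ideal_def cone_simps)
qed

text \<open>The order is line by line, and by i on each line; \<open>before j e\<close> equals
  \<open>before (Suc j) 0\<close>, which chains the lines together.\<close>

definition before :: "nat \<Rightarrow> nat \<Rightarrow> (3 \<Rightarrow> 'k) set" where
  "before j i = {pt j' i' | j' i'. i' < e \<and> j' < \<mu> i' \<and> (j' < j \<or> j' = j \<and> i' < i)}"

lemma forms_vanish_pt:
  assumes "i < e" "j < \<mu> i" "h \<in> points_ideal (before j i)" "h \<in> forms (int t)" "t < i + j"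
  shows "ev (pt j i) h = 0"
  unfolding ev_pt
proof (rule vanishing_dehom[OF assms(1) _ assms(2), of 0])
  have van: "ev q h = 0" if "q \<in> before j i" for q
    using ev_point_ideal[OF assms(3) that] .
  show "tdeg_less (i + (j - 0)) (\<delta> h)"
    using dehom_tdeg_less[OF assms(4)] assms(5) by (auto intro: tdeg_less_mono)
  show "poly (spec (a j') (\<delta> h)) (z j' i') = 0" if "j' < j" "i' < e" "j' < \<mu> i'" for j' i'
    using van[of "pt j' i'"] that unfolding before_def ev_pt by blast
  show "poly (spec (a j) (\<delta> h)) (z j i') = 0" if "i' < i" for i'
  proof -
    have "j < \<mu> i'" using lam_antimono[of i' i] that assms(1,2) by simp
    then show ?thesis using van[of "pt j i'"] that assms(1) unfolding before_def ev_pt by force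
  qed
qed simp

lemma ex_nonvanishing_form:
  assumes "i < e"
  shows "\<exists>f\<in>points_ideal (before j i). f \<in> forms (int (i + j)) \<and> ev (pt j i) f \<noteq> 0"
proof -
  define A where "A = (\<Prod>j'<j. Y1 - scale (a j') Y0)"
  \<comment> \<open>These lines avoid w and cut out the points (j, i') on line j; the earlier lines
    are taken care of by \<open>A\<close>.\<close>
  define B where "B = (\<Prod>i'<i. Z - scale (z j i') Y0)"
  have "A \<in> forms (int j)" unfolding A_def
    by (intro forms_prod forms_diff forms_scale lin)
  moreover have "B \<in> forms (int i)" unfolding B_def
    by (intro forms_prod forms_diff forms_scale lin)
  ultimately have form: "A * B \<in> forms (int (i + j))"
    using forms_mult[of A "int j" B "int i"] by (simp add: add.commute)
  have evA: "ev (pt j' i') A = (\<Prod>k<j. a j' - a k)" for j' i'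
    unfolding A_def by (induction j) (simp_all add: ev_simps ev_pt_coords)
  have evB: "ev (pt j i') B = (\<Prod>k<i. z j i' - z j k)" for i'
    unfolding B_def by (induction i) (simp_all add: ev_simps ev_pt_coords)
  have "ev q (A * B) = 0" if "q \<in> before j i" for q
    using that unfolding before_def by (auto simp: ev_simps evA evB)
  then have "A * B \<in> points_ideal (before j i)" using form_in_points_ideal_iff[OF form] by blast
  moreover have "ev (pt j i) (A * B) \<noteq> 0"
  proof -
    have "z j i \<noteq> z j k" if "k < i" for k
      using inj_onD[OF inj_z[of j], of i k] that assms by auto
    then show ?thesis using inj_a by (auto simp: ev_simps evA evB inj_on_def)
  qed
  ultimately show ?thesis using form by blast
qed

end

section \<open>Admissible pairs of linear forms\<close>

definition vec :: "'k \<Rightarrow> 'k \<Rightarrow> 'k \<Rightarrow> 3 \<Rightarrow> 'k" where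
  "vec x y z i = (if i = 0 then x else if i = 1 then y else z)"

lemma vec_simps [simp]: "vec x y z 0 = x" "vec x y z 1 = y" "vec x y z 2 = z"
  by (simp_all add: vec_def)

definition cross :: "(3 \<Rightarrow> 'k::comm_ring) \<Rightarrow> (3 \<Rightarrow> 'k) \<Rightarrow> 3 \<Rightarrow> 'k" where
  "cross a b = vec (a 1 * b 2 - a 2 * b 1) (a 2 * b 0 - a 0 * b 2) (a 0 * b 1 - a 1 * b 0)"

definition lin_form :: "(3 \<Rightarrow> 'k::field) \<Rightarrow> 'k poly3" where
  "lin_form a = (\<Sum>i\<in>UNIV. scale (a i) (var i))"

lemma lin_form_forms: "lin_form a \<in> forms 1"
  unfolding lin_form_def by (intro forms_sum forms_scale forms_var)

lemma ev_lin_form: "ev q (lin_form a) = a 0 * q 0 + a 1 * q 1 + a 2 * q 2"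
  by (simp add: lin_form_def sum_3 ev_simps)

text \<open>Cramer's rule: if the determinant of a, b, c is 1, the cross products form the dual
  basis.\<close>

lemma coords_cross:
  fixes a b c :: "3 \<Rightarrow> 'k::field"
  assumes "c 0 * cross a b 0 + c 1 * cross a b 1 + c 2 * cross a b 2 = 1"
  shows "coords (lin_form a) (lin_form b) (lin_form c) (cross b c) (cross c a) (cross a b)"
proof
  have det: "c 0 * (a 1 * b 2 - a 2 * b 1) + c 1 * (a 2 * b 0 - a 0 * b 2) + c 2 * (a 0 * b 1 - a 1 * b 0) = 1"
    using assms by (simp add: cross_def)
  have inv: "\<forall>i k. cross b c i * a k + cross c a i * b k + cross a b i * c k = (if i = k then 1 else 0)"
    unfolding forall_3 using det by (simp add: cross_def) (simp add: algebra_simps)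
  show "var i = scale (cross b c i) (lin_form a) + scale (cross c a i) (lin_form b) + scale (cross a b i) (lin_form c)" for i
  proof -
    have "scale (cross b c i) (lin_form a) + scale (cross c a i) (lin_form b) + scale (cross a b i) (lin_form c) =
        (\<Sum>k\<in>UNIV. scale (cross b c i * a k + cross c a i * b k + cross a b i * c k) (var k))"
      by (simp add: lin_form_def poly3.scale_sum_right scale_add_left sum.distrib scale_scale)
    also have "\<dots> = (\<Sum>k\<in>UNIV. if i = k then var k else 0)"
      by (intro sum.cong) (simp_all add: inv)
    finally show ?thesis by (simp add: sum.delta)
  qed
qed (use assms in \<open>simp_all add: lin_form_forms ev_lin_form cross_def algebra_simps\<close>)

text \<open>The conditions on \<open>p k\<close> and \<open>r k\<close> make \<open>p + t r\<close> nonzero for every \<open>t\<close>.\<close>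

lemma ex_common_zeros:
  fixes a b :: "3 \<Rightarrow> 'k::field"
  assumes "cross a b = (\<lambda>_. 0)"
  shows "\<exists>p r k. ev p (lin_form a) = 0 \<and> ev r (lin_form a) = 0 \<and> ev p (lin_form b) = 0 \<and>
    ev r (lin_form b) = 0 \<and> p k \<noteq> 0 \<and> r k = 0 \<and> r \<noteq> (\<lambda>_. 0)"
proof -
  have c: "a 1 * b 2 = a 2 * b 1" "a 2 * b 0 = a 0 * b 2" "a 0 * b 1 = a 1 * b 0"
    using fun_cong[OF assms, of 0] fun_cong[OF assms, of 1] fun_cong[OF assms, of 2]
    by (simp_all add: cross_def)
  have *: "\<exists>p r k. ev p (lin_form a) = 0 \<and> ev r (lin_form a) = 0 \<and> ev p (lin_form b) = 0 \<and>
    ev r (lin_form b) = 0 \<and> p k \<noteq> 0 \<and> r k = 0 \<and> r \<noteq> (\<lambda>_. 0)"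
    if a: "a \<noteq> (\<lambda>_. 0)" and c: "a 1 * b 2 = a 2 * b 1" "a 2 * b 0 = a 0 * b 2" "a 0 * b 1 = a 1 * b 0"
    for a b :: "3 \<Rightarrow> 'k"
  proof -
    have "\<not> (\<forall>i. a i = 0)" using a by auto
    then consider "a 0 \<noteq> 0" | "a 1 \<noteq> 0" | "a 2 \<noteq> 0" unfolding forall_3 by blast
    then show ?thesis
    proof cases
      case 1
      then show ?thesis
        by (intro exI[of _ "vec (- a 1) (a 0) 0"] exI[of _ "vec (- a 2) 0 (a 0)"] exI[of _ 1])
          (use c in \<open>auto simp: ev_lin_form algebra_simps fun_eq_iff forall_3\<close>)
    next
      case 2
      then show ?thesis
        by (intro exI[of _ "vec (a 1) (- a 0) 0"] exI[of _ "vec 0 (- a 2) (a 1)"] exI[of _ 0])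
          (use c in \<open>auto simp: ev_lin_form algebra_simps fun_eq_iff forall_3\<close>)
    next
      case 3
      then show ?thesis
        by (intro exI[of _ "vec (a 2) 0 (- a 0)"] exI[of _ "vec 0 (a 2) (- a 1)"] exI[of _ 0])
          (use c in \<open>auto simp: ev_lin_form algebra_simps fun_eq_iff forall_3\<close>)
    qed
  qed
  consider "a \<noteq> (\<lambda>_. 0)" | "b \<noteq> (\<lambda>_. 0)" | "a = (\<lambda>_. 0)" "b = (\<lambda>_. 0)" by blast
  then show ?thesis
  proof cases
    case 1 then show ?thesis using *[OF _ c] by blast
  next
    case 2
    then show ?thesis using *[of b a] c by (simp add: mult.commute) blast
  next
    case 3
    then show ?thesis
      by (intro exI[of _ "vec 1 0 0"] exI[of _ "vec 0 1 0"] exI[of _ 0])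
        (auto simp: ev_lin_form fun_eq_iff forall_3)
  qed
qed

text \<open>F(p + t r) is a polynomial in t whose coefficient at t^e is F(r). If this is nonzero,
  the degree is positive and there is a root.\<close>

lemma ex_zero_on_line:
  fixes F :: "'k::alg_closed_field poly3"
  assumes F: "F \<in> forms (int e)" "e > 0"
  shows "ev r F = 0 \<or> (\<exists>t. ev (\<lambda>i. p i + t * r i) F = 0)"
proof -
  let ?\<psi> = "psubst (\<lambda>a. [:a:]) (\<lambda>i. [:p i, r i:])"
  have \<psi>: "degree (?\<psi> h) \<le> l \<and> coeff (?\<psi> h) l = ev r h" if "h \<in> forms (int l)" for h l
    using that
  proof (induction rule: forms_induct)
    case (const c) then show ?case by (simp add: hom_C.psubst_const ev_simps)
  next
    case (var l i g)
    have "degree ([:p i, r i:] * ?\<psi> g) \<le> Suc l"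
      using degree_mult_le[of "[:p i, r i:]" "?\<psi> g"] degree_pCons_le[of "p i" "[:r i:]"] var by simp
    moreover have "coeff (?\<psi> g) (Suc l) = 0" using var by (simp add: coeff_eq_0)
    ultimately show ?case using var by (simp add: hom_C.psubst_mult hom_C.psubst_var ev_simps)
  next
    case (add l f g)
    then show ?case by (simp add: hom_C.psubst_add ev_simps degree_add_le)
  qed
  have ev\<psi>: "poly (?\<psi> h) t = ev (\<lambda>i. p i + t * r i) h" for h t
  proof (induction h rule: poly3_induct)
    case (single m c)
    show ?case by (simp add: ev_def hom_C.psubst_single hom_id.psubst_single poly_prod)
  next
    case (add f g) then show ?case by (simp add: hom_C.psubst_add ev_simps)
  qed
  show ?thesis
  proof (cases "ev r F = 0")
    case False
    then have "degree (?\<psi> F) \<ge> e" using \<psi>[OF F(1)] by (intro le_degree) simp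
    then have "degree (?\<psi> F) > 0" using F(2) by simp
    then obtain t where "poly (?\<psi> F) t = 0" using alg_closed_imp_poly_has_root by blast
    then show ?thesis by (auto simp: ev\<psi>)
  qed simp
qed

context curve_coords
begin

text \<open>Dependent forms would vanish on a whole line, which meets X, against admissibility. So
  \<open>cross a b\<close> is nonzero; being a common zero of the two forms, it lies off X.\<close>

lemma admissible_coords:
  assumes IX_eq: "IX = range ((*) F)" and adm: "admissible IX Y0' Y1'"
  shows "\<exists>Z' u' v' w'. coords Y0' Y1' Z' u' v' w' \<and> ev w' F \<noteq> 0"
proof -
  have no_zero: False if "q \<noteq> (\<lambda>_. 0)" "ev q Y0' = 0" "ev q Y1' = 0" "ev q F = 0" for q
  proof -
    have "cone q F = 0" using cone_form[OF F(2)] that(4) by simp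
    then have "IX \<subseteq> points_ideal {q}" unfolding IX_eq by (auto simp: points_ideal_def cone_simps)
    then have "points_ideal {q} \<in> proj_points IX"
      using point_ideal_in_proj_points that(1) by blast
    moreover have "Y0' \<in> points_ideal {q}" "Y1' \<in> points_ideal {q}"
      using adm form_in_points_ideal_iff[of Y0' 1] form_in_points_ideal_iff[of Y1' 1] that(2,3) by (auto simp: admissible_def)
    ultimately show False using adm unfolding admissible_def no_common_zero_def by blast
  qed
  obtain a b where Y: "Y0' = lin_form a" "Y1' = lin_form b"
    using adm forms_1_expand[of Y0'] forms_1_expand[of Y1'] by (auto simp: admissible_def lin_form_def)
  have nz: "cross a b \<noteq> (\<lambda>_. 0)"
  proof
    assume "cross a b = (\<lambda>_. 0)"
    then obtain p r k where pr: "ev p Y0' = 0" "ev r Y0' = 0" "ev p Y1' = 0" "ev r Y1' = 0"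
      "p k \<noteq> 0" "r k = 0" "r \<noteq> (\<lambda>_. 0)"
      using ex_common_zeros[of a b] unfolding Y by blast
    have lin: "ev (\<lambda>i. p i + t * r i) (lin_form c) = ev p (lin_form c) + t * ev r (lin_form c)" for t c
      by (simp add: ev_lin_form algebra_simps)
    show False using ex_zero_on_line[OF F(2) e_pos, of r p]
    proof
      assume "ev r F = 0"
      then show False using no_zero pr by blast
    next
      assume "\<exists>t. ev (\<lambda>i. p i + t * r i) F = 0"
      then obtain t where t: "ev (\<lambda>i. p i + t * r i) F = 0" by blast
      have "(\<lambda>i. p i + t * r i) \<noteq> (\<lambda>_. 0)" using pr(5,6) by (auto simp: fun_eq_iff intro!: exI[of _ k])
      then show False using no_zero[OF _ _ _ t] pr(1-4) by (simp add: Y lin)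
    qed
  qed
  from nz obtain i where i: "cross a b i \<noteq> 0" by auto
  \<comment> \<open>A nonzero coordinate of \<open>cross a b\<close> is used to normalise the
    determinant to 1.\<close>
  define c where "c j = (if j = i then 1 / cross a b i else 0)" for j
  have "(\<Sum>j\<in>UNIV. c j * cross a b j) = (\<Sum>j\<in>UNIV. if j = i then 1 else 0)"
    using i by (intro sum.cong) (auto simp: c_def)
  then have "c 0 * cross a b 0 + c 1 * cross a b 1 + c 2 * cross a b 2 = 1"
    by (simp add: sum_3[of "\<lambda>j. c j * cross a b j"] sum.delta)
  then have C: "coords Y0' Y1' (lin_form c) (cross b c) (cross c a) (cross a b)"
    unfolding Y by (rule coords_cross)
  moreover have "ev (cross a b) F \<noteq> 0"
    using no_zero[OF nz] coords.dual[OF C] by blast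
  ultimately show ?thesis by blast
qed

text \<open>A point P of X containing Y0 and Y1 contains all terms of F except F(w) Z^e, since their
  coefficients in R have positive degree. So P contains Z, and with it all variables.\<close>

lemma admissible_self: "admissible IX Y0 Y1"
proof -
  have "\<not> (Y0 \<in> P \<and> Y1 \<in> P)" if P: "P \<in> proj_points IX" for P
  proof
    assume Y: "Y0 \<in> P \<and> Y1 \<in> P"
    have prime: "primeideal P A2" and FP: "F \<in> P" and var: "\<exists>i. var i \<notin> P"
      using P F(1) by (auto simp: proj_points_def)
    interpret P: poly3_ideal P using prime by (intro poly3_ideal.intro) (simp add: primeideal_A2_iff)
    have pow: "a ^ n \<in> P \<Longrightarrow> a \<in> P" for a n
      using prime by (induction n) (auto simp: primeideal_A2_iff)
    obtain r where r: "\<forall>i<e. r i \<in> Rf (int e - int i)" "F = scale (ev w F) (Z ^ e) + (\<Sum>i<e. r i * Z ^ i)"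
      using expand_powers[OF F(2)] by blast
    have pos: "x \<in> P" if "x \<in> Rf (int (Suc m))" for x m
      using Rf_in_span[OF that]
    proof (induction rule: poly3.span_induct_alt)
      case base then show ?case by (rule P.zero_in)
    next
      case (step c x y)
      then obtain a b where x: "x = Y0 ^ a * Y1 ^ b" "a + b = Suc m" by blast
      then consider a' where "a = Suc a'" | b' where "b = Suc b'" by (cases a) auto
      then have "x \<in> P"
      proof cases
        case 1
        then show ?thesis unfolding x(1) power_Suc using Y by (simp add: P.mult_in')
      next
        case 2
        then have "Y1 ^ b \<in> P" using Y by (simp add: P.mult_in')
        then show ?thesis unfolding x(1) by (rule P.mult_in)
      qed
      then show ?case using step by (intro P.add_in P.scale_in)
    qed
    have "(\<Sum>i<e. r i * Z ^ i) \<in> P"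
    proof (intro P.sum_in P.mult_in')
      fix i assume "i \<in> {..<e}"
      then have "r i \<in> Rf (int e - int i)" "int e - int i = int (Suc (e - i - 1))" using r(1) by auto
      then show "r i \<in> P" using pos by metis
    qed
    then have "F - (\<Sum>i<e. r i * Z ^ i) \<in> P" using FP P.diff_in by blast
    moreover have "F - (\<Sum>i<e. r i * Z ^ i) = scale (ev w F) (Z ^ e)" using r(2) by (metis add_diff_cancel_right')
    ultimately have "scale (ev w F) (Z ^ e) \<in> P" by simp
    then have "scale (1 / ev w F) (scale (ev w F) (Z ^ e)) \<in> P" by (rule P.scale_in)
    then have "Z \<in> P" using F(3) pow by (simp add: scale_scale)
    then have "var i \<in> P" for i using Y by (simp add: var_eq P.add_in P.scale_in)
    then show False using var by blast
  qed
  then show ?thesis using lin by (auto simp: admissible_def no_common_zero_def)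
qed

end

section \<open>Adding the points one by one\<close>

lemma (in two_forms) graded_basis_cong:
  assumes "graded_basis IX I d n e" "\<And>i. i < d \<Longrightarrow> n i = n' i"
  shows "graded_basis IX I d n' e"
proof (rule graded_basisI)
  have eq: "(\<forall>i<d. r i \<in> Rf (l - int (n' i))) \<longleftrightarrow> (\<forall>i<d. r i \<in> Rf (l - int (n i)))" for r l
    using assms(2) by simp
  show "r i = 0" if "\<forall>i<d. r i \<in> Rf (l - int (n' i))" "(\<Sum>i<d. r i * e i) \<in> IX" "i < d" for l r i
    using graded_basis_unique[OF assms(1)] that unfolding eq by blast
  show "\<exists>r. (\<forall>i<d. r i \<in> Rf (l - int (n' i))) \<and> h - (\<Sum>i<d. r i * e i) \<in> IX"
    if "h \<in> I" "h \<in> forms l" for l h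
    using graded_basis_span[OF assms(1) that] unfolding eq .
qed (use graded_basis_form[OF assms(1)] assms(2) in simp_all)

context lines_on_curve
begin

definition pts :: "(3 \<Rightarrow> 'k) set" where
  "pts = {pt j i | j i. i < e \<and> j < \<mu> i}"

lemma finite_pts: "finite pts"
proof -
  have "pts = (\<lambda>(i, j). pt j i) ` (SIGMA i:{..<e}. {..<\<mu> i})" by (auto simp: pts_def)
  then show ?thesis by simp
qed

lemma IX_vanishes_pts: "IX \<subseteq> points_ideal pts"
  using IX_vanishes_pt unfolding pts_def points_ideal_def by blast

text \<open>The degree attached to x is x plus the number of points with second index x imposed so
  far. The points come from the fixed coordinates, while the module is taken over any pair whose
  common zero lies off X.\<close>

lemma graded_basis_before:
  fixes Y0' Y1' Z' :: "'k poly3"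
  assumes C: "coords Y0' Y1' Z' u' v' w'" and Fw: "ev w' F \<noteq> 0"
    and i: "i \<le> e"
  shows "\<exists>b. two_forms.graded_basis Y0' Y1' IX (points_ideal (before j i)) e
     (\<lambda>x. x + min (\<mu> x) (if x < i then Suc j else j)) b"
proof -
  interpret C: coords Y0' Y1' Z' u' v' w' by (rule C)
  \<comment> \<open>If both forms vanished at q, then F(q) = 0 would reduce to F(w') Z'(q)^e = 0;
    all coordinates would vanish, and q would be 0.\<close>
  have no_base_point: "C.line q \<noteq> 0" if q: "q \<in> pts" for q
  proof -
    have "ev q Y0' \<noteq> 0 \<or> ev q Y1' \<noteq> 0"
    proof (rule ccontr)
      assume *: "\<not> (ev q Y0' \<noteq> 0 \<or> ev q Y1' \<noteq> 0)"
      obtain r where r: "\<forall>i<e. r i \<in> C.Rf (int e - int i)" "F = scale (ev w' F) (Z' ^ e) + (\<Sum>i<e. r i * Z' ^ i)"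
        using C.expand_powers[OF F(2)] by blast
      have q0: "q \<noteq> (\<lambda>_. 0)" using q pt_nonzero by (auto simp: pts_def)
      have "ev q F = 0" using q IX_vanishes_pts F(1) ev_point_ideal by blast
      moreover have "ev q (r i) = 0" if "i < e" for i
      proof -
        have "r i \<in> C.Rf (int (Suc (e - i - 1)))" using r(1) that by (simp add: of_nat_diff)
        from C.Rf_in_span[OF this] show ?thesis
        proof (induction rule: poly3.span_induct_alt)
          case base show ?case by (simp add: ev_simps)
        next
          case (step c x y)
          then obtain a b where "x = Y0' ^ a * Y1' ^ b" "a + b = Suc (e - i - 1)" by blast
          then have "ev q x = 0" using * by (cases a) (auto simp: ev_simps)
          then show ?case using step by (simp add: ev_simps)
        qed
      qed
      then have "ev q (\<Sum>i<e. r i * Z' ^ i) = 0" by (simp add: ev_simps)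
      moreover have "ev q F = ev q (scale (ev w' F) (Z' ^ e) + (\<Sum>i<e. r i * Z' ^ i))" using r(2) by simp
      ultimately have "ev q Z' = 0" using Fw by (simp add: ev_simps)
      then have "q i = 0" for i
        using arg_cong[OF C.var_eq[of i], of "ev q"] * by (simp add: ev_simps)
      then show False using q0 by auto
    qed
    then show ?thesis using C.line_nonzero by blast
  qed
  have step: "\<exists>b. C.graded_basis IX (points_ideal (before j (Suc i))) e
      (\<lambda>x. x + min (\<mu> x) (if x < Suc i then Suc j else j)) b"
    if gb: "C.graded_basis IX (points_ideal (before j i)) e (\<lambda>x. x + min (\<mu> x) (if x < i then Suc j else j)) b"
      and i: "i < e" for i j b
  proof (cases "j < \<mu> i")
    case False
    \<comment> \<open>The point (j, i) is not selected: neither the ideal nor the degrees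
      change.\<close>
    then have "before j (Suc i) = before j i"
      unfolding before_def by (auto simp: less_Suc_eq)
    moreover have "x + min (\<mu> x) (if x < i then Suc j else j) = x + min (\<mu> x) (if x < Suc i then Suc j else j)" for x
      using False by (auto simp: less_Suc_eq)
    ultimately show ?thesis using gb by auto
  next
    case True
    let ?n = "\<lambda>x. x + min (\<mu> x) (if x < i then Suc j else j)"
    have n: "?n i = i + j" using True by simp
    have "before j (Suc i) = insert (pt j i) (before j i)"
      unfolding before_def using True i by (auto simp: less_Suc_eq)
    then have I: "points_ideal (before j (Suc i)) = points_ideal (before j i) \<inter> points_ideal {pt j i}"
      by (auto simp: points_ideal_def)
    obtain f where f: "f \<in> points_ideal (before j i)" "f \<in> forms (int (i + j))" "ev (pt j i) f \<noteq> 0"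
      using ex_nonvanishing_form[OF i] by blast
    have "pt j i \<in> pts" using True i by (auto simp: pts_def)
    \<comment> \<open>The least degree of a form that is nonzero at the new point is i + j, the
      current degree at index i; so that entry increases.\<close>
    then have "\<exists>b. C.graded_basis IX (points_ideal (before j i) \<inter> points_ideal {pt j i}) e (?n(i := Suc (?n i))) b"
      using C.graded_basis_add_point[OF gb ideal_points_ideal ideal IX_vanishes_pt[OF i] no_base_point i f(1) _ f(3)]
        f(2) forms_vanish_pt[OF i True] unfolding n by blast
    moreover have "(?n(i := Suc (?n i))) x = x + min (\<mu> x) (if x < Suc i then Suc j else j)" for x
      using True by (auto simp: less_Suc_eq)
    ultimately show ?thesis unfolding I by (metis (mono_tags, lifting) C.graded_basis_cong)
  qed
  have row: "\<exists>b. C.graded_basis IX (points_ideal (before j i)) e (\<lambda>x. x + min (\<mu> x) (if x < i then Suc j else j)) b"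
    if "\<exists>b. C.graded_basis IX (points_ideal (before j 0)) e (\<lambda>x. x + min (\<mu> x) j) b" "i \<le> e" for i j
    using that(2)
  proof (induction i)
    case 0 then show ?case using that(1) by simp
  next
    case (Suc i) then show ?case using step[of j i] by auto
  qed
  have start: "\<exists>b. C.graded_basis IX (points_ideal (before j 0)) e (\<lambda>x. x + min (\<mu> x) j) b" for j
  proof (induction j)
    case 0
    have "before 0 0 = {}" by (auto simp: before_def)
    then have "points_ideal (before 0 0) = UNIV" by (auto simp: points_ideal_def)
    moreover have "C.graded_basis IX UNIV e (\<lambda>i. i) (\<lambda>i. Z' ^ i)"
      by (rule C.graded_basis_powers[OF ideal _ F(1,2) Fw e_pos]) (use IX_eq in blast)
    ultimately show ?case by auto
  next
    case (Suc j)
    obtain b where b: "C.graded_basis IX (points_ideal (before j e)) e (\<lambda>x. x + min (\<mu> x) (if x < e then Suc j else j)) b"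
      using row[OF Suc, of e] by blast
    have "before j e = before (Suc j) 0" unfolding before_def by (auto simp: less_Suc_eq)
    then have "C.graded_basis IX (points_ideal (before (Suc j) 0)) e (\<lambda>x. x + min (\<mu> x) (Suc j)) b"
      using C.graded_basis_cong[OF b, of "\<lambda>x. x + min (\<mu> x) (Suc j)"] by simp
    then show ?case by blast
  qed
  show ?thesis by (rule row[OF start i])
qed

lemma graded_basis_pts:
  assumes "coords Y0' Y1' Z' u' v' w'" "ev w' F \<noteq> 0"
  shows "\<exists>b. two_forms.graded_basis Y0' Y1' IX (points_ideal pts) e (\<lambda>i. i + \<mu> i) b"
proof -
  interpret C: coords Y0' Y1' Z' u' v' w' by (rule assms(1))
  \<comment> \<open>Any common bound of the \<mu> i serves: no line from there on carries a selected
    point.\<close>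
  define j where "j = (\<Sum>i<e. \<mu> i)"
  have le: "\<mu> i \<le> j" if "i < e" for i
    unfolding j_def using that by (intro member_le_sum) auto
  have "before j 0 = pts"
    unfolding before_def pts_def using le by fastforce
  moreover obtain b where "C.graded_basis IX (points_ideal (before j 0)) e (\<lambda>x. x + min (\<mu> x) (if x < 0 then Suc j else j)) b"
    using graded_basis_before[OF assms, of 0 j] by blast
  ultimately have "C.graded_basis IX (points_ideal pts) e (\<lambda>i. i + \<mu> i) b"
    using C.graded_basis_cong[of IX "points_ideal pts" e _ b "\<lambda>i. i + \<mu> i"] le by (simp add: min_absorb1)
  then show ?thesis by blast
qed

lemma relative_characteristic_sequence_pts:
  assumes "\<And>i. i < e \<Longrightarrow> n i = int (i + \<mu> i)"
  shows "relative_characteristic_sequence IX (points_ideal pts) e n"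
  unfolding relative_characteristic_sequence_def
proof (intro conjI allI impI)
  show "mono_on {..<e} n"
  proof (rule mono_onI)
    fix i j assume ij: "i \<in> {..<e}" "j \<in> {..<e}" "i \<le> j"
    then obtain t where t: "j = i + t" using le_Suc_ex by blast
    then show "n i \<le> n j" using lam_drop[of i t] assms[of i] assms[of j] ij by simp
  qed
  show "\<exists>Y0 Y1. admissible IX Y0 Y1" using admissible_self by blast
  fix Y0' Y1' assume "admissible IX Y0' Y1'"
  then obtain Z' u' v' w' where C: "coords Y0' Y1' Z' u' v' w'" "ev w' F \<noteq> 0"
    using admissible_coords[OF IX_eq] by blast
  interpret C: coords Y0' Y1' Z' u' v' w' by (rule C(1))
  obtain b where "C.graded_basis IX (points_ideal pts) e (\<lambda>i. i + \<mu> i) b"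
    using graded_basis_pts[OF C] by blast
  then obtain \<phi> where "graded_iso IX (points_ideal pts) Y0' Y1' e (\<lambda>i. int (i + \<mu> i)) \<phi>"
    using C.graded_basis_iso[OF _ homogeneous_points_ideal hom IX_vanishes_pts] by blast
  moreover have "free_module_part Y0' Y1' e n l = free_module_part Y0' Y1' e (\<lambda>i. int (i + \<mu> i)) l" for l
    unfolding free_module_part_def using assms by (intro PiE_cong) simp
  ultimately show "\<exists>\<phi>. graded_iso IX (points_ideal pts) Y0' Y1' e n \<phi>"
    unfolding graded_iso_def by auto
qed

end

theorem mainTheorem11:
  fixes IX :: "'k::{alg_closed_field, field_char_0} poly3 set"
    and d :: nat
    and n :: "nat \<Rightarrow> int"
  assumes "curve_of_degree IX d"
    and "primeideal IX A2"
    and "\<And>i. i < d \<Longrightarrow> n i \<ge> int i"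
    and "\<And>i. Suc i < d \<Longrightarrow> n i \<le> n (Suc i) \<and> n (Suc i) \<le> n i + 1"
  shows "\<exists>IY. group_of_points_on IY IX \<and> relative_characteristic_sequence IX IY d n"
proof -
  obtain Y0 Y1 Z u v w F where C: "curve_coords Y0 Y1 Z u v w IX F d" "IX = range ((*) F)"
    using ex_curve_coords[OF assms(1,2)] by blast
  interpret principal_curve Y0 Y1 Z u v w IX F d
    using C by (intro principal_curve.intro principal_curve_axioms.intro)
  obtain a z where az: "inj (a :: nat \<Rightarrow> 'k)" "\<And>j. inj_on (z j) {..<d}"
    "\<And>i j. i < d \<Longrightarrow> poly (spec (a j) (\<delta> F)) (z j i) = 0"
    using ex_points by blast
  \<comment> \<open>For i < d nothing is lost by \<open>nat\<close>, because n i \<ge> i.\<close>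
  define \<mu> where "\<mu> i = nat (n i - int i)" for i
  have n: "n i = int (i + \<mu> i)" if "i < d" for i
    using assms(3)[OF that] by (simp add: \<mu>_def)
  have step: "\<mu> (Suc i) \<le> \<mu> i \<and> \<mu> i \<le> \<mu> (Suc i) + 1" if "Suc i < d" for i
    using assms(4)[OF that] n[OF that] n[of i] that by simp
  interpret lines_on_curve Y0 Y1 Z u v w IX F d a z \<mu>
    using az step by unfold_locales auto
  have "group_of_points_on (points_ideal pts) IX"
    using finite_pts IX_vanishes_pts pt_nonzero
    by (intro group_of_points_points_ideal) (auto simp: pts_def)
  moreover have "relative_characteristic_sequence IX (points_ideal pts) d n"
    by (rule relative_characteristic_sequence_pts[OF n])
  ultimately show ?thesis by blast
qed

end
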